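(* (Kerr-AdS control map and crossover.) For $\chi>0$, $j>0$ let $\mathcal R(\chi,j)=\chi^3+2\chi^2+\chi+4j^2+4j^2/\chi$, $m=\frac12\sqrt{\mathcal R}$, $\sigma=\pi\chi$, regard $m$ as a function of $(\sigma,j)$, and let $\mathcal I_K(\sigma;\tau,j)=m(\sigma,j)/\tau-\sigma$. Let $\chi_c$ be the unique positive root of $8\chi^3+10\chi^2+2\chi-1=0$, $\sigma_c=\pi\chi_c$, $j_c=\chi_c^2/2$, $\tau_c=m_\sigma(\sigma_c,j_c)$, and $\widehat a_{4,K}=\frac{1}{\pi^3\chi_c(2\chi_c^2+4\chi_c+1)}$. A subscript $c$ denotes evaluation at $(\sigma_c,j_c)$. Put $\Delta\tau=\tau-\tau_c$, $\Delta j=j-j_c$, with common order $\Delta$, and $$w_K=\frac{\Delta\tau-m_{\sigma j,c}\,\Delta j}{\tau_c},\qquad u_K=\frac{m_{\sigma\sigma j,c}}{2\tau_c}\,\Delta j .$$ 1. There is an analytic translation $\sigma-\sigma_c=y+\mathcal O(\Delta j)$, removing the leading control-dependent cubic term, such that, as $(y,\Delta\tau,\Delta j)\to0$, $$\mathcal I_K=\mathcal I_{K,0}(\tau,j)-w_Ky+u_Ky^2+\widehat a_{4,K}y^4+\mathcal O(y^5,\Delta y^3,\Delta^2y),$$ where $\mathcal I_{K,0}(\tau,j)$ is independent of $y$. 2. $m_{\sigma j,c}<0$ and $m_{\sigma\sigma j,c}>0$. Hence the linear map $(\Delta\tau,\Delta j)\mapsto(w_K,u_K)$ is nonsingular. The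 zero-field tangent $w_K=0$ is $\Delta\tau=m_{\sigma j,c}\Delta j$, and on it $\Delta j>0$ gives $u_K>0$. 3. Fix $\lambda_K\ge0$ and, for small $g>0$, choose $(\tau,j)$ on the zero-field tangent $\Delta\tau=m_{\sigma j,c}\Delta j$ with $u_K=\lambda_K\sqrt{\widehat a_{4,K}\,g}$ (so $\Delta j=\mathcal O(g^{1/2})$). Then, as $g\to0^+$, $$\frac{\bar F-F_{\mathrm{cl}}}{T_E}=\Phi(\lambda_K)+o(1),$$ where $$\Phi(\lambda)=\frac14-\frac\lambda2\frac{d}{d\lambda}\ln\int_{-\infty}^\infty e^{-x^4-\lambda x^2}dx,\qquad \Phi(0)=\frac14,\quad \Phi(\infty)=\frac12 .$$
   Context: This is the four-dimensional Kerr-AdS canonical reduced ensemble at fixed angular momentum $J$ and AdS radius $L$, with entropy $S$, mass $M$ and temperature $T_E$, in dimensionless variables $g=G_N/L^2$, $\sigma=gS$, $j=gJ$, $m=G_NM/L$, $\tau=LT_E$. Subscripts $\sigma,j$ on $m$ denote partial derivatives. The generalized free energy is $F_{\mathrm{gen}}=M-T_ES$ and the reduced action is $I_E=F_{\mathrm{gen}}/T_E=\mathcal I_K/g$. The measure is the energy measure $m_\sigma\,d\sigma$ over the nonextremal branch $\sigma>\sigma_e(j)$, where $\sigma_e(j)$ is the positive value of $\sigma$ at which $m_\sigma(\sigma,j)=0$. The average is $\bar F=\int_{\sigma_e(j)}^\infty F_{\mathrm{gen}}m_\sigma e^{-I_E}d\sigma\big/\int_{\sigma_e(j)}^\infty m_\sigma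 e^{-I_E}d\sigma$. $F_{\mathrm{cl}}$ is the value of $F_{\mathrm{gen}}$ at its global minimum on this branch at the same $(\tau,j)$. The notation $\mathcal O(y^5,\Delta y^3,\Delta^2y)$ means a sum of terms bounded by constants times $|y|^5$, $|\Delta||y|^3$, $|\Delta|^2|y|$, with $|\Delta|=|\Delta\tau|+|\Delta j|$. $\Phi(\infty)$ means $\lim_{\lambda\to\infty}\Phi(\lambda)$. *)

theory Defs
  imports "HOL-Analysis.Analysis" "HOL-Library.Landau_Symbols"
begin

definition R_K :: "real \<Rightarrow> real \<Rightarrow> real" where
  "R_K x j = x ^ 3 + 2 * x\<^sup>2 + x + 4 * j\<^sup>2 + 4 * j\<^sup>2 / x"

definition m_K :: "real \<Rightarrow> real \<Rightarrow> real" where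
  "m_K \<sigma> j = sqrt (R_K (\<sigma> / pi) j) / 2"

definition m_\<sigma> :: "real \<Rightarrow> real \<Rightarrow> real" where
  "m_\<sigma> \<sigma> j = deriv (\<lambda>s. m_K s j) \<sigma>"

definition m_\<sigma>\<sigma> :: "real \<Rightarrow> real \<Rightarrow> real" where
  "m_\<sigma>\<sigma> \<sigma> j = deriv (\<lambda>s. m_\<sigma> s j) \<sigma>"

definition m_\<sigma>j :: "real \<Rightarrow> real \<Rightarrow> real" where
  "m_\<sigma>j \<sigma> j = deriv (\<lambda>k. m_\<sigma> \<sigma> k) j"

definition m_\<sigma>\<sigma>j :: "real \<Rightarrow> real \<Rightarrow> real" where
  "m_\<sigma>\<sigma>j \<sigma> j = deriv (\<lambda>k. m_\<sigma>\<sigma> \<sigma> k) j"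

definition I_K :: "real \<Rightarrow> real \<Rightarrow> real \<Rightarrow> real" where
  "I_K \<sigma> \<tau> j = m_K \<sigma> j / \<tau> - \<sigma>"


definition chi\<^sub>c :: real where
  "chi\<^sub>c = (THE x. x > 0 \<and> 8 * x ^ 3 + 10 * x\<^sup>2 + 2 * x - 1 = 0)"

definition \<sigma>\<^sub>c :: real where "\<sigma>\<^sub>c = pi * chi\<^sub>c"

definition j\<^sub>c :: real where "j\<^sub>c = chi\<^sub>c\<^sup>2 / 2"

definition \<tau>\<^sub>c :: real where "\<tau>\<^sub>c = m_\<sigma> \<sigma>\<^sub>c j\<^sub>c"

definition a4_K :: real where
  "a4_K = 1 / (pi ^ 3 * chi\<^sub>c * (2 * chi\<^sub>c\<^sup>2 + 4 * chi\<^sub>c + 1))"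

definition w_K :: "real \<Rightarrow> real \<Rightarrow> real" where
  "w_K \<Delta>\<tau> \<Delta>j = (\<Delta>\<tau> - m_\<sigma>j \<sigma>\<^sub>c j\<^sub>c * \<Delta>j) / \<tau>\<^sub>c"

definition u_K :: "real \<Rightarrow> real" where
  "u_K \<Delta>j = m_\<sigma>\<sigma>j \<sigma>\<^sub>c j\<^sub>c / (2 * \<tau>\<^sub>c) * \<Delta>j"

definition \<sigma>\<^sub>e :: "real \<Rightarrow> real" where
  "\<sigma>\<^sub>e j = (THE \<sigma>. \<sigma> > 0 \<and> m_\<sigma> \<sigma> j = 0)"


text \<open>The dimensionful quantities are recovered from \<open>g\<close>, \<open>\<sigma>\<close>, \<open>j\<close>, \<open>m\<close>, \<open>\<tau>\<close> and the AdS
  radius \<open>L\<close>: Newton's constant is \<open>g L\<^sup>2\<close>.\<close>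

definition G_N :: "real \<Rightarrow> real \<Rightarrow> real" where
  "G_N L g = g * L\<^sup>2"

definition mass :: "real \<Rightarrow> real \<Rightarrow> real \<Rightarrow> real \<Rightarrow> real" where
  "mass L g j \<sigma> = L * m_K \<sigma> j / G_N L g"

definition entropy :: "real \<Rightarrow> real \<Rightarrow> real" where
  "entropy g \<sigma> = \<sigma> / g"

definition T_E :: "real \<Rightarrow> real \<Rightarrow> real" where
  "T_E L \<tau> = \<tau> / L"

definition F_gen :: "real \<Rightarrow> real \<Rightarrow> real \<Rightarrow> real \<Rightarrow> real \<Rightarrow> real" where
  "F_gen L g \<tau> j \<sigma> = mass L g j \<sigma> - T_E L \<tau> * entropy g \<sigma>"

definition I_E :: "real \<Rightarrow> real \<Rightarrow> real \<Rightarrow> real \<Rightarrow> real \<Rightarrow> real" where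
  "I_E L g \<tau> j \<sigma> = F_gen L g \<tau> j \<sigma> / T_E L \<tau>"

definition F_avg :: "real \<Rightarrow> real \<Rightarrow> real \<Rightarrow> real \<Rightarrow> real" where
  "F_avg L g \<tau> j =
     (LBINT \<sigma>:{\<sigma>\<^sub>e j<..}. F_gen L g \<tau> j \<sigma> * m_\<sigma> \<sigma> j * exp (- I_E L g \<tau> j \<sigma>)) /
     (LBINT \<sigma>:{\<sigma>\<^sub>e j<..}. m_\<sigma> \<sigma> j * exp (- I_E L g \<tau> j \<sigma>))"

definition F_cl :: "real \<Rightarrow> real \<Rightarrow> real \<Rightarrow> real \<Rightarrow> real" where
  "F_cl L g \<tau> j = F_gen L g \<tau> j (arg_min_on (F_gen L g \<tau> j) {\<sigma>\<^sub>e j<..})"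

definition \<Phi> :: "real \<Rightarrow> real" where
  "\<Phi> l = 1 / 4 - l / 2 * deriv (\<lambda>k. ln (LBINT x. exp (- (x ^ 4) - k * x\<^sup>2))) l"


lemma I_E_eq_I_K:
  assumes "L > 0" "g > 0" "\<tau> > 0"
  shows "I_E L g \<tau> j \<sigma> = I_K \<sigma> \<tau> j / g"
  using assms
  by (simp add: I_E_def F_gen_def mass_def entropy_def T_E_def G_N_def I_K_def
      field_simps power2_eq_square)

lemma chi\<^sub>c_unique: "\<exists>!x::real. x > 0 \<and> 8 * x ^ 3 + 10 * x\<^sup>2 + 2 * x - 1 = 0"
proof -
  let ?p = "\<lambda>x::real. 8 * x ^ 3 + 10 * x\<^sup>2 + 2 * x - 1"
  have mono: "?p x < ?p y" if "0 \<le> x" "x < y" for x y :: real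
    using power_strict_mono[OF that(2,1), of 3] power_strict_mono[OF that(2,1), of 2] that
    by simp
  have "\<exists>x\<ge>0. x \<le> 1 \<and> ?p x = 0"
    by (rule IVT') (auto intro!: continuous_intros)
  then obtain x where x: "0 \<le> x" "?p x = 0" by blast
  moreover have "x \<noteq> 0" using x by auto
  ultimately have "0 < x \<and> ?p x = 0" by simp
  then show ?thesis
  proof (rule ex1I[of _ x])
    fix y assume y: "0 < y \<and> ?p y = 0"
    show "y = x"
      using mono[of x y] mono[of y x] x y by (cases y x rule: linorder_cases) auto
  qed
qed

lemma m_\<sigma>_eq:
  assumes "\<sigma> > 0" "j > 0"
  shows "m_\<sigma> \<sigma> j = (3 * (\<sigma> / pi)\<^sup>2 + 4 * (\<sigma> / pi) + 1 - 4 * j\<^sup>2 / (\<sigma> / pi)\<^sup>2)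
           / (4 * pi * sqrt (R_K (\<sigma> / pi) j))"
proof -
  have pos: "R_K (\<sigma> / pi) j > 0"
    using assms unfolding R_K_def by (intro add_pos_pos) auto
  have R: "((\<lambda>s. R_K (s / pi) j) has_real_derivative
      (3 * (\<sigma> / pi)\<^sup>2 + 4 * (\<sigma> / pi) + 1 - 4 * j\<^sup>2 / (\<sigma> / pi)\<^sup>2) / pi) (at \<sigma>)"
    unfolding R_K_def using assms
    by (auto intro!: derivative_eq_intros simp: field_simps power2_eq_square eval_nat_numeral)
  have "((\<lambda>s. m_K s j) has_real_derivative
      (3 * (\<sigma> / pi)\<^sup>2 + 4 * (\<sigma> / pi) + 1 - 4 * j\<^sup>2 / (\<sigma> / pi)\<^sup>2)
           / (4 * pi * sqrt (R_K (\<sigma> / pi) j))) (at \<sigma>)"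
    unfolding m_K_def
    using DERIV_cdivide[OF DERIV_chain2[OF DERIV_real_sqrt[OF pos] R], of 2] pos
    by (simp add: inverse_eq_divide mult_ac)
  then show ?thesis
    unfolding m_\<sigma>_def by (rule DERIV_imp_deriv)
qed

lemma \<sigma>\<^sub>e_unique:
  assumes "j > 0"
  shows "\<exists>!\<sigma>. \<sigma> > 0 \<and> m_\<sigma> \<sigma> j = 0"
proof -
  let ?q = "\<lambda>x::real. 3 * x ^ 4 + 4 * x ^ 3 + x\<^sup>2"
  have iff: "m_\<sigma> \<sigma> j = 0 \<longleftrightarrow> ?q (\<sigma> / pi) = 4 * j\<^sup>2" if "\<sigma> > 0" for \<sigma>
  proof -
    define x where "x = \<sigma> / pi"
    have x: "x > 0" using that by (simp add: x_def)
    have "R_K x j > 0"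
      using assms x unfolding R_K_def by (intro add_pos_pos) auto
    then have "m_\<sigma> \<sigma> j = 0 \<longleftrightarrow> 3 * x\<^sup>2 + 4 * x + 1 - 4 * j\<^sup>2 / x\<^sup>2 = 0"
      using m_\<sigma>_eq[OF that assms] by (simp add: x_def)
    also have "\<dots> \<longleftrightarrow> ?q x = 4 * j\<^sup>2"
      using x by (simp add: field_simps power2_eq_square power3_eq_cube power4_eq_xxxx)
    finally show ?thesis by (simp add: x_def)
  qed
  have mono: "?q x < ?q y" if "0 \<le> x" "x < y" for x y :: real
    using power_strict_mono[OF that(2,1), of 4] power_strict_mono[OF that(2,1), of 3]
      power_strict_mono[OF that(2,1), of 2] by simp
  have "\<exists>x\<ge>0. x \<le> 2 * j \<and> ?q x = 4 * j\<^sup>2"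
    using assms by (intro IVT') (auto intro!: continuous_intros simp: power_mult_distrib)
  then obtain x where x: "0 \<le> x" "?q x = 4 * j\<^sup>2" by blast
  moreover have "x \<noteq> 0" using x assms by auto
  ultimately have "x > 0" by simp
  show ?thesis
  proof (rule ex1I[of _ "pi * x"])
    show "pi * x > 0 \<and> m_\<sigma> (pi * x) j = 0"
      using iff[of "pi * x"] x \<open>x > 0\<close> by simp
  next
    fix \<sigma> assume s: "\<sigma> > 0 \<and> m_\<sigma> \<sigma> j = 0"
    then have "?q (\<sigma> / pi) = ?q x" using iff[of \<sigma>] x by metis
    moreover have "\<sigma> / pi > 0" using s by simp
    ultimately have "\<sigma> / pi = x"
      using mono[of x "\<sigma> / pi"] mono[of "\<sigma> / pi" x] \<open>x > 0\<close> by (cases "\<sigma> / pi" x rule: linorder_cases) auto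
    then show "\<sigma> = pi * x" by (simp add: field_simps)
  qed
qed

end

theory Submission
  imports Defs
begin

text \<open>
  Since \<open>4 m\<^sup>2\<close> is the rational function \<open>R_K\<close>, all derivatives of \<open>m\<close> follow recursively from those
  of \<open>R_K\<close>, and at the critical point \<open>m\<close> has vanishing second and third derivatives in \<open>\<sigma>\<close>.
  A shift of \<open>\<sigma>\<close> linear in \<open>\<Delta>j\<close> then removes the cubic term to first order, and Taylor's formula
  gives the quartic normal form.

  For \<open>j \<ge> j\<^sub>c\<close> the mass is convex in \<open>\<sigma>\<close>. On the zero-field tangent the action, rescaled by
  \<open>y = (g / a4_K)\<^bsup>1/4\<^esup> x\<close>, is therefore convex and converges pointwise to \<open>x\<^sup>4 + \<lambda> x\<^sup>2\<close>. Convexity turns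
  the limits at \<open>x = 1\<close> and \<open>x = -1\<close> into a uniform linear lower bound on the whole branch, so that
  dominated convergence applies, and it also forces the minimum of the rescaled action to \<open>0\<close>.
  The average of \<open>x\<^sup>4 + \<lambda> x\<^sup>2\<close> in the limiting weight equals \<open>\<Phi> \<lambda>\<close> by integration by parts.
\<close>

section \<open>Derivatives of the mass function\<close>

text \<open>The obstacle is global: the normal form controls only a neighbourhood of
  \<open>\<sigma>\<^sub>c\<close>, while the average and the minimum range over an unbounded branch
  whose edge moves with \<open>j\<close>. Convexity closes this gap, and \<lambda> \<ge> 0 is what
  puts the tangent into \<open>j \<ge> j\<^sub>c\<close>. Convexity amounts to 2 R R'' - R'^2 \<ge>
  0. In powers of x and j^2 the only negative term is the constant -1, so this expression grows with
  j; at \<open>j\<^sub>c\<close> inequalities of arithmetic-geometric type bound it below by its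
  value at \<open>chi\<^sub>c\<close>. That value is the defining cubic times a positive factor,
  hence 0, which is also why m'' vanishes there; \<open>j\<^sub>c = chi\<^sub>c\<^sup>2 / 2\<close>
  is the condition R''' = 0, which then gives m''' = 0. On the scale y = eps x with g =
  \<open>a4_K\<close> eps^4 the tangent has \<Delta> of order eps^2, so y^5, \<Delta> y^3 and
  \<Delta>^2 y are all of order eps^5 and vanish after division by g. The density tends to the
  constant \<open>\<tau>\<^sub>c\<close>, which cancels in the quotient; the additive constant of
  the action cancels between average and minimum. Mixed derivatives are reduced to one variable by
  expanding along lines (\<open>chi\<^sub>c\<close> + k h, \<open>j\<^sub>c\<close> + h) with free
  slope k.\<close>

lemma R_K_pos:
  assumes "x > 0"
  shows "R_K x j > 0"
  using assms unfolding R_K_def by (intro add_pos_nonneg) auto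

definition R1 :: "real \<Rightarrow> real \<Rightarrow> real" where
  "R1 x j = 3 * x\<^sup>2 + 4 * x + 1 - 4 * j\<^sup>2 / x\<^sup>2"

definition R2 :: "real \<Rightarrow> real \<Rightarrow> real" where
  "R2 x j = 6 * x + 4 + 8 * j\<^sup>2 / x ^ 3"

definition R3 :: "real \<Rightarrow> real \<Rightarrow> real" where
  "R3 x j = 6 - 24 * j\<^sup>2 / x ^ 4"

definition R4 :: "real \<Rightarrow> real \<Rightarrow> real" where
  "R4 x j = 96 * j\<^sup>2 / x ^ 5"

definition R5 :: "real \<Rightarrow> real \<Rightarrow> real" where
  "R5 x j = - 480 * j\<^sup>2 / x ^ 6"

lemma DERIV_R:
  assumes "x > 0"
  shows "((\<lambda>x. R_K x j) has_real_derivative R1 x j) (at x)"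
    and "((\<lambda>x. R1 x j) has_real_derivative R2 x j) (at x)"
    and "((\<lambda>x. R2 x j) has_real_derivative R3 x j) (at x)"
    and "((\<lambda>x. R3 x j) has_real_derivative R4 x j) (at x)"
    and "((\<lambda>x. R4 x j) has_real_derivative R5 x j) (at x)"
  using assms unfolding R_K_def R1_def R2_def R3_def R4_def R5_def
  by (auto intro!: derivative_eq_intros simp: field_simps power2_eq_square eval_nat_numeral)

text \<open>The \<open>k\<close>-th derivative of \<open>sqrt (R_K x j) / 2\<close> in \<open>x\<close>, from \<open>k\<close>-fold differentiation of
  \<open>4 mu0\<^sup>2 = R_K\<close>.\<close>

definition mu0 :: "real \<Rightarrow> real \<Rightarrow> real" where
  "mu0 x j = sqrt (R_K x j) / 2"

definition mu1 :: "real \<Rightarrow> real \<Rightarrow> real" where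
  "mu1 x j = (R1 x j / 8) / mu0 x j"

definition mu2 :: "real \<Rightarrow> real \<Rightarrow> real" where
  "mu2 x j = (R2 x j / 8 - (mu1 x j)\<^sup>2) / mu0 x j"

definition mu3 :: "real \<Rightarrow> real \<Rightarrow> real" where
  "mu3 x j = (R3 x j / 8 - 3 * mu1 x j * mu2 x j) / mu0 x j"

definition mu4 :: "real \<Rightarrow> real \<Rightarrow> real" where
  "mu4 x j = (R4 x j / 8 - 4 * mu1 x j * mu3 x j - 3 * (mu2 x j)\<^sup>2) / mu0 x j"

definition mu5 :: "real \<Rightarrow> real \<Rightarrow> real" where
  "mu5 x j = (R5 x j / 8 - 5 * mu1 x j * mu4 x j - 10 * mu2 x j * mu3 x j) / mu0 x j"

lemma mu0_pos: "x > 0 \<Longrightarrow> mu0 x j > 0"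
  by (simp add: mu0_def R_K_pos)

lemma DERIV_mu0:
  assumes "x > 0"
  shows "((\<lambda>x. mu0 x j) has_real_derivative mu1 x j) (at x)"
  using DERIV_cdivide[OF DERIV_chain2[OF DERIV_real_sqrt[OF R_K_pos] DERIV_R(1)], OF assms assms, of j 2]
  by (simp add: mu0_def [abs_def] mu1_def inverse_eq_divide mult_ac)

text \<open>The quotient rule with the quotient itself kept on the right; this produces the
  recursive shape of \<open>mu1\<close> to \<open>mu5\<close> at once, since each of them is some
  expression divided by \<open>mu0\<close>.\<close>

lemma DERIV_divide_mu0:
  assumes "(f has_real_derivative D) (at x)" "x > 0"
  shows "((\<lambda>x. f x / mu0 x j) has_real_derivative (D - mu1 x j * (f x / mu0 x j)) / mu0 x j) (at x)"
  using DERIV_divide[OF assms(1) DERIV_mu0[OF assms(2)], of j] mu0_pos[OF assms(2), of j]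
  by (simp add: diff_divide_distrib mult_ac)

lemma DERIV_mu:
  assumes "x > 0"
  shows "((\<lambda>x. mu0 x j) has_real_derivative mu1 x j) (at x)"
    and "((\<lambda>x. mu1 x j) has_real_derivative mu2 x j) (at x)"
    and "((\<lambda>x. mu2 x j) has_real_derivative mu3 x j) (at x)"
    and "((\<lambda>x. mu3 x j) has_real_derivative mu4 x j) (at x)"
    and "((\<lambda>x. mu4 x j) has_real_derivative mu5 x j) (at x)"
proof -
  note [derivative_intros] = DERIV_R[OF assms, of j]
  note Q = DERIV_divide_mu0[OF _ assms]
  show D0[derivative_intros]: "((\<lambda>x. mu0 x j) has_real_derivative mu1 x j) (at x)"
    by (rule DERIV_mu0[OF assms])
  have "((\<lambda>x. R1 x j / 8) has_real_derivative
      R2 x j / 8) (at x)"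
    by (auto intro!: derivative_eq_intros simp: algebra_simps)
  from Q[OF this, of j, folded mu1_def] show D1[derivative_intros]: "((\<lambda>x. mu1 x j) has_real_derivative mu2 x j) (at x)"
    by (simp add: mu2_def algebra_simps power2_eq_square)
  have "((\<lambda>x. R2 x j / 8 - (mu1 x j)\<^sup>2) has_real_derivative
      R3 x j / 8 - 2 * mu1 x j * mu2 x j) (at x)"
    by (auto intro!: derivative_eq_intros simp: algebra_simps)
  from Q[OF this, of j, folded mu2_def] show D2[derivative_intros]: "((\<lambda>x. mu2 x j) has_real_derivative mu3 x j) (at x)"
    by (simp add: mu3_def algebra_simps power2_eq_square)
  have "((\<lambda>x. R3 x j / 8 - 3 * mu1 x j * mu2 x j) has_real_derivative
      R4 x j / 8 - 3 * (mu2 x j * mu2 x j + mu1 x j * mu3 x j)) (at x)"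
    by (auto intro!: derivative_eq_intros simp: algebra_simps)
  from Q[OF this, of j, folded mu3_def] show D3[derivative_intros]: "((\<lambda>x. mu3 x j) has_real_derivative mu4 x j) (at x)"
    by (simp add: mu4_def algebra_simps power2_eq_square)
  have "((\<lambda>x. R4 x j / 8 - 4 * mu1 x j * mu3 x j - 3 * (mu2 x j)\<^sup>2) has_real_derivative
      R5 x j / 8 - 4 * (mu2 x j * mu3 x j + mu1 x j * mu4 x j) - 6 * mu2 x j * mu3 x j) (at x)"
    by (auto intro!: derivative_eq_intros simp: algebra_simps)
  from Q[OF this, of j, folded mu4_def] show D4[derivative_intros]: "((\<lambda>x. mu4 x j) has_real_derivative mu5 x j) (at x)"
    by (simp add: mu5_def algebra_simps power2_eq_square)
qed

lemma m_K_eq_mu0: "m_K \<sigma> j = mu0 (\<sigma> / pi) j"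
  by (simp add: m_K_def mu0_def)

lemma DERIV_mu_sigma:
  assumes "\<sigma> > 0"
  shows "((\<lambda>\<sigma>. mu0 (\<sigma> / pi) j) has_real_derivative mu1 (\<sigma> / pi) j / pi) (at \<sigma>)"
    and "((\<lambda>\<sigma>. mu1 (\<sigma> / pi) j) has_real_derivative mu2 (\<sigma> / pi) j / pi) (at \<sigma>)"
    and "((\<lambda>\<sigma>. mu2 (\<sigma> / pi) j) has_real_derivative mu3 (\<sigma> / pi) j / pi) (at \<sigma>)"
proof -
  have d: "((\<lambda>\<sigma>. \<sigma> / pi) has_real_derivative 1 / pi) (at \<sigma>)"
    by (auto intro!: derivative_eq_intros)
  have pos: "\<sigma> / pi > 0" using assms by simp
  show "((\<lambda>\<sigma>. mu0 (\<sigma> / pi) j) has_real_derivative mu1 (\<sigma> / pi) j / pi) (at \<sigma>)"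
    using DERIV_chain2[OF DERIV_mu(1)[OF pos] d] by simp
  show "((\<lambda>\<sigma>. mu1 (\<sigma> / pi) j) has_real_derivative mu2 (\<sigma> / pi) j / pi) (at \<sigma>)"
    using DERIV_chain2[OF DERIV_mu(2)[OF pos] d] by simp
  show "((\<lambda>\<sigma>. mu2 (\<sigma> / pi) j) has_real_derivative mu3 (\<sigma> / pi) j / pi) (at \<sigma>)"
    using DERIV_chain2[OF DERIV_mu(3)[OF pos] d] by simp
qed

lemma m_\<sigma>_eq_mu1: "\<sigma> > 0 \<Longrightarrow> m_\<sigma> \<sigma> j = mu1 (\<sigma> / pi) j / pi"
  unfolding m_\<sigma>_def m_K_eq_mu0 by (intro DERIV_imp_deriv DERIV_mu_sigma)

lemma m_\<sigma>\<sigma>_eq_mu2: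
  assumes "\<sigma> > 0"
  shows "m_\<sigma>\<sigma> \<sigma> j = mu2 (\<sigma> / pi) j / pi\<^sup>2"
proof -
  have "\<forall>\<^sub>F s in nhds \<sigma>. m_\<sigma> s j = mu1 (s / pi) j / pi"
    using eventually_nhds_in_open[of "{0<..}" \<sigma>] assms
    by (auto elim!: eventually_mono simp: m_\<sigma>_eq_mu1)
  then have "m_\<sigma>\<sigma> \<sigma> j = deriv (\<lambda>s. mu1 (s / pi) j / pi) \<sigma>"
    unfolding m_\<sigma>\<sigma>_def by (intro deriv_cong_ev refl)
  also have "\<dots> = mu2 (\<sigma> / pi) j / pi / pi"
    by (intro DERIV_imp_deriv DERIV_cdivide DERIV_mu_sigma assms)
  finally show ?thesis by (simp add: power2_eq_square)
qed

text \<open>Links the iterated \<open>deriv\<close> in the theorem to \<open>mu3\<close>. Each outer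
  derivative needs the inner one in closed form on a whole neighbourhood, so \<open>d1\<close> and
  \<open>d2\<close> are proved for every \<open>y\<close> with
  \<open>\<sigma> + y > 0\<close>.\<close>

lemma deriv3_I_K:
  assumes "\<sigma> > 0"
  shows "(deriv ^^ 3) (\<lambda>y. I_K (\<sigma> + y) \<tau> j) 0 = mu3 (\<sigma> / pi) j / (pi ^ 3 * \<tau>)"
proof -
  have ev: "\<forall>\<^sub>F y in nhds 0. \<sigma> + y > 0"
    using eventually_nhds_in_open[of "{-\<sigma><..}" 0] assms by (auto elim!: eventually_mono)
  have sh: "((\<lambda>y. f (\<sigma> + y)) has_real_derivative D) (at y)"
    if "(f has_real_derivative D) (at (\<sigma> + y))" for f D y
    using that DERIV_shift[of f D y \<sigma>] by (simp add: add.commute)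
  have d1: "deriv (\<lambda>y. I_K (\<sigma> + y) \<tau> j) y = mu1 ((\<sigma> + y) / pi) j / pi / \<tau> - 1" if "\<sigma> + y > 0" for y
    unfolding I_K_def m_K_eq_mu0
    by (intro DERIV_imp_deriv DERIV_diff DERIV_cdivide sh[OF DERIV_mu_sigma(1)] that)
      (auto intro!: derivative_eq_intros)
  have d2: "deriv (deriv (\<lambda>y. I_K (\<sigma> + y) \<tau> j)) y = mu2 ((\<sigma> + y) / pi) j / pi / pi / \<tau>" if "\<sigma> + y > 0" for y
  proof -
    have "\<forall>\<^sub>F z in nhds y. \<sigma> + z > 0"
      using eventually_nhds_in_open[of "{-\<sigma><..}" y] that by (auto elim!: eventually_mono)
    then have "deriv (deriv (\<lambda>y. I_K (\<sigma> + y) \<tau> j)) y = deriv (\<lambda>y. mu1 ((\<sigma> + y) / pi) j / pi / \<tau> - 1) y"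
      by (intro deriv_cong_ev refl) (auto elim!: eventually_mono simp: d1)
    also have "\<dots> = mu2 ((\<sigma> + y) / pi) j / pi / pi / \<tau> - 0"
      by (intro DERIV_imp_deriv DERIV_diff DERIV_cdivide sh[OF DERIV_mu_sigma(2)] that DERIV_const)
    finally show ?thesis by simp
  qed
  have "(deriv ^^ 3) (\<lambda>y. I_K (\<sigma> + y) \<tau> j) 0 = deriv (deriv (deriv (\<lambda>y. I_K (\<sigma> + y) \<tau> j))) 0"
    by (simp add: eval_nat_numeral)
  also have "\<dots> = deriv (\<lambda>y. mu2 ((\<sigma> + y) / pi) j / pi / pi / \<tau>) 0"
    using ev by (intro deriv_cong_ev refl) (auto elim!: eventually_mono simp: d2)
  also have "\<dots> = mu3 ((\<sigma> + 0) / pi) j / pi / pi / pi / \<tau>"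
    using assms by (intro DERIV_imp_deriv DERIV_cdivide sh[OF DERIV_mu_sigma(3)]) auto
  finally show ?thesis by (simp add: eval_nat_numeral mult_ac)
qed

lemma Taylor_mu0:
  assumes "x > 0" "x + e > 0"
  obtains t where "\<bar>t\<bar> \<le> \<bar>e\<bar>"
    and "mu0 (x + e) j = mu0 x j + mu1 x j * e + mu2 x j / 2 * e\<^sup>2 + mu3 x j / 6 * e ^ 3
           + mu4 x j / 24 * e ^ 4 + mu5 (x + t) j / 120 * e ^ 5"
proof (cases "e = 0")
  case True
  then show ?thesis using that[of 0] by simp
next
  case False
  \<comment> \<open>A list indexed by the order of the derivative supplies the family that
    \<open>Taylor\<close> expects; the Lagrange remainder is of order 5, so \<open>mu5\<close>
    enters at an intermediate point.\<close>
  define diff where "diff = (\<lambda>m x. ([mu0, mu1, mu2, mu3, mu4, mu5] ! m) x j)"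
  let ?a = "min x (x + e)" and ?b = "max x (x + e)"
  have D: "\<forall>m t. m < 5 \<and> ?a \<le> t \<and> t \<le> ?b \<longrightarrow> DERIV (diff m) t :> diff (Suc m) t"
  proof (intro allI impI)
    fix m :: nat and t
    assume *: "m < 5 \<and> ?a \<le> t \<and> t \<le> ?b"
    then have "t > 0" using assms by (auto simp: min_def split: if_splits)
    have "m = 0 \<or> m = 1 \<or> m = 2 \<or> m = 3 \<or> m = 4" using * by auto
    then show "DERIV (diff m) t :> diff (Suc m) t"
      using DERIV_mu[OF \<open>t > 0\<close>, of j] by (auto simp: diff_def eval_nat_numeral)
  qed
  have "\<exists>t. (if x + e < x then x + e < t \<and> t < x else x < t \<and> t < x + e) \<and>
     mu0 (x + e) j = (\<Sum>m<5. (diff m x / fact m) * (x + e - x) ^ m) + (diff 5 t / fact 5) * (x + e - x) ^ 5"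
    using D False by (intro Taylor) (auto simp: diff_def)
  then obtain t where t: "(if x + e < x then x + e < t \<and> t < x else x < t \<and> t < x + e)"
    "mu0 (x + e) j = (\<Sum>m<5. (diff m x / fact m) * e ^ m) + (diff 5 t / fact 5) * e ^ 5"
    by auto
  show ?thesis
  proof (rule that[of "t - x"])
    show "\<bar>t - x\<bar> \<le> \<bar>e\<bar>" using t(1) by (auto split: if_splits)
    show "mu0 (x + e) j = mu0 x j + mu1 x j * e + mu2 x j / 2 * e\<^sup>2 + mu3 x j / 6 * e ^ 3
           + mu4 x j / 24 * e ^ 4 + mu5 (x + (t - x)) j / 120 * e ^ 5"
      using t(2) by (simp add: diff_def eval_nat_numeral fact_numeral)
  qed
qed

section \<open>First-order jets in the angular momentum\<close>

text \<open>A first-order expansion at 0 with quadratic remainder. This is stronger than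
  differentiability, and the remainder yields the \<Delta>^2 errors of the normal form. With
  \<open>nhds 0\<close> instead of \<open>at 0\<close> it also fixes the value at 0.\<close>

definition jet1 :: "(real \<Rightarrow> real) \<Rightarrow> real \<Rightarrow> real \<Rightarrow> bool" where
  "jet1 f a b \<longleftrightarrow> (\<lambda>h. f h - (a + b * h)) \<in> O[nhds 0](\<lambda>h. h\<^sup>2)"

lemma bigo_nhds_0_at: "f \<in> O[nhds 0](g) \<Longrightarrow> f 0 = 0" if "g 0 = 0" for f g :: "real \<Rightarrow> real"
proof -
  assume "f \<in> O[nhds 0](g)"
  then obtain c where "\<forall>\<^sub>F x in nhds 0. norm (f x) \<le> c * norm (g x)"
    by (auto elim: landau_o.bigE)
  from eventually_nhds_x_imp_x[OF this] show "f 0 = 0" using that by simp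
qed

lemma jet1_at_0:
  assumes "jet1 f a b"
  shows "f 0 = a"
proof -
  have "f 0 - (a + b * 0) = 0"
    using assms unfolding jet1_def by (rule bigo_nhds_0_at[rotated]) simp
  then show ?thesis by simp
qed

lemma jet1_linear: "jet1 (\<lambda>h. a + b * h) a b"
  unfolding jet1_def by (rule bigoI[of _ 0]) simp

lemma jet1_const: "jet1 (\<lambda>h. a) a 0"
  unfolding jet1_def by (rule bigoI[of _ 0]) simp

lemma jet1_add:
  assumes "jet1 f a b" "jet1 g c d"
  shows "jet1 (\<lambda>h. f h + g h) (a + c) (b + d)"
proof -
  have "(\<lambda>h. (f h - (a + b * h)) + (g h - (c + d * h))) \<in> O[nhds 0](\<lambda>h. h\<^sup>2)"
    using assms unfolding jet1_def by (rule sum_in_bigo(1))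
  also have "(\<lambda>h. (f h - (a + b * h)) + (g h - (c + d * h))) = (\<lambda>h. (f h + g h) - ((a + c) + (b + d) * h))"
    by (simp add: fun_eq_iff algebra_simps)
  finally show ?thesis by (simp only: jet1_def)
qed

lemma jet1_diff:
  assumes "jet1 f a b" "jet1 g c d"
  shows "jet1 (\<lambda>h. f h - g h) (a - c) (b - d)"
proof -
  have "(\<lambda>h. (f h - (a + b * h)) - (g h - (c + d * h))) \<in> O[nhds 0](\<lambda>h. h\<^sup>2)"
    using assms unfolding jet1_def by (rule sum_in_bigo(2))
  also have "(\<lambda>h. (f h - (a + b * h)) - (g h - (c + d * h))) = (\<lambda>h. (f h - g h) - ((a - c) + (b - d) * h))"
    by (simp add: fun_eq_iff algebra_simps)
  finally show ?thesis by (simp only: jet1_def)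
qed

lemma bigo_1_nhds_0:
  fixes f :: "real \<Rightarrow> real"
  assumes "isCont f 0"
  shows "f \<in> O[nhds 0](\<lambda>_. 1)"
proof -
  have "(f \<longlongrightarrow> f 0) (nhds 0)"
    using assms by (simp add: tendsto_nhds_iff isCont_def)
  then show ?thesis
    by (intro bigoI_tendsto[of _ _ "f 0"]) auto
qed

lemma jet1_bigo_1: "jet1 f a b \<Longrightarrow> f \<in> O[nhds 0](\<lambda>_. 1)"
proof -
  assume f: "jet1 f a b"
  have l: "(\<lambda>h::real. h\<^sup>2) \<in> O[nhds 0](\<lambda>_. 1)" "(\<lambda>h. a + b * h) \<in> O[nhds 0](\<lambda>_. 1)"
    by (intro bigo_1_nhds_0 continuous_intros)+
  from sum_in_bigo(1)[OF landau_o.big.trans[OF f[unfolded jet1_def] l(1)] l(2)]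
  show ?thesis by simp
qed

lemma jet1_mult:
  assumes "jet1 f a b" "jet1 g c d"
  shows "jet1 (\<lambda>h. f h * g h) (a * c) (a * d + b * c)"
proof -
  let ?F = "\<lambda>h. f h - (a + b * h)" and ?G = "\<lambda>h. g h - (c + d * h)"
  have l: "(\<lambda>h. a + b * h) \<in> O[nhds 0](\<lambda>_. 1)"
    by (intro bigo_1_nhds_0 continuous_intros)
  \<comment> \<open>With \<open>?F\<close> and \<open>?G\<close> the two remainders, the remainder
    of the product is \<open>?F h * g h + (a + b * h) * ?G h + b * d * h\<^sup>2\<close>; the three
    terms are estimated separately.\<close>
  have "(\<lambda>h. ?F h * g h) \<in> O[nhds 0](\<lambda>h. h\<^sup>2 * 1)"
    using assms by (intro landau_o.big.mult jet1_bigo_1) (auto simp: jet1_def)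
  moreover have "(\<lambda>h. (a + b * h) * ?G h) \<in> O[nhds 0](\<lambda>h. 1 * h\<^sup>2)"
    using assms l by (intro landau_o.big.mult) (auto simp: jet1_def)
  moreover have "(\<lambda>h. b * d * h\<^sup>2) \<in> O[nhds 0](\<lambda>h. h\<^sup>2)"
    by simp
  ultimately have "(\<lambda>h. ?F h * g h + (a + b * h) * ?G h + b * d * h\<^sup>2) \<in> O[nhds 0](\<lambda>h. h\<^sup>2)"
    by (intro sum_in_bigo) simp_all
  then show ?thesis
    by (simp add: jet1_def algebra_simps power2_eq_square)
qed

lemma jet1_cmult:
  assumes "jet1 f a b"
  shows "jet1 (\<lambda>h. c * f h) (c * a) (c * b)"
  using jet1_mult[OF jet1_const[of c] assms] by simp

lemma jet1_power2:
  assumes "jet1 f a b"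
  shows "jet1 (\<lambda>h. (f h)\<^sup>2) (a\<^sup>2) (2 * a * b)"
proof -
  have "a * b + b * a = 2 * a * b" by simp
  with jet1_mult[OF assms assms] show ?thesis by (simp only: power2_eq_square)
qed

lemma jet1_power3:
  assumes "jet1 f a b"
  shows "jet1 (\<lambda>h. (f h) ^ 3) (a ^ 3) (3 * a\<^sup>2 * b)"
proof -
  have "a * (2 * a * b) + b * a\<^sup>2 = 3 * a\<^sup>2 * b" by (simp add: power2_eq_square)
  with jet1_mult[OF assms jet1_power2[OF assms]] show ?thesis
    by (simp only: power3_eq_cube power2_eq_square mult.assoc)
qed

lemma jet1_DERIV:
  assumes "jet1 f a b"
  shows "(f has_real_derivative b) (at 0)"
proof -
  obtain c where c: "\<forall>\<^sub>F h in nhds 0. norm (f h - (a + b * h)) \<le> c * norm (h\<^sup>2)"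
    using assms by (auto simp: jet1_def elim: landau_o.bigE)
  then have "\<forall>\<^sub>F h in at 0. norm (f h - (a + b * h)) \<le> c * norm (h\<^sup>2)"
    by (simp add: eventually_at_filter eventually_mono)
  moreover have "\<forall>\<^sub>F h in at 0. h \<noteq> (0::real)"
    by (simp add: eventually_at_filter)
  ultimately have "\<forall>\<^sub>F h in at 0. norm ((f h - f 0) / h - b) \<le> c * \<bar>h\<bar>"
  proof eventually_elim
    case (elim h)
    have "(f h - f 0) / h - b = (f h - (a + b * h)) / h"
      using elim jet1_at_0[OF assms] by (simp add: field_simps)
    then show ?case
      using elim by (simp add: abs_mult field_simps power2_eq_square)
  qed
  moreover have "((\<lambda>h. c * \<bar>h\<bar>) \<longlongrightarrow> 0) (at (0::real))"
    by (auto intro!: tendsto_eq_intros)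
  ultimately have "((\<lambda>h. (f h - f 0) / h - b) \<longlongrightarrow> 0) (at 0)"
    by (rule Lim_null_comparison)
  then show ?thesis
    by (simp add: DERIV_def LIM_zero_iff)
qed

lemma jet1_tendsto: "jet1 f a b \<Longrightarrow> (f \<longlongrightarrow> a) (nhds 0)"
  using jet1_DERIV[THEN DERIV_isCont, of f a b] jet1_at_0[of f a b]
  by (simp add: isCont_def tendsto_nhds_iff)

text \<open>The jet of a quotient is determined by solving \<open>q * g = f\<close> for \<open>q\<close>.\<close>

lemma jet1_divide:
  assumes "jet1 f a b" "jet1 g c d" "c \<noteq> 0" "p * c = a" "q * c + p * d = b"
  shows "jet1 (\<lambda>h. f h / g h) p q"
proof -
  have ev: "\<forall>\<^sub>F h in nhds 0. g h \<noteq> 0"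
    using jet1_tendsto[OF assms(2)] assms(3) by (rule tendsto_imp_eventually_ne)
  have "((\<lambda>h. inverse (g h)) \<longlongrightarrow> inverse c) (nhds 0)"
    using jet1_tendsto[OF assms(2)] assms(3) by (intro tendsto_intros)
  then have inv: "(\<lambda>h. inverse (g h)) \<in> O[nhds 0](\<lambda>_. 1)"
    by (intro bigoI_tendsto[of _ _ "inverse c"]) auto
  \<comment> \<open>The equations for \<open>p\<close> and \<open>q\<close> make both coefficients
    of this jet vanish; dividing by \<open>g\<close>, whose inverse is bounded near 0, preserves the
    quadratic order.\<close>
  have "jet1 (\<lambda>h. f h - (p + q * h) * g h) (a - p * c) (b - (p * d + q * c))"
    by (intro jet1_diff jet1_mult jet1_linear assms)
  moreover have "a - p * c = 0" "b - (p * d + q * c) = 0"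
    using assms by simp_all
  ultimately have "(\<lambda>h. f h - (p + q * h) * g h) \<in> O[nhds 0](\<lambda>h. h\<^sup>2)"
    by (simp add: jet1_def)
  from landau_o.big.mult[OF this inv]
  have "(\<lambda>h. (f h - (p + q * h) * g h) * inverse (g h)) \<in> O[nhds 0](\<lambda>h. h\<^sup>2)" by simp
  moreover have "\<forall>\<^sub>F h in nhds 0. (f h - (p + q * h) * g h) * inverse (g h) = f h / g h - (p + q * h)"
    using ev by eventually_elim (simp add: field_simps)
  ultimately show ?thesis
    unfolding jet1_def by (subst (asm) landau_o.big.in_cong) auto
qed

text \<open>Rationalisation: \<open>sqrt (f h) - (a + q * h)\<close> equals
  \<open>f h - (a + q * h)\<^sup>2\<close> divided by a sum tending to \<open>2 * a > 0\<close>, and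
  that numerator has zero jet. The leading coefficient is given as \<open>a\<^sup>2\<close> so that
  the root is explicit.\<close>

lemma jet1_sqrt:
  assumes "jet1 f (a\<^sup>2) b" "a > 0" "2 * a * q = b"
  shows "jet1 (\<lambda>h. sqrt (f h)) a q"
proof -
  have lim: "((\<lambda>h. sqrt (f h)) \<longlongrightarrow> sqrt (a\<^sup>2)) (nhds 0)"
    by (intro tendsto_intros jet1_tendsto[OF assms(1)])
  have "((\<lambda>h. inverse (sqrt (f h) + (a + q * h))) \<longlongrightarrow> inverse (a + (a + q * 0))) (nhds 0)"
    using lim assms(2) by (intro tendsto_intros filterlim_ident) auto
  then have inv: "(\<lambda>h. inverse (sqrt (f h) + (a + q * h))) \<in> O[nhds 0](\<lambda>_. 1)"
    using assms(2) by (intro bigoI_tendsto[of _ _ "inverse (a + a)"]) auto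
  have "((\<lambda>h. sqrt (f h) + (a + q * h)) \<longlongrightarrow> a + (a + q * 0)) (nhds 0)"
    using lim assms(2) by (intro tendsto_intros filterlim_ident) auto
  then have ne: "\<forall>\<^sub>F h in nhds 0. sqrt (f h) + (a + q * h) \<noteq> 0"
    using assms(2) by (intro tendsto_imp_eventually_ne) auto
  have pos: "\<forall>\<^sub>F h in nhds 0. f h > 0"
    using order_tendstoD(1)[OF jet1_tendsto[OF assms(1)], of 0] assms(2) by simp
  have "jet1 (\<lambda>h. f h - (a + q * h)\<^sup>2) (a\<^sup>2 - a\<^sup>2) (b - 2 * a * q)"
    by (intro jet1_diff jet1_power2 jet1_linear assms)
  then have "(\<lambda>h. f h - (a + q * h)\<^sup>2) \<in> O[nhds 0](\<lambda>h. h\<^sup>2)"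
    using assms by (simp add: jet1_def)
  from landau_o.big.mult[OF this inv]
  have "(\<lambda>h. (f h - (a + q * h)\<^sup>2) * inverse (sqrt (f h) + (a + q * h))) \<in> O[nhds 0](\<lambda>h. h\<^sup>2)" by simp
  moreover have "\<forall>\<^sub>F h in nhds 0. (f h - (a + q * h)\<^sup>2) * inverse (sqrt (f h) + (a + q * h))
      = sqrt (f h) - (a + q * h)"
    using ne pos
  proof eventually_elim
    case (elim h)
    have "f h = (sqrt (f h))\<^sup>2" using elim by simp
    then have "f h - (a + q * h)\<^sup>2 = (sqrt (f h) - (a + q * h)) * (sqrt (f h) + (a + q * h))"
      by (simp add: algebra_simps power2_eq_square)
    then show ?case using elim by (simp add: field_simps)
  qed
  ultimately show ?thesis
    unfolding jet1_def by (subst (asm) landau_o.big.in_cong) auto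
qed

section \<open>Values and jets at the critical point\<close>

lemma chi\<^sub>c: "chi\<^sub>c > 0" "8 * chi\<^sub>c ^ 3 + 10 * chi\<^sub>c\<^sup>2 + 2 * chi\<^sub>c - 1 = 0"
  using theI'[OF chi\<^sub>c_unique] unfolding chi\<^sub>c_def[symmetric] by blast+

lemma j\<^sub>c_pos: "j\<^sub>c > 0"
  using chi\<^sub>c by (simp add: j\<^sub>c_def)

lemma \<sigma>\<^sub>c_pos: "\<sigma>\<^sub>c > 0"
  using chi\<^sub>c by (simp add: \<sigma>\<^sub>c_def)

definition mu\<^sub>c :: real where
  "mu\<^sub>c = mu0 chi\<^sub>c j\<^sub>c"

definition t\<^sub>c :: real where
  "t\<^sub>c = mu1 chi\<^sub>c j\<^sub>c"

text \<open>The \<open>j\<close>-derivative of \<open>mu1\<close> at the critical point: there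
  \<open>R1 / 8\<close> has \<open>j\<close>-derivative -1/2 and \<open>mu0\<close> has
  \<open>(chi\<^sub>c\<^sup>2 + chi\<^sub>c) / (2 * mu\<^sub>c)\<close>.\<close>

definition mu1\<^sub>j :: real where
  "mu1\<^sub>j = - (1 / 2 + t\<^sub>c * (chi\<^sub>c\<^sup>2 + chi\<^sub>c) / (2 * mu\<^sub>c)) / mu\<^sub>c"

text \<open>The \<open>j\<close>-derivative of \<open>mu2\<close> at the critical point. The change
  of the denominator \<open>mu0\<close> does not contribute because \<open>mu2\<close> vanishes
  there.\<close>

definition mu2\<^sub>j :: real where
  "mu2\<^sub>j = (1 / chi\<^sub>c - 2 * t\<^sub>c * mu1\<^sub>j) / mu\<^sub>c"

text \<open>The \<open>h\<close>-derivatives of \<open>mu1\<close> and \<open>mu2\<close> along \<open>(chi\<^sub>c + k h, j\<^sub>c + h)\<close> do not depend on \<open>k\<close>, because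
  \<open>mu2\<close> and \<open>mu3\<close> vanish at the critical point; \<open>kap\<^sub>c\<close> is the slope \<open>k\<close> at which that of \<open>mu3\<close> vanishes.\<close>

definition kap\<^sub>c :: real where
  "kap\<^sub>c = 1 / chi\<^sub>c + chi\<^sub>c * t\<^sub>c * mu2\<^sub>j"

text \<open>Everything follows from \<open>4 * j\<^sub>c\<^sup>2 = chi\<^sub>c ^ 4\<close>, which
  removes the negative powers of the first three and is exactly the condition that \<open>R3\<close>
  vanish.\<close>

lemma R_c:
  "R_K chi\<^sub>c j\<^sub>c = chi\<^sub>c ^ 4 + 2 * chi\<^sub>c ^ 3 + 2 * chi\<^sub>c\<^sup>2 + chi\<^sub>c"
  "R1 chi\<^sub>c j\<^sub>c = 2 * chi\<^sub>c\<^sup>2 + 4 * chi\<^sub>c + 1"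
  "R2 chi\<^sub>c j\<^sub>c = 8 * chi\<^sub>c + 4"
  "R3 chi\<^sub>c j\<^sub>c = 0"
  "R4 chi\<^sub>c j\<^sub>c = 24 / chi\<^sub>c"
proof -
  have c: "chi\<^sub>c \<noteq> 0" using chi\<^sub>c(1) by simp
  have j: "j\<^sub>c\<^sup>2 = chi\<^sub>c ^ 4 / 4"
    by (simp add: j\<^sub>c_def power_divide)
  show "R_K chi\<^sub>c j\<^sub>c = chi\<^sub>c ^ 4 + 2 * chi\<^sub>c ^ 3 + 2 * chi\<^sub>c\<^sup>2 + chi\<^sub>c"
    using c by (simp add: R_K_def j power4_eq_xxxx power3_eq_cube)
  show "R1 chi\<^sub>c j\<^sub>c = 2 * chi\<^sub>c\<^sup>2 + 4 * chi\<^sub>c + 1"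
    unfolding R1_def j using c by (simp add: power4_eq_xxxx power2_eq_square)
  show "R2 chi\<^sub>c j\<^sub>c = 8 * chi\<^sub>c + 4" "R3 chi\<^sub>c j\<^sub>c = 0"
    using c by (simp_all add: R2_def R3_def j power4_eq_xxxx power3_eq_cube)
  show "R4 chi\<^sub>c j\<^sub>c = 24 / chi\<^sub>c"
    unfolding R4_def j using c by (simp add: power4_eq_xxxx eval_nat_numeral)
qed

lemma mu\<^sub>c_pos: "mu\<^sub>c > 0"
  using chi\<^sub>c by (simp add: mu\<^sub>c_def mu0_pos)

lemma mu\<^sub>c_sq: "4 * mu\<^sub>c\<^sup>2 = chi\<^sub>c ^ 4 + 2 * chi\<^sub>c ^ 3 + 2 * chi\<^sub>c\<^sup>2 + chi\<^sub>c"
  using R_K_pos[OF chi\<^sub>c(1), of j\<^sub>c] R_c(1) by (simp add: mu\<^sub>c_def mu0_def power_divide)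

lemma t\<^sub>c_mu\<^sub>c: "8 * t\<^sub>c * mu\<^sub>c = 2 * chi\<^sub>c\<^sup>2 + 4 * chi\<^sub>c + 1"
  using mu\<^sub>c_pos R_c(2) by (simp add: t\<^sub>c_def mu1_def mu\<^sub>c_def[symmetric])

lemma t\<^sub>c_pos: "t\<^sub>c > 0"
proof -
  have "8 * t\<^sub>c * mu\<^sub>c > 0"
    using t\<^sub>c_mu\<^sub>c chi\<^sub>c(1) by (simp add: add_pos_pos)
  then show ?thesis using mu\<^sub>c_pos by (simp add: zero_less_mult_iff)
qed

text \<open>The critical-point equation \<open>m'' = 0\<close> is the cubic for \<open>chi\<^sub>c\<close> up to a positive factor.\<close>

lemma t\<^sub>c_sq: "t\<^sub>c\<^sup>2 = chi\<^sub>c + 1 / 2"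
proof -
  \<comment> \<open>The left side is \<open>R1\<close> squared and the first term on the right is 2
    R R''. The factor \<open>2 * chi\<^sub>c\<^sup>2 + 2 * chi\<^sub>c + 1\<close> is the polynomial
    quotient of their difference by the cubic.\<close>
  have "(8 * t\<^sub>c * mu\<^sub>c)\<^sup>2 = (8 * chi\<^sub>c + 4) * 2 * (4 * mu\<^sub>c\<^sup>2)
      - (2 * chi\<^sub>c\<^sup>2 + 2 * chi\<^sub>c + 1) * (8 * chi\<^sub>c ^ 3 + 10 * chi\<^sub>c\<^sup>2 + 2 * chi\<^sub>c - 1)"
    unfolding t\<^sub>c_mu\<^sub>c mu\<^sub>c_sq by (simp add: algebra_simps eval_nat_numeral)
  then have "64 * mu\<^sub>c\<^sup>2 * t\<^sub>c\<^sup>2 = 64 * mu\<^sub>c\<^sup>2 * (chi\<^sub>c + 1 / 2)"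
    unfolding chi\<^sub>c(2) by (simp add: algebra_simps power2_eq_square)
  then show ?thesis using mu\<^sub>c_pos by simp
qed

lemma mu1\<^sub>j_neg: "mu1\<^sub>j < 0"
proof -
  have "t\<^sub>c * (chi\<^sub>c\<^sup>2 + chi\<^sub>c) / (2 * mu\<^sub>c) > 0"
    using mu\<^sub>c_pos t\<^sub>c_pos chi\<^sub>c(1) by (intro divide_pos_pos mult_pos_pos add_pos_pos) auto
  then show ?thesis
    unfolding mu1\<^sub>j_def using mu\<^sub>c_pos by (intro divide_neg_pos) auto
qed

lemma mu2\<^sub>j_pos: "mu2\<^sub>j > 0"
proof -
  have "t\<^sub>c * mu1\<^sub>j < 0" "1 / chi\<^sub>c > 0"
    using t\<^sub>c_pos chi\<^sub>c(1) mu1\<^sub>j_neg by (auto simp: mult_pos_neg)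
  then show ?thesis
    unfolding mu2\<^sub>j_def using mu\<^sub>c_pos by (intro divide_pos_pos) linarith+
qed

lemma mu_c:
  "mu2 chi\<^sub>c j\<^sub>c = 0" "mu3 chi\<^sub>c j\<^sub>c = 0" "mu4 chi\<^sub>c j\<^sub>c = 3 / (chi\<^sub>c * mu\<^sub>c)"
proof -
  note [simp] = mu\<^sub>c_def[symmetric] t\<^sub>c_def[symmetric]
  show mu2: "mu2 chi\<^sub>c j\<^sub>c = 0"
    using R_c(3) t\<^sub>c_sq by (simp add: mu2_def)
  show mu3: "mu3 chi\<^sub>c j\<^sub>c = 0"
    using R_c(4) mu2 by (simp add: mu3_def)
  show "mu4 chi\<^sub>c j\<^sub>c = 3 / (chi\<^sub>c * mu\<^sub>c)"
    using R_c(5) mu2 mu3 by (simp add: mu4_def)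
qed

context
  fixes k :: real
begin

text \<open>The slope \<open>k\<close> stays free because two values are used later:
  \<open>k = 0\<close> gives pure \<open>j\<close>-derivatives, and \<open>k = kap\<^sub>c\<close>
  gives the expansion along the translated centre.\<close>

lemma jet1_R:
  "jet1 (\<lambda>h. R_K (chi\<^sub>c + k * h) (j\<^sub>c + h)) ((2 * mu\<^sub>c)\<^sup>2) ((2 * chi\<^sub>c\<^sup>2 + 4 * chi\<^sub>c + 1) * k + 4 * chi\<^sub>c\<^sup>2 + 4 * chi\<^sub>c)"
  "jet1 (\<lambda>h. R1 (chi\<^sub>c + k * h) (j\<^sub>c + h)) (8 * t\<^sub>c * mu\<^sub>c) ((8 * chi\<^sub>c + 4) * k - 4)"
  "jet1 (\<lambda>h. R2 (chi\<^sub>c + k * h) (j\<^sub>c + h)) (8 * chi\<^sub>c + 4) (8 / chi\<^sub>c)"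
  "jet1 (\<lambda>h. R3 (chi\<^sub>c + k * h) (j\<^sub>c + h)) 0 (24 / chi\<^sub>c * k - 24 / chi\<^sub>c\<^sup>2)"
proof -
  note J = jet1_linear[of chi\<^sub>c k] jet1_linear[of j\<^sub>c 1, unfolded mult_1]
  have c: "chi\<^sub>c \<noteq> 0" using chi\<^sub>c by simp
  note X = J(1) jet1_power2[OF J(1)] jet1_power3[OF J(1)]
  have X4: "jet1 (\<lambda>h. (chi\<^sub>c + k * h) ^ 4) (chi\<^sub>c ^ 4) (4 * chi\<^sub>c ^ 3 * k)"
    using jet1_power2[OF X(2)] by (simp add: eval_nat_numeral mult_ac)
  note Y = jet1_power2[OF J(2)]
  note jc = j\<^sub>c_def
  have "jet1 (\<lambda>h. 4 * (j\<^sub>c + h)\<^sup>2 / (chi\<^sub>c + k * h)) (chi\<^sub>c ^ 3) (4 * chi\<^sub>c - chi\<^sub>c\<^sup>2 * k)"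
    by (rule jet1_divide[OF jet1_cmult[OF Y] X(1)])
      (use c in \<open>simp_all add: jc field_simps eval_nat_numeral\<close>)
  from jet1_add[OF jet1_add[OF jet1_add[OF jet1_add[OF X(3) jet1_cmult[OF X(2), of 2]] X(1)]
        jet1_cmult[OF Y, of 4]] this]
  show "jet1 (\<lambda>h. R_K (chi\<^sub>c + k * h) (j\<^sub>c + h)) ((2 * mu\<^sub>c)\<^sup>2)
      ((2 * chi\<^sub>c\<^sup>2 + 4 * chi\<^sub>c + 1) * k + 4 * chi\<^sub>c\<^sup>2 + 4 * chi\<^sub>c)"
    unfolding R_K_def using mu\<^sub>c_sq
    by (simp add: power_mult_distrib jc power_divide algebra_simps eval_nat_numeral)
  have "jet1 (\<lambda>h. 4 * (j\<^sub>c + h)\<^sup>2 / (chi\<^sub>c + k * h)\<^sup>2) (chi\<^sub>c ^ 2) (4 - 2 * chi\<^sub>c * k)"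
    by (rule jet1_divide[OF jet1_cmult[OF Y] X(2)])
      (use c in \<open>simp_all add: jc field_simps eval_nat_numeral\<close>)
  from jet1_diff[OF jet1_add[OF jet1_add[OF jet1_cmult[OF X(2), of 3] jet1_cmult[OF X(1), of 4]]
        jet1_const[of 1]] this]
  show "jet1 (\<lambda>h. R1 (chi\<^sub>c + k * h) (j\<^sub>c + h)) (8 * t\<^sub>c * mu\<^sub>c) ((8 * chi\<^sub>c + 4) * k - 4)"
    unfolding R1_def t\<^sub>c_mu\<^sub>c by (simp add: algebra_simps)
  have "jet1 (\<lambda>h. 8 * (j\<^sub>c + h)\<^sup>2 / (chi\<^sub>c + k * h) ^ 3) (2 * chi\<^sub>c) (8 / chi\<^sub>c - 6 * k)"
    by (rule jet1_divide[OF jet1_cmult[OF Y] X(3)])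
      (use c in \<open>simp_all add: jc field_simps eval_nat_numeral\<close>)
  from jet1_add[OF jet1_add[OF jet1_cmult[OF X(1), of 6] jet1_const[of 4]] this]
  show "jet1 (\<lambda>h. R2 (chi\<^sub>c + k * h) (j\<^sub>c + h)) (8 * chi\<^sub>c + 4) (8 / chi\<^sub>c)"
    unfolding R2_def by (simp add: algebra_simps)
  have "jet1 (\<lambda>h. 24 * (j\<^sub>c + h)\<^sup>2 / (chi\<^sub>c + k * h) ^ 4) 6 (24 / chi\<^sub>c\<^sup>2 - 24 / chi\<^sub>c * k)"
    by (rule jet1_divide[OF jet1_cmult[OF Y] X4])
      (use c in \<open>simp_all add: jc field_simps eval_nat_numeral\<close>)
  from jet1_diff[OF jet1_const[of 6] this]
  show "jet1 (\<lambda>h. R3 (chi\<^sub>c + k * h) (j\<^sub>c + h)) 0 (24 / chi\<^sub>c * k - 24 / chi\<^sub>c\<^sup>2)"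
    unfolding R3_def by simp
qed

lemma jet1_mu0:
  "jet1 (\<lambda>h. mu0 (chi\<^sub>c + k * h) (j\<^sub>c + h)) mu\<^sub>c (t\<^sub>c * k + (chi\<^sub>c\<^sup>2 + chi\<^sub>c) / (2 * mu\<^sub>c))"
proof -
  have "jet1 (\<lambda>h. sqrt (R_K (chi\<^sub>c + k * h) (j\<^sub>c + h))) (2 * mu\<^sub>c) (2 * (t\<^sub>c * k + (chi\<^sub>c\<^sup>2 + chi\<^sub>c) / (2 * mu\<^sub>c)))"
    using mu\<^sub>c_pos unfolding t\<^sub>c_mu\<^sub>c[symmetric]
    by (intro jet1_sqrt[OF jet1_R(1)[folded t\<^sub>c_mu\<^sub>c]]) (simp_all add: field_simps)
  from jet1_cmult[OF this, of "1 / 2"] show ?thesis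
    unfolding mu0_def by (simp del: distrib_left_numeral)
qed

text \<open>The contributions of \<open>k\<close> from numerator and denominator cancel by
  \<open>t\<^sub>c_sq\<close>, that is, because \<open>mu2\<close> vanishes at the critical
  point.\<close>

lemma jet1_mu1: "jet1 (\<lambda>h. mu1 (chi\<^sub>c + k * h) (j\<^sub>c + h)) t\<^sub>c mu1\<^sub>j"
proof -
  have "jet1 (\<lambda>h. R1 (chi\<^sub>c + k * h) (j\<^sub>c + h) / 8) (t\<^sub>c * mu\<^sub>c) ((chi\<^sub>c + 1 / 2) * k - 1 / 2)"
    using jet1_cmult[OF jet1_R(2), of "1 / 8"] by (simp add: algebra_simps)
  moreover have "mu1\<^sub>j * mu\<^sub>c + t\<^sub>c * (t\<^sub>c * k + (chi\<^sub>c\<^sup>2 + chi\<^sub>c) / (2 * mu\<^sub>c)) = (chi\<^sub>c + 1 / 2) * k - 1 / 2"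
    unfolding t\<^sub>c_sq[symmetric] mu1\<^sub>j_def using mu\<^sub>c_pos by (simp add: field_simps power2_eq_square)
  ultimately show ?thesis
    unfolding mu1_def using mu\<^sub>c_pos by (intro jet1_divide[OF _ jet1_mu0]) simp_all
qed

lemma jet1_mu2: "jet1 (\<lambda>h. mu2 (chi\<^sub>c + k * h) (j\<^sub>c + h)) 0 mu2\<^sub>j"
proof -
  have "jet1 (\<lambda>h. R2 (chi\<^sub>c + k * h) (j\<^sub>c + h) / 8 - (mu1 (chi\<^sub>c + k * h) (j\<^sub>c + h))\<^sup>2) 0 (1 / chi\<^sub>c - 2 * t\<^sub>c * mu1\<^sub>j)"
    using jet1_diff[OF jet1_cmult[OF jet1_R(3), of "1 / 8"] jet1_power2[OF jet1_mu1]] t\<^sub>c_sq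
    by (simp add: algebra_simps)
  from jet1_divide[OF this jet1_mu0, of 0 mu2\<^sub>j] show ?thesis
    unfolding mu2_def mu2\<^sub>j_def using mu\<^sub>c_pos by simp
qed

lemma jet1_mu3:
  "jet1 (\<lambda>h. mu3 (chi\<^sub>c + k * h) (j\<^sub>c + h)) 0 ((3 / chi\<^sub>c * k - 3 / chi\<^sub>c\<^sup>2 - 3 * t\<^sub>c * mu2\<^sub>j) / mu\<^sub>c)"
proof -
  have "jet1 (\<lambda>h. R3 (chi\<^sub>c + k * h) (j\<^sub>c + h) / 8 - 3 * mu1 (chi\<^sub>c + k * h) (j\<^sub>c + h) * mu2 (chi\<^sub>c + k * h) (j\<^sub>c + h)) 0
      (3 / chi\<^sub>c * k - 3 / chi\<^sub>c\<^sup>2 - 3 * t\<^sub>c * mu2\<^sub>j)"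
    using jet1_diff[OF jet1_cmult[OF jet1_R(4), of "1 / 8"]
        jet1_mult[OF jet1_cmult[OF jet1_mu1, of 3] jet1_mu2]]
    by (simp add: right_diff_distrib)
  from jet1_divide[OF this jet1_mu0, of 0 "(3 / chi\<^sub>c * k - 3 / chi\<^sub>c\<^sup>2 - 3 * t\<^sub>c * mu2\<^sub>j) / mu\<^sub>c"]
  show ?thesis
    unfolding mu3_def using mu\<^sub>c_pos by simp
qed

end

lemma \<tau>\<^sub>c_eq: "\<tau>\<^sub>c = t\<^sub>c / pi"
  unfolding \<tau>\<^sub>c_def m_\<sigma>_eq_mu1[OF \<sigma>\<^sub>c_pos] by (simp add: t\<^sub>c_def \<sigma>\<^sub>c_def)

lemma \<tau>\<^sub>c_pos: "\<tau>\<^sub>c > 0"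
  by (simp add: \<tau>\<^sub>c_eq t\<^sub>c_pos)

text \<open>Jets are centred at increment 0, whereas the mixed derivatives in the theorem are taken
  at \<open>j\<^sub>c\<close>.\<close>

lemma deriv_shift_0: "deriv f (a::real) = D" if "((\<lambda>h. f (a + h)) has_real_derivative D) (at 0)"
proof (rule DERIV_imp_deriv)
  show "(f has_real_derivative D) (at a)"
    using that DERIV_shift[of f D 0 a] by (simp add: add.commute)
qed

lemma m_\<sigma>j_c: "m_\<sigma>j \<sigma>\<^sub>c j\<^sub>c = mu1\<^sub>j / pi"
proof -
  have "((\<lambda>h. mu1 chi\<^sub>c (j\<^sub>c + h) / pi) has_real_derivative mu1\<^sub>j / pi) (at 0)"
    using DERIV_cdivide[OF jet1_DERIV[OF jet1_mu1[of 0]], of pi] by simp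
  then show ?thesis
    unfolding m_\<sigma>j_def m_\<sigma>_eq_mu1[OF \<sigma>\<^sub>c_pos] by (intro deriv_shift_0) (simp add: \<sigma>\<^sub>c_def)
qed

lemma m_\<sigma>\<sigma>j_c: "m_\<sigma>\<sigma>j \<sigma>\<^sub>c j\<^sub>c = mu2\<^sub>j / pi\<^sup>2"
proof -
  have "((\<lambda>h. mu2 chi\<^sub>c (j\<^sub>c + h) / pi\<^sup>2) has_real_derivative mu2\<^sub>j / pi\<^sup>2) (at 0)"
    using DERIV_cdivide[OF jet1_DERIV[OF jet1_mu2[of 0]], of "pi\<^sup>2"] by simp
  then show ?thesis
    unfolding m_\<sigma>\<sigma>j_def m_\<sigma>\<sigma>_eq_mu2[OF \<sigma>\<^sub>c_pos] by (intro deriv_shift_0) (simp add: \<sigma>\<^sub>c_def)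
qed

lemma a4_K_eq: "a4_K = mu4 chi\<^sub>c j\<^sub>c / (24 * pi ^ 4 * \<tau>\<^sub>c)"
proof -
  have "a4_K = 1 / (pi ^ 3 * chi\<^sub>c * (8 * t\<^sub>c * mu\<^sub>c))"
    by (simp add: a4_K_def t\<^sub>c_mu\<^sub>c)
  then show ?thesis
    unfolding mu_c(3) \<tau>\<^sub>c_eq using t\<^sub>c_pos mu\<^sub>c_pos chi\<^sub>c(1)
    by (simp add: field_simps power_numeral_reduce)
qed

lemma a4_K_pos: "a4_K > 0"
  using chi\<^sub>c(1) by (simp add: a4_K_def add_pos_pos)

section \<open>The quartic normal form\<close>

lemma jet1_divide':
  assumes "jet1 f a b" "jet1 g c d" "c \<noteq> 0"
  shows "jet1 (\<lambda>h. f h / g h) (a / c) ((b - a / c * d) / c)"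
  by (rule jet1_divide[OF assms]) (use assms(3) in simp_all)

text \<open>The quartic coefficient is wanted only up to an error linear in the controls, so the
  slope may stay unspecified.\<close>

lemma jet1_mu4: "\<exists>b. jet1 (\<lambda>h. mu4 (chi\<^sub>c + k * h) (j\<^sub>c + h)) (mu4 chi\<^sub>c j\<^sub>c) b"
proof -
  \<comment> \<open>Replaces the bulky constant term that the jet rules produce by the value at 0,
    which is visibly \<open>mu4 chi\<^sub>c j\<^sub>c\<close>.\<close>
  have jet: "\<exists>b. jet1 f (f 0) b" if "jet1 f a b" for f a b
    using that jet1_at_0[OF that] by blast
  have X: "jet1 (\<lambda>h. chi\<^sub>c + k * h) chi\<^sub>c k" and Y: "jet1 (\<lambda>h. j\<^sub>c + h) j\<^sub>c 1"
    using jet1_linear[of chi\<^sub>c k] jet1_linear[of j\<^sub>c 1] by simp_all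
  have X5: "jet1 (\<lambda>h. (chi\<^sub>c + k * h)\<^sup>2 * (chi\<^sub>c + k * h) ^ 3) (chi\<^sub>c\<^sup>2 * chi\<^sub>c ^ 3)
      (chi\<^sub>c\<^sup>2 * (3 * chi\<^sub>c\<^sup>2 * k) + 2 * chi\<^sub>c * k * chi\<^sub>c ^ 3)"
    by (intro jet1_mult jet1_power2 jet1_power3 X)
  have "\<exists>a b. jet1 (\<lambda>h. 96 * (j\<^sub>c + h)\<^sup>2 / ((chi\<^sub>c + k * h)\<^sup>2 * (chi\<^sub>c + k * h) ^ 3)) a b"
    using jet1_divide'[OF jet1_cmult[OF jet1_power2[OF Y]] X5, of 96] chi\<^sub>c(1) by auto
  then obtain a b where R4: "jet1 (\<lambda>h. R4 (chi\<^sub>c + k * h) (j\<^sub>c + h)) a b"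
    unfolding R4_def by (auto simp flip: power_add)
  note mu = jet1_mu1[of k] jet1_mu2[of k] jet1_mu3[of k]
  have "jet1 (\<lambda>h. mu0 (chi\<^sub>c + k * h) (j\<^sub>c + h)) mu\<^sub>c (t\<^sub>c * k + (chi\<^sub>c\<^sup>2 + chi\<^sub>c) / (2 * mu\<^sub>c))"
    by (rule jet1_mu0)
  note * = jet1_divide'[OF jet1_diff[OF jet1_diff[OF jet1_cmult[OF R4, of "1 / 8"]
        jet1_mult[OF jet1_cmult[OF mu(1), of 4] mu(3)]] jet1_cmult[OF jet1_power2[OF mu(2)], of 3]]
      this mu\<^sub>c_pos[THEN less_imp_neq, symmetric]]
  have eq: "mu4 x j = (1 / 8 * R4 x j - 4 * mu1 x j * mu3 x j - 3 * (mu2 x j)\<^sup>2) / mu0 x j" for x j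
    by (simp add: mu4_def)
  from jet[OF *] show ?thesis
    unfolding eq[symmetric] by simp
qed

lemma jet1_bound:
  assumes "jet1 f a b"
  obtains K d where "K \<ge> 0" "d > 0" "\<And>h. \<bar>h\<bar> < d \<Longrightarrow> \<bar>f h - (a + b * h)\<bar> \<le> K * h\<^sup>2"
proof -
  obtain c where c: "c > 0" "\<forall>\<^sub>F h in nhds 0. norm (f h - (a + b * h)) \<le> c * norm (h\<^sup>2)"
    using assms unfolding jet1_def by (rule landau_o.bigE)
  from c(2) obtain d where "d > 0" "\<And>h. dist h 0 < d \<Longrightarrow> norm (f h - (a + b * h)) \<le> c * norm (h\<^sup>2)"
    unfolding eventually_nhds_metric by blast
  with c(1) show ?thesis
    by (intro that[of c d]) auto
qed

text \<open>Joint continuity at the critical point; the bound must be uniform in both variables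
  since the intermediate point of the Taylor remainder is unknown.\<close>

lemma mu5_bound:
  obtains K d where "K \<ge> 0" "d > 0" "\<And>x j. \<bar>x - chi\<^sub>c\<bar> < d \<Longrightarrow> \<bar>j - j\<^sub>c\<bar> < d \<Longrightarrow> \<bar>mu5 x j\<bar> \<le> K"
proof -
  let ?N = "nhds (chi\<^sub>c, j\<^sub>c)"
  have x: "(fst \<longlongrightarrow> chi\<^sub>c) ?N" and j: "(snd \<longlongrightarrow> j\<^sub>c) ?N"
    using tendsto_fst[OF filterlim_ident] tendsto_snd[OF filterlim_ident] by force+
  have c: "chi\<^sub>c \<noteq> 0" using chi\<^sub>c(1) by simp
  note I = tendsto_intros x j
  have R: "((\<lambda>p. R_K (fst p) (snd p)) \<longlongrightarrow> R_K chi\<^sub>c j\<^sub>c) ?N"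
    "((\<lambda>p. R1 (fst p) (snd p)) \<longlongrightarrow> R1 chi\<^sub>c j\<^sub>c) ?N"
    "((\<lambda>p. R2 (fst p) (snd p)) \<longlongrightarrow> R2 chi\<^sub>c j\<^sub>c) ?N"
    "((\<lambda>p. R3 (fst p) (snd p)) \<longlongrightarrow> R3 chi\<^sub>c j\<^sub>c) ?N"
    "((\<lambda>p. R4 (fst p) (snd p)) \<longlongrightarrow> R4 chi\<^sub>c j\<^sub>c) ?N"
    "((\<lambda>p. R5 (fst p) (snd p)) \<longlongrightarrow> R5 chi\<^sub>c j\<^sub>c) ?N"
    unfolding R_K_def R1_def R2_def R3_def R4_def R5_def
    by (intro I c power_not_zero)+
  have ne: "mu0 chi\<^sub>c j\<^sub>c \<noteq> 0"
    using mu0_pos[OF chi\<^sub>c(1), of j\<^sub>c] by simp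
  have mu0: "((\<lambda>p. mu0 (fst p) (snd p)) \<longlongrightarrow> mu0 chi\<^sub>c j\<^sub>c) ?N"
    unfolding mu0_def by (intro tendsto_intros R) simp
  have mu1: "((\<lambda>p. mu1 (fst p) (snd p)) \<longlongrightarrow> mu1 chi\<^sub>c j\<^sub>c) ?N"
    unfolding mu1_def by (intro tendsto_intros R mu0 ne) simp
  have mu2: "((\<lambda>p. mu2 (fst p) (snd p)) \<longlongrightarrow> mu2 chi\<^sub>c j\<^sub>c) ?N"
    unfolding mu2_def by (intro tendsto_intros R mu0 mu1 ne) simp
  have mu3: "((\<lambda>p. mu3 (fst p) (snd p)) \<longlongrightarrow> mu3 chi\<^sub>c j\<^sub>c) ?N"
    unfolding mu3_def by (intro tendsto_intros R mu0 mu1 mu2 ne) simp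
  have mu4: "((\<lambda>p. mu4 (fst p) (snd p)) \<longlongrightarrow> mu4 chi\<^sub>c j\<^sub>c) ?N"
    unfolding mu4_def by (intro tendsto_intros R mu0 mu1 mu2 mu3 ne) simp
  have mu5: "((\<lambda>p. mu5 (fst p) (snd p)) \<longlongrightarrow> mu5 chi\<^sub>c j\<^sub>c) ?N"
    unfolding mu5_def by (intro tendsto_intros R mu0 mu1 mu2 mu3 mu4 ne) simp
  have "\<forall>\<^sub>F p in ?N. dist (mu5 (fst p) (snd p)) (mu5 chi\<^sub>c j\<^sub>c) < 1"
    by (rule tendstoD[OF mu5]) simp
  then obtain d where d: "d > 0"
    "\<And>p. dist p (chi\<^sub>c, j\<^sub>c) < d \<Longrightarrow> dist (mu5 (fst p) (snd p)) (mu5 chi\<^sub>c j\<^sub>c) < 1"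
    unfolding eventually_nhds_metric by blast
  show ?thesis
  proof (rule that[of "\<bar>mu5 chi\<^sub>c j\<^sub>c\<bar> + 1" "d / 2"])
    fix x j :: real
    assume xj: "\<bar>x - chi\<^sub>c\<bar> < d / 2" "\<bar>j - j\<^sub>c\<bar> < d / 2"
    have "dist (x, j) (chi\<^sub>c, j\<^sub>c) \<le> \<bar>x - chi\<^sub>c\<bar> + \<bar>j - j\<^sub>c\<bar>"
      using sqrt_sum_squares_le_sum_abs[of "x - chi\<^sub>c" "j - j\<^sub>c"]
      by (simp add: dist_Pair_Pair dist_real_def)
    with xj d(2)[of "(x, j)"] show "\<bar>mu5 x j\<bar> \<le> \<bar>mu5 chi\<^sub>c j\<^sub>c\<bar> + 1"
      by (simp add: dist_real_def)
  qed (use d in auto)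
qed

lemma abs_bound3:
  fixes p q r :: real
  assumes "\<bar>p\<bar> \<le> P" "\<bar>q\<bar> \<le> Q" "\<bar>r\<bar> \<le> R"
  shows "\<bar>p + q - r\<bar> \<le> P + Q + R"
  using assms by linarith

text \<open>The slope \<open>kap\<^sub>c\<close> refers to \<open>chi\<close>; the factor
  \<open>pi\<close> converts it to \<open>\<sigma>\<close>.\<close>

definition shift\<^sub>c :: "real \<Rightarrow> real" where
  "shift\<^sub>c h = pi * kap\<^sub>c * h"

lemma shift\<^sub>c_div_pi: "(\<sigma>\<^sub>c + shift\<^sub>c h + y) / pi = chi\<^sub>c + kap\<^sub>c * h + y / pi"
  by (simp add: shift\<^sub>c_def \<sigma>\<^sub>c_def add_divide_distrib)

text \<open>With \<open>\<tau> = \<tau>\<^sub>c + a\<close> the coefficients of \<open>y, y\<^sup>2, y\<^sup>4\<close> are compared with \<open>w_K, u_K, a4_K\<close> over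
  the common denominator \<open>\<tau> \<tau>\<^sub>c\<close>.\<close>

lemma expansion_coefficients:
  obtains K d where "K > 0" "d > 0"
    "\<And>a h. \<bar>a\<bar> < d \<Longrightarrow> \<bar>h\<bar> < d \<Longrightarrow> \<tau>\<^sub>c + a \<ge> \<tau>\<^sub>c / 2 \<and>
      \<bar>mu1 (chi\<^sub>c + kap\<^sub>c * h) (j\<^sub>c + h) / (pi * (\<tau>\<^sub>c + a)) - 1 + w_K a h\<bar> \<le> K * (\<bar>a\<bar> + \<bar>h\<bar>)\<^sup>2 \<and>
      \<bar>mu2 (chi\<^sub>c + kap\<^sub>c * h) (j\<^sub>c + h) / (2 * pi\<^sup>2 * (\<tau>\<^sub>c + a)) - u_K h\<bar> \<le> K * (\<bar>a\<bar> + \<bar>h\<bar>)\<^sup>2 \<and>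
      \<bar>mu3 (chi\<^sub>c + kap\<^sub>c * h) (j\<^sub>c + h) / (6 * pi ^ 3 * (\<tau>\<^sub>c + a))\<bar> \<le> K * (\<bar>a\<bar> + \<bar>h\<bar>)\<^sup>2 \<and>
      \<bar>mu4 (chi\<^sub>c + kap\<^sub>c * h) (j\<^sub>c + h) / (24 * pi ^ 4 * (\<tau>\<^sub>c + a)) - a4_K\<bar> \<le> K * (\<bar>a\<bar> + \<bar>h\<bar>)"
proof -
  let ?X = "\<lambda>h. chi\<^sub>c + kap\<^sub>c * h" and ?Y = "\<lambda>h. j\<^sub>c + h"
  \<comment> \<open>The equation that determines \<open>kap\<^sub>c\<close>: the first-order term of
    \<open>mu3\<close> disappears, leaving a cubic coefficient of second order.\<close>
  have zero: "3 / chi\<^sub>c * kap\<^sub>c - 3 / chi\<^sub>c\<^sup>2 - 3 * t\<^sub>c * mu2\<^sub>j = 0"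
    using chi\<^sub>c(1) by (simp add: kap\<^sub>c_def distrib_left power2_eq_square)
  obtain K1 d1 where 1: "K1 \<ge> 0" "d1 > 0" "\<And>h. \<bar>h\<bar> < d1 \<Longrightarrow> \<bar>mu1 (?X h) (?Y h) - (t\<^sub>c + mu1\<^sub>j * h)\<bar> \<le> K1 * h\<^sup>2"
    using jet1_bound[OF jet1_mu1[of kap\<^sub>c]] by blast
  obtain K2 d2 where 2: "K2 \<ge> 0" "d2 > 0" "\<And>h. \<bar>h\<bar> < d2 \<Longrightarrow> \<bar>mu2 (?X h) (?Y h) - (0 + mu2\<^sub>j * h)\<bar> \<le> K2 * h\<^sup>2"
    using jet1_bound[OF jet1_mu2[of kap\<^sub>c]] by blast
  obtain K3 d3 where 3: "K3 \<ge> 0" "d3 > 0" "\<And>h. \<bar>h\<bar> < d3 \<Longrightarrow> \<bar>mu3 (?X h) (?Y h) - (0 + 0 / mu\<^sub>c * h)\<bar> \<le> K3 * h\<^sup>2"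
    using jet1_bound[OF jet1_mu3[of kap\<^sub>c, unfolded zero]] by blast
  obtain b where "jet1 (\<lambda>h. mu4 (?X h) (?Y h)) (mu4 chi\<^sub>c j\<^sub>c) b"
    using jet1_mu4 by blast
  then obtain K4 d4 where 4: "K4 \<ge> 0" "d4 > 0"
    "\<And>h. \<bar>h\<bar> < d4 \<Longrightarrow> \<bar>mu4 (?X h) (?Y h) - (mu4 chi\<^sub>c j\<^sub>c + b * h)\<bar> \<le> K4 * h\<^sup>2"
    by (rule jet1_bound) blast
  define d where "d = Min {d1, d2, d3, d4, \<tau>\<^sub>c / 2, 1}"
  have d: "d > 0" "d \<le> d1" "d \<le> d2" "d \<le> d3" "d \<le> d4" "d \<le> \<tau>\<^sub>c / 2" "d \<le> 1"
    using 1 2 3 4 \<tau>\<^sub>c_pos by (auto simp: d_def)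
  \<comment> \<open>A lower bound for the common denominator
    \<open>(\<tau>\<^sub>c + a) * \<tau>\<^sub>c\<close>, valid because
    \<open>d \<le> \<tau>\<^sub>c / 2\<close>. The constants \<open>A1\<close> to \<open>A4\<close>
    are the numerator bounds of the four coefficients divided by it.\<close>
  define T where "T = \<tau>\<^sub>c\<^sup>2 / 2"
  have T: "T > 0" using \<tau>\<^sub>c_pos by (simp add: T_def)
  define A1 where "A1 = (K1 * \<tau>\<^sub>c + pi + \<bar>mu1\<^sub>j\<bar>) / (pi * T)"
  define A2 where "A2 = (K2 * \<tau>\<^sub>c + \<bar>mu2\<^sub>j\<bar>) / (2 * pi\<^sup>2 * T)"
  define A3 where "A3 = (K3 * \<tau>\<^sub>c) / (6 * pi ^ 3 * T)"
  define A4 where "A4 = ((K4 + \<bar>b\<bar>) * \<tau>\<^sub>c + \<bar>mu4 chi\<^sub>c j\<^sub>c\<bar>) / (24 * pi ^ 4 * T)"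
  have A: "A1 \<ge> 0" "A2 \<ge> 0" "A3 \<ge> 0" "A4 \<ge> 0"
    using 1 2 3 4 T \<tau>\<^sub>c_pos by (auto simp: A1_def A2_def A3_def A4_def)
  define K where "K = A1 + A2 + A3 + A4 + 1"
  have K: "A1 \<le> K" "A2 \<le> K" "A3 \<le> K" "A4 \<le> K" "K > 0"
    using A by (auto simp: K_def)
  show ?thesis
  proof (rule that[OF K(5) d(1)])
    fix a h :: real
    assume a: "\<bar>a\<bar> < d" and h: "\<bar>h\<bar> < d"
    define D where "D = \<bar>a\<bar> + \<bar>h\<bar>"
    have D: "D \<ge> 0" "\<bar>a\<bar> \<le> D" "\<bar>h\<bar> \<le> D" by (auto simp: D_def)
    have sq: "h\<^sup>2 \<le> D\<^sup>2" "a\<^sup>2 \<le> D\<^sup>2"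
      using D power_mono[of "\<bar>h\<bar>" D 2] power_mono[of "\<bar>a\<bar>" D 2] by auto
    have sq3: "\<bar>h * a\<bar> \<le> D\<^sup>2"
      using D mult_mono[of "\<bar>h\<bar>" D "\<bar>a\<bar>" D] by (simp add: abs_mult power2_eq_square)
    note sq = sq sq3
    have t: "\<tau>\<^sub>c + a \<ge> \<tau>\<^sub>c / 2" using a d by simp
    then have tp: "\<tau>\<^sub>c + a > 0" "T \<le> (\<tau>\<^sub>c + a) * \<tau>\<^sub>c"
      using \<tau>\<^sub>c_pos mult_right_mono[of "\<tau>\<^sub>c / 2" "\<tau>\<^sub>c + a" \<tau>\<^sub>c] by (auto simp: T_def power2_eq_square)
    have ratio: "\<bar>N / (q * ((\<tau>\<^sub>c + a) * \<tau>\<^sub>c))\<bar> \<le> K * P"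
      if "\<bar>N\<bar> \<le> B * P" "B / (q * T) \<le> K" "q > 0" "P \<ge> 0" "B \<ge> 0" for N q P B
    proof -
      have "\<bar>N / (q * ((\<tau>\<^sub>c + a) * \<tau>\<^sub>c))\<bar> = \<bar>N\<bar> / (q * ((\<tau>\<^sub>c + a) * \<tau>\<^sub>c))"
        using that tp \<tau>\<^sub>c_pos by (simp add: abs_mult)
      also have "\<dots> \<le> (B * P) / (q * T)"
        using that tp T by (intro frac_le mult_left_mono mult_pos_pos) auto
      also have "\<dots> = B / (q * T) * P" by simp
      also have "\<dots> \<le> K * P" using that by (intro mult_right_mono) auto
      finally show ?thesis .
    qed
    let ?m1 = "mu1 (?X h) (?Y h)" and ?m2 = "mu2 (?X h) (?Y h)"
    let ?m3 = "mu3 (?X h) (?Y h)" and ?m4 = "mu4 (?X h) (?Y h)"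
    have e1: "\<bar>?m1 / (pi * (\<tau>\<^sub>c + a)) - 1 + w_K a h\<bar> \<le> K * D\<^sup>2"
    proof -
      \<comment> \<open>Here \<open>T\<close> stands for \<open>\<tau>\<^sub>c + a\<close> and
        \<open>c\<close> for \<open>\<tau>\<^sub>c\<close>, so \<open>T - c\<close> is
        \<open>a\<close>. Apart from the jet remainder of \<open>mu1\<close> the numerator contains
        only products of two controls.\<close>
      have "m / (pi * T) - 1 + ((T - c) - b / pi * h) / c
          = ((m - (pi * c + b * h)) * c + pi * (T - c)\<^sup>2 - b * (h * (T - c))) / (pi * (T * c))"
        if "T \<noteq> 0" "c \<noteq> 0" for m T c b :: real
        using that by (simp add: field_simps power2_eq_square)
      moreover have "t\<^sub>c = pi * \<tau>\<^sub>c" by (simp add: \<tau>\<^sub>c_eq)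
      ultimately have eq: "?m1 / (pi * (\<tau>\<^sub>c + a)) - 1 + w_K a h
          = ((?m1 - (t\<^sub>c + mu1\<^sub>j * h)) * \<tau>\<^sub>c + pi * a\<^sup>2 - mu1\<^sub>j * (h * a)) / (pi * ((\<tau>\<^sub>c + a) * \<tau>\<^sub>c))"
        using tp(1) \<tau>\<^sub>c_pos unfolding w_K_def m_\<sigma>j_c
        by (metis add_diff_cancel_left' less_irrefl)
      have "\<bar>?m1 - (t\<^sub>c + mu1\<^sub>j * h)\<bar> * \<tau>\<^sub>c \<le> K1 * D\<^sup>2 * \<tau>\<^sub>c"
        using 1(3)[of h] h d sq mult_left_mono[OF sq(1) 1(1)] \<tau>\<^sub>c_pos by (intro mult_right_mono) auto
      moreover have "\<bar>mu1\<^sub>j\<bar> * \<bar>h * a\<bar> \<le> \<bar>mu1\<^sub>j\<bar> * D\<^sup>2" "pi * a\<^sup>2 \<le> pi * D\<^sup>2"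
        using sq by (auto intro: mult_left_mono)
      ultimately have "\<bar>(?m1 - (t\<^sub>c + mu1\<^sub>j * h)) * \<tau>\<^sub>c + pi * a\<^sup>2 - mu1\<^sub>j * (h * a)\<bar>
          \<le> K1 * D\<^sup>2 * \<tau>\<^sub>c + pi * D\<^sup>2 + \<bar>mu1\<^sub>j\<bar> * D\<^sup>2"
        using \<tau>\<^sub>c_pos by (intro abs_bound3) (simp_all add: abs_mult)
      also have "\<dots> = (K1 * \<tau>\<^sub>c + pi + \<bar>mu1\<^sub>j\<bar>) * D\<^sup>2"
        by (simp add: algebra_simps)
      finally have "\<bar>(?m1 - (t\<^sub>c + mu1\<^sub>j * h)) * \<tau>\<^sub>c + pi * a\<^sup>2 - mu1\<^sub>j * (h * a)\<bar>
          \<le> (K1 * \<tau>\<^sub>c + pi + \<bar>mu1\<^sub>j\<bar>) * D\<^sup>2" .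
      from ratio[OF this K(1)[unfolded A1_def]] show ?thesis
        unfolding eq using 1(1) \<tau>\<^sub>c_pos by simp
    qed
    have two: "m / (q * T) - n / (q * c) = ((m - n) * c - n * (T - c)) / (q * (T * c))"
      if "T \<noteq> 0" "c \<noteq> 0" "q \<noteq> 0" for m n T c q :: real
      using that by (simp add: field_simps)
    have e2: "\<bar>?m2 / (2 * pi\<^sup>2 * (\<tau>\<^sub>c + a)) - u_K h\<bar> \<le> K * D\<^sup>2"
    proof -
      have eq: "?m2 / (2 * pi\<^sup>2 * (\<tau>\<^sub>c + a)) - u_K h
          = ((?m2 - mu2\<^sub>j * h) * \<tau>\<^sub>c + 0 - mu2\<^sub>j * (h * a)) / (2 * pi\<^sup>2 * ((\<tau>\<^sub>c + a) * \<tau>\<^sub>c))"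
        using two[of "\<tau>\<^sub>c + a" "\<tau>\<^sub>c" "2 * pi\<^sup>2" ?m2 "mu2\<^sub>j * h"] tp(1) \<tau>\<^sub>c_pos
        unfolding u_K_def m_\<sigma>\<sigma>j_c by (simp add: mult_ac)
      have "\<bar>?m2 - mu2\<^sub>j * h\<bar> * \<tau>\<^sub>c \<le> K2 * D\<^sup>2 * \<tau>\<^sub>c"
        using 2(3)[of h] h d sq mult_left_mono[OF sq(1) 2(1)] \<tau>\<^sub>c_pos by (intro mult_right_mono) auto
      moreover have "\<bar>mu2\<^sub>j\<bar> * \<bar>h * a\<bar> \<le> \<bar>mu2\<^sub>j\<bar> * D\<^sup>2"
        using sq by (auto intro: mult_left_mono)
      ultimately have "\<bar>(?m2 - mu2\<^sub>j * h) * \<tau>\<^sub>c + 0 - mu2\<^sub>j * (h * a)\<bar> \<le> K2 * D\<^sup>2 * \<tau>\<^sub>c + 0 + \<bar>mu2\<^sub>j\<bar> * D\<^sup>2"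
        using \<tau>\<^sub>c_pos by (intro abs_bound3) (simp_all add: abs_mult)
      also have "\<dots> = (K2 * \<tau>\<^sub>c + \<bar>mu2\<^sub>j\<bar>) * D\<^sup>2"
        by (simp add: algebra_simps)
      finally have "\<bar>(?m2 - mu2\<^sub>j * h) * \<tau>\<^sub>c + 0 - mu2\<^sub>j * (h * a)\<bar> \<le> (K2 * \<tau>\<^sub>c + \<bar>mu2\<^sub>j\<bar>) * D\<^sup>2" .
      from ratio[OF this K(2)[unfolded A2_def]] show ?thesis
        unfolding eq using 2(1) \<tau>\<^sub>c_pos by simp
    qed
    have e3: "\<bar>?m3 / (6 * pi ^ 3 * (\<tau>\<^sub>c + a))\<bar> \<le> K * D\<^sup>2"
    proof -
      have eq: "?m3 / (6 * pi ^ 3 * (\<tau>\<^sub>c + a)) = (?m3 * \<tau>\<^sub>c) / (6 * pi ^ 3 * ((\<tau>\<^sub>c + a) * \<tau>\<^sub>c))"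
        using tp(1) \<tau>\<^sub>c_pos by simp
      have "\<bar>?m3\<bar> * \<tau>\<^sub>c \<le> K3 * D\<^sup>2 * \<tau>\<^sub>c"
        using 3(3)[of h] h d sq mult_left_mono[OF sq(1) 3(1)] \<tau>\<^sub>c_pos by (intro mult_right_mono) auto
      then have "\<bar>?m3 * \<tau>\<^sub>c\<bar> \<le> (K3 * \<tau>\<^sub>c) * D\<^sup>2"
        using \<tau>\<^sub>c_pos by (simp add: abs_mult mult_ac)
      from ratio[OF this K(3)[unfolded A3_def]] show ?thesis
        unfolding eq using 3(1) \<tau>\<^sub>c_pos by simp
    qed
    have e4: "\<bar>?m4 / (24 * pi ^ 4 * (\<tau>\<^sub>c + a)) - a4_K\<bar> \<le> K * D"
    proof -
      let ?m = "mu4 chi\<^sub>c j\<^sub>c"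
      have eq: "?m4 / (24 * pi ^ 4 * (\<tau>\<^sub>c + a)) - a4_K
          = ((?m4 - ?m) * \<tau>\<^sub>c + 0 - ?m * a) / (24 * pi ^ 4 * ((\<tau>\<^sub>c + a) * \<tau>\<^sub>c))"
        using two[of "\<tau>\<^sub>c + a" "\<tau>\<^sub>c" "24 * pi ^ 4"] tp(1) \<tau>\<^sub>c_pos unfolding a4_K_eq by simp
      have "\<bar>?m4 - ?m\<bar> * \<tau>\<^sub>c \<le> (K4 + \<bar>b\<bar>) * D * \<tau>\<^sub>c"
      proof (intro mult_right_mono)
        have "h\<^sup>2 \<le> D"
          using h d D mult_mono[of "\<bar>h\<bar>" D "\<bar>h\<bar>" 1] by (simp add: power2_eq_square)
        then have "K4 * h\<^sup>2 \<le> K4 * D" using 4(1) by (rule mult_left_mono)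
        moreover have "\<bar>b * h\<bar> \<le> \<bar>b\<bar> * D" using D by (simp add: abs_mult mult_left_mono)
        ultimately show "\<bar>?m4 - mu4 chi\<^sub>c j\<^sub>c\<bar> \<le> (K4 + \<bar>b\<bar>) * D"
          using 4(3)[of h] h d by (simp add: algebra_simps)
      qed (use \<tau>\<^sub>c_pos in simp)
      moreover have "\<bar>?m * a\<bar> \<le> \<bar>?m\<bar> * D"
        using D by (auto simp: abs_mult intro: mult_left_mono)
      ultimately have "\<bar>(?m4 - ?m) * \<tau>\<^sub>c + 0 - ?m * a\<bar> \<le> (K4 + \<bar>b\<bar>) * D * \<tau>\<^sub>c + 0 + \<bar>?m\<bar> * D"
        using \<tau>\<^sub>c_pos by (intro abs_bound3) (simp_all add: abs_mult)
      also have "\<dots> = ((K4 + \<bar>b\<bar>) * \<tau>\<^sub>c + \<bar>?m\<bar>) * D"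
        by (simp add: algebra_simps)
      finally have "\<bar>(?m4 - ?m) * \<tau>\<^sub>c + 0 - ?m * a\<bar> \<le> ((K4 + \<bar>b\<bar>) * \<tau>\<^sub>c + \<bar>?m\<bar>) * D" .
      from ratio[OF this K(4)[unfolded A4_def]] show ?thesis
        unfolding eq using 4(1) \<tau>\<^sub>c_pos D(1) by simp
    qed
    show "\<tau>\<^sub>c + a \<ge> \<tau>\<^sub>c / 2 \<and>
      \<bar>?m1 / (pi * (\<tau>\<^sub>c + a)) - 1 + w_K a h\<bar> \<le> K * (\<bar>a\<bar> + \<bar>h\<bar>)\<^sup>2 \<and>
      \<bar>?m2 / (2 * pi\<^sup>2 * (\<tau>\<^sub>c + a)) - u_K h\<bar> \<le> K * (\<bar>a\<bar> + \<bar>h\<bar>)\<^sup>2 \<and>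
      \<bar>?m3 / (6 * pi ^ 3 * (\<tau>\<^sub>c + a))\<bar> \<le> K * (\<bar>a\<bar> + \<bar>h\<bar>)\<^sup>2 \<and>
      \<bar>?m4 / (24 * pi ^ 4 * (\<tau>\<^sub>c + a)) - a4_K\<bar> \<le> K * (\<bar>a\<bar> + \<bar>h\<bar>)"
      using t e1 e2 e3 e4 by (simp add: D_def)
  qed
qed

text \<open>Taylor expansion about the translated centre. The errors in the coefficients of y, y^2,
  y^3 are O(\<Delta>^2) and go into \<Delta>^2 |y|, the one of y^4 is O(\<Delta>) and goes into
  \<Delta> |y|^3, and the remainder gives |y|^5.\<close>

lemma I_K_expansion:
  obtains K d where "K > 0" "d > 0"
    "\<And>y a h. \<bar>y\<bar> < d \<Longrightarrow> \<bar>a\<bar> < d \<Longrightarrow> \<bar>h\<bar> < d \<Longrightarrow>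
      \<bar>I_K (\<sigma>\<^sub>c + shift\<^sub>c h + y) (\<tau>\<^sub>c + a) (j\<^sub>c + h)
        - (I_K (\<sigma>\<^sub>c + shift\<^sub>c h) (\<tau>\<^sub>c + a) (j\<^sub>c + h) - w_K a h * y + u_K h * y\<^sup>2 + a4_K * y ^ 4)\<bar>
      \<le> K * (\<bar>y\<bar> ^ 5 + (\<bar>a\<bar> + \<bar>h\<bar>) * \<bar>y\<bar> ^ 3 + (\<bar>a\<bar> + \<bar>h\<bar>)\<^sup>2 * \<bar>y\<bar>)"
proof -
  obtain K1 d1 where 1: "K1 > 0" "d1 > 0"
    "\<And>a h. \<bar>a\<bar> < d1 \<Longrightarrow> \<bar>h\<bar> < d1 \<Longrightarrow> \<tau>\<^sub>c + a \<ge> \<tau>\<^sub>c / 2 \<and>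
      \<bar>mu1 (chi\<^sub>c + kap\<^sub>c * h) (j\<^sub>c + h) / (pi * (\<tau>\<^sub>c + a)) - 1 + w_K a h\<bar> \<le> K1 * (\<bar>a\<bar> + \<bar>h\<bar>)\<^sup>2 \<and>
      \<bar>mu2 (chi\<^sub>c + kap\<^sub>c * h) (j\<^sub>c + h) / (2 * pi\<^sup>2 * (\<tau>\<^sub>c + a)) - u_K h\<bar> \<le> K1 * (\<bar>a\<bar> + \<bar>h\<bar>)\<^sup>2 \<and>
      \<bar>mu3 (chi\<^sub>c + kap\<^sub>c * h) (j\<^sub>c + h) / (6 * pi ^ 3 * (\<tau>\<^sub>c + a))\<bar> \<le> K1 * (\<bar>a\<bar> + \<bar>h\<bar>)\<^sup>2 \<and>
      \<bar>mu4 (chi\<^sub>c + kap\<^sub>c * h) (j\<^sub>c + h) / (24 * pi ^ 4 * (\<tau>\<^sub>c + a)) - a4_K\<bar> \<le> K1 * (\<bar>a\<bar> + \<bar>h\<bar>)"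
    using expansion_coefficients by blast
  obtain K2 d2 where 2: "K2 \<ge> 0" "d2 > 0"
    "\<And>x j. \<bar>x - chi\<^sub>c\<bar> < d2 \<Longrightarrow> \<bar>j - j\<^sub>c\<bar> < d2 \<Longrightarrow> \<bar>mu5 x j\<bar> \<le> K2"
    using mu5_bound by blast
  define K5 where "K5 = K2 / (120 * pi ^ 5 * (\<tau>\<^sub>c / 2))"
  have K5: "K5 \<ge> 0" using 2(1) \<tau>\<^sub>c_pos by (simp add: K5_def)
  \<comment> \<open>Half of the available radius goes to the translation
    \<open>kap\<^sub>c * h\<close> and half to \<open>e = y / pi\<close>; together they keep the
    argument positive and inside the domain of the \<open>mu5\<close> bound.\<close>
  define q where "q = min d2 chi\<^sub>c / 2"
  have q: "q > 0" "2 * q \<le> d2" "2 * q \<le> chi\<^sub>c" using 2(2) chi\<^sub>c(1) by (auto simp: q_def)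
  define d where "d = Min {d1, d2, 1, q / (\<bar>kap\<^sub>c\<bar> + 1), q}"
  have d: "d > 0" "d \<le> d1" "d \<le> d2" "d \<le> 1" "d \<le> q / (\<bar>kap\<^sub>c\<bar> + 1)" "d \<le> q"
    using 1 2 q by (auto simp: d_def)
  show ?thesis
  proof (rule that[of "3 * K1 + K5" d])
    show "3 * K1 + K5 > 0" using 1 K5 by simp
    show "d > 0" by fact
    fix y a h :: real
    assume y: "\<bar>y\<bar> < d" and a: "\<bar>a\<bar> < d" and h: "\<bar>h\<bar> < d"
    define D where "D = \<bar>a\<bar> + \<bar>h\<bar>"
    have D: "D \<ge> 0" by (simp add: D_def)
    have kh: "\<bar>kap\<^sub>c * h\<bar> < q"
    proof -
      have "\<bar>kap\<^sub>c * h\<bar> \<le> (\<bar>kap\<^sub>c\<bar> + 1) * \<bar>h\<bar>" by (simp add: abs_mult algebra_simps)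
      also have "\<dots> < (\<bar>kap\<^sub>c\<bar> + 1) * (q / (\<bar>kap\<^sub>c\<bar> + 1))"
        using h d by (intro mult_strict_left_mono) auto
      also have "\<dots> = q" by simp
      finally show ?thesis .
    qed
    define e where "e = y / pi"
    have "\<bar>y\<bar> / pi \<le> \<bar>y\<bar> / 1" using pi_gt3 by (intro divide_left_mono) auto
    then have e: "\<bar>e\<bar> < q" using y d by (simp add: e_def)
    define x where "x = chi\<^sub>c + kap\<^sub>c * h"
    have x: "x > 0" "x + e > 0" using kh e q unfolding x_def by linarith+
    define j where "j = j\<^sub>c + h"
    define \<tau> where "\<tau> = \<tau>\<^sub>c + a"
    obtain t where t: "\<bar>t\<bar> \<le> \<bar>e\<bar>" "mu0 (x + e) j = mu0 x j + mu1 x j * e + mu2 x j / 2 * e\<^sup>2 + mu3 x j / 6 * e ^ 3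
           + mu4 x j / 24 * e ^ 4 + mu5 (x + t) j / 120 * e ^ 5"
      using Taylor_mu0[OF x] by metis
    have mu5: "\<bar>mu5 (x + t) j\<bar> \<le> K2"
      using t(1) e kh q h d by (intro 2(3)) (auto simp: x_def j_def)
    have "\<bar>a\<bar> < d1" "\<bar>h\<bar> < d1" using a h d by auto
    note co = 1(3)[OF this, folded x_def j_def \<tau>_def D_def]
    then have \<tau>: "\<tau> > 0" "\<tau> \<ge> \<tau>\<^sub>c / 2" using \<tau>\<^sub>c_pos by auto
    let ?c1 = "mu1 x j / (pi * \<tau>) - 1 + w_K a h"
    let ?c2 = "mu2 x j / (2 * pi\<^sup>2 * \<tau>) - u_K h"
    let ?c3 = "mu3 x j / (6 * pi ^ 3 * \<tau>)"
    let ?c4 = "mu4 x j / (24 * pi ^ 4 * \<tau>) - a4_K"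
    let ?c5 = "mu5 (x + t) j / (120 * pi ^ 5 * \<tau>)"
    have c5: "\<bar>?c5\<bar> \<le> K5"
    proof -
      have "\<bar>?c5\<bar> = \<bar>mu5 (x + t) j\<bar> / (120 * pi ^ 5 * \<tau>)" using \<tau>(1) by (simp add: abs_mult)
      also have "\<dots> \<le> K5"
        unfolding K5_def using \<tau> mu5 \<tau>\<^sub>c_pos 2(1) by (intro frac_le mult_left_mono mult_pos_pos) auto
      finally show ?thesis .
    qed
    have "I_K (\<sigma>\<^sub>c + shift\<^sub>c h + y) \<tau> j
        - (I_K (\<sigma>\<^sub>c + shift\<^sub>c h) \<tau> j - w_K a h * y + u_K h * y\<^sup>2 + a4_K * y ^ 4)
        = (mu0 (x + e) j - mu0 x j) / \<tau> - y + w_K a h * y - u_K h * y\<^sup>2 - a4_K * y ^ 4"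
      using shift\<^sub>c_div_pi[of h y] shift\<^sub>c_div_pi[of h 0]
      by (simp add: I_K_def m_K_eq_mu0 x_def e_def diff_divide_distrib)
    also have "\<dots> = ?c1 * y + ?c2 * y\<^sup>2 + ?c3 * y ^ 3 + ?c4 * y ^ 4 + ?c5 * y ^ 5"
      unfolding t(2) using \<tau>(1)
      by (simp add: add_divide_distrib) (simp add: e_def power_divide algebra_simps)
    finally have eq: "I_K (\<sigma>\<^sub>c + shift\<^sub>c h + y) \<tau> j
        - (I_K (\<sigma>\<^sub>c + shift\<^sub>c h) \<tau> j - w_K a h * y + u_K h * y\<^sup>2 + a4_K * y ^ 4)
        = ?c1 * y + ?c2 * y\<^sup>2 + ?c3 * y ^ 3 + ?c4 * y ^ 4 + ?c5 * y ^ 5" .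
    have y1: "\<bar>y\<bar> \<le> 1" using y d by simp
    have pw: "\<bar>y\<bar> ^ n \<le> \<bar>y\<bar> ^ m" if "m \<le> n" for m n
      using that y1 by (intro power_decreasing) auto
    have b: "\<bar>c * y ^ n\<bar> \<le> B * \<bar>y\<bar> ^ m" if "\<bar>c\<bar> \<le> B" "m \<le> n" for c B n m
      unfolding abs_mult power_abs using that pw[OF that(2)] by (intro mult_mono) auto
    have "\<bar>?c1 * y ^ 1\<bar> \<le> (K1 * D\<^sup>2) * \<bar>y\<bar> ^ 1"
      "\<bar>?c2 * y\<^sup>2\<bar> \<le> (K1 * D\<^sup>2) * \<bar>y\<bar> ^ 1"
      "\<bar>?c3 * y ^ 3\<bar> \<le> (K1 * D\<^sup>2) * \<bar>y\<bar> ^ 1"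
      "\<bar>?c4 * y ^ 4\<bar> \<le> (K1 * D) * \<bar>y\<bar> ^ 3"
      "\<bar>?c5 * y ^ 5\<bar> \<le> K5 * \<bar>y\<bar> ^ 5"
      using co c5 by (intro b; simp)+
    then have "\<bar>?c1 * y + ?c2 * y\<^sup>2 + ?c3 * y ^ 3 + ?c4 * y ^ 4 + ?c5 * y ^ 5\<bar>
        \<le> 3 * (K1 * (D\<^sup>2 * \<bar>y\<bar>)) + K1 * (D * \<bar>y\<bar> ^ 3) + K5 * \<bar>y\<bar> ^ 5"
    proof -
      have five: "\<bar>p1 + p2 + p3 + p4 + p5\<bar> \<le> 3 * P + Q + R"
        if "\<bar>p1\<bar> \<le> P" "\<bar>p2\<bar> \<le> P" "\<bar>p3\<bar> \<le> P" "\<bar>p4\<bar> \<le> Q" "\<bar>p5\<bar> \<le> R"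
        for p1 p2 p3 p4 p5 P Q R :: real
        using that by linarith
      assume *: "\<bar>?c1 * y ^ 1\<bar> \<le> (K1 * D\<^sup>2) * \<bar>y\<bar> ^ 1"
        "\<bar>?c2 * y\<^sup>2\<bar> \<le> (K1 * D\<^sup>2) * \<bar>y\<bar> ^ 1"
        "\<bar>?c3 * y ^ 3\<bar> \<le> (K1 * D\<^sup>2) * \<bar>y\<bar> ^ 1"
        "\<bar>?c4 * y ^ 4\<bar> \<le> (K1 * D) * \<bar>y\<bar> ^ 3"
        "\<bar>?c5 * y ^ 5\<bar> \<le> K5 * \<bar>y\<bar> ^ 5"
      from five[OF this] show ?thesis
        by (simp only: power_one_right mult.assoc)
    qed
    also have "\<dots> \<le> (3 * K1 + K5) * (\<bar>y\<bar> ^ 5 + D * \<bar>y\<bar> ^ 3 + D\<^sup>2 * \<bar>y\<bar>)"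
    proof -
      have "0 \<le> K1 * \<bar>y\<bar> ^ 5" "0 \<le> K1 * (D * \<bar>y\<bar> ^ 3)" "0 \<le> K5 * (D * \<bar>y\<bar> ^ 3)" "0 \<le> K5 * (D\<^sup>2 * \<bar>y\<bar>)"
        using 1 K5 D by auto
      then show ?thesis by (simp add: algebra_simps)
    qed
    finally show "\<bar>I_K (\<sigma>\<^sub>c + shift\<^sub>c h + y) (\<tau>\<^sub>c + a) (j\<^sub>c + h)
        - (I_K (\<sigma>\<^sub>c + shift\<^sub>c h) (\<tau>\<^sub>c + a) (j\<^sub>c + h) - w_K a h * y + u_K h * y\<^sup>2 + a4_K * y ^ 4)\<bar>
      \<le> (3 * K1 + K5) * (\<bar>y\<bar> ^ 5 + (\<bar>a\<bar> + \<bar>h\<bar>) * \<bar>y\<bar> ^ 3 + (\<bar>a\<bar> + \<bar>h\<bar>)\<^sup>2 * \<bar>y\<bar>)"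
      unfolding eq[unfolded \<tau>_def j_def] D_def[symmetric] \<tau>_def j_def .
  qed
qed

section \<open>Moments of the quartic weight\<close>

lemma power_le_fact_exp:
  assumes "0 \<le> x"
  shows "x ^ n \<le> fact n * exp (x :: real)"
proof -
  have "x ^ n / fact n \<le> (\<Sum>k<Suc n. x ^ k / fact k)"
    using assms by (intro member_le_sum) auto
  also have "\<dots> \<le> (\<Sum>k. x ^ k / fact k)"
    using assms summable_exp[of x] by (intro sum_le_suminf) (auto simp: divide_inverse mult.commute)
  also have "\<dots> = exp x"
    by (simp add: exp_def divide_inverse mult.commute)
  finally show ?thesis by (simp add: field_simps)
qed

lemma abs_power_le_exp:
  assumes "c > 0"
  shows "\<bar>x\<bar> ^ n \<le> fact n / c ^ n * exp (c * \<bar>x :: real\<bar>)"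
  using power_le_fact_exp[of "c * \<bar>x\<bar>" n] assms by (simp add: power_mult_distrib field_simps)

lemma integrable_exp_abs:
  assumes "c > 0"
  shows "integrable lborel (\<lambda>x::real. exp (- c * \<bar>x\<bar>))"
proof -
  let ?f = "\<lambda>x::real. exp (- c * x) * indicator {0..} x"
  have "(\<integral>\<^sup>+x. ennreal (exp (- c * x)) * indicator {0..} x \<partial>lborel) = ennreal (0 - (- exp (- c * 0) / c))"
  proof (rule nn_integral_FTC_atLeast)
    show "DERIV (\<lambda>x. - exp (- c * x) / c) x :> exp (- c * x)" for x
      using assms by (auto intro!: derivative_eq_intros)
    have "filterlim (\<lambda>x. c * x) at_top at_top"
      using assms by (intro filterlim_tendsto_pos_mult_at_top[OF tendsto_const] filterlim_ident)
    then have "((\<lambda>x. exp (- (c * x))) \<longlongrightarrow> 0) at_top"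
      by (intro filterlim_compose[OF exp_at_bot] filterlim_compose[OF filterlim_uminus_at_bot_at_top])
    from tendsto_divide[OF tendsto_minus[OF this] tendsto_const[of c]] assms
    show "((\<lambda>x. - exp (- c * x) / c) \<longlongrightarrow> 0) at_top" by simp
  qed auto
  then have "(\<integral>\<^sup>+x. ennreal (?f x) \<partial>lborel) = ennreal (1 / c)"
    by (simp add: ennreal_mult' ennreal_indicator)
  then have f: "integrable lborel ?f"
    by (intro integrableI_nn_integral_finite) auto
  \<comment> \<open>The reflected half-line function; its sum with \<open>?f\<close> dominates
    \<open>exp (- c * \<bar>x\<bar>)\<close>, with equality away from 0.\<close>
  have f': "integrable lborel (\<lambda>x. ?f (0 + (- 1) * x))"
    by (rule lborel_integrable_real_affine[OF f]) simp
  show ?thesis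
    by (rule Bochner_Integration.integrable_bound[OF Bochner_Integration.integrable_add[OF f f']])
      (auto simp: indicator_def)
qed

lemma integrable_power_exp_abs:
  assumes "c > 0"
  shows "integrable lborel (\<lambda>x::real. x ^ n * exp (- c * \<bar>x\<bar>))"
proof (rule Bochner_Integration.integrable_bound)
  show "integrable lborel (\<lambda>x::real. fact n / (c / 2) ^ n * exp (- (c / 2) * \<bar>x\<bar>))"
    using assms by (intro integrable_mult_right integrable_exp_abs) auto
  show "AE x in lborel. norm (x ^ n * exp (- c * \<bar>x\<bar>)) \<le> norm (fact n / (c / 2) ^ n * exp (- (c / 2) * \<bar>x\<bar>))"
  proof (rule AE_I2)
    fix x :: real
    have "\<bar>x\<bar> ^ n * exp (- c * \<bar>x\<bar>) \<le> (fact n / (c / 2) ^ n * exp (c / 2 * \<bar>x\<bar>)) * exp (- c * \<bar>x\<bar>)"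
      using assms by (intro mult_right_mono abs_power_le_exp) auto
    also have "\<dots> = fact n / (c / 2) ^ n * exp (c / 2 * \<bar>x\<bar> + - c * \<bar>x\<bar>)"
      by (simp only: exp_add mult.assoc)
    also have "c / 2 * \<bar>x\<bar> + - c * \<bar>x\<bar> = - (c / 2) * \<bar>x\<bar>"
      by (simp add: field_simps)
    finally show "norm (x ^ n * exp (- c * \<bar>x\<bar>)) \<le> norm (fact n / (c / 2) ^ n * exp (- (c / 2) * \<bar>x\<bar>))"
      using assms by (simp add: abs_mult power_abs)
  qed
qed auto

abbreviation quartic :: "real \<Rightarrow> real \<Rightarrow> real" where
  "quartic l x \<equiv> x ^ 4 + l * x\<^sup>2"

definition moment :: "real \<Rightarrow> nat \<Rightarrow> real" where
  "moment l n = (LBINT x. x ^ n * exp (- quartic l x))"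

lemma exp_quartic_le:
  assumes "l \<ge> 0"
  shows "exp (- quartic l x) \<le> exp 1 * exp (- \<bar>x\<bar>)"
proof -
  have "\<bar>x\<bar> \<le> 1 + x ^ 4"
  proof (cases "\<bar>x\<bar> \<le> 1")
    case True
    then show ?thesis by (intro order_trans[OF True]) simp
  next
    case False
    then have "\<bar>x\<bar> ^ 1 \<le> \<bar>x\<bar> ^ 4" by (intro power_increasing) auto
    then show ?thesis by simp
  qed
  moreover have "l * x\<^sup>2 \<ge> 0" using assms by simp
  ultimately have "- quartic l x \<le> 1 + - \<bar>x\<bar>" by linarith
  then show ?thesis by (simp flip: exp_add)
qed

lemma integrable_moment:
  assumes "l \<ge> 0"
  shows "integrable lborel (\<lambda>x. x ^ n * exp (- quartic l x))"
proof (rule Bochner_Integration.integrable_bound)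
  show "integrable lborel (\<lambda>x::real. exp 1 * (x ^ n * exp (- 1 * \<bar>x\<bar>)))"
    using integrable_mult_right[OF integrable_power_exp_abs[of 1 n], of "exp 1"] by simp
  show "AE x in lborel. norm (x ^ n * exp (- quartic l x)) \<le> norm (exp 1 * (x ^ n * exp (- 1 * \<bar>x\<bar>)))"
    using mult_left_mono[OF exp_quartic_le[OF assms], of "\<bar>x ^ n\<bar>" for x]
    by (intro AE_I2) (simp add: abs_mult mult_ac)
qed auto

text \<open>On the unit interval the integrand is at least \<open>exp (- (1 + l))\<close>, which
  gives a strictly positive lower bound for the integral.\<close>

lemma moment_0_pos:
  assumes "l \<ge> 0"
  shows "moment l 0 > 0"
proof -
  have i: "integrable lborel (\<lambda>x. indicator {0..1::real} x * exp (- (1 + l)))"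
    by simp
  have "0 < (LBINT x. indicator {0..1::real} x * exp (- (1 + l)))"
    by simp
  also have "\<dots> \<le> moment l 0"
    unfolding moment_def
  proof (rule integral_mono[OF i integrable_moment[OF assms]])
    fix x :: real
    show "indicator {0..1} x * exp (- (1 + l)) \<le> x ^ 0 * exp (- quartic l x)"
    proof (cases "x \<in> {0..1}")
      case True
      then have "x ^ 4 \<le> 1" "x\<^sup>2 \<le> 1" by (auto intro: power_le_one)
      then have "x ^ 4 + l * x\<^sup>2 \<le> 1 + l * 1"
        using assms by (intro add_mono mult_left_mono) auto
      then show ?thesis using True by simp
    qed simp
  qed
  finally show ?thesis .
qed

lemma moment_even_nonneg:
  assumes "even n"
  shows "moment l n \<ge> 0"
  unfolding moment_def using assms
  by (intro Bochner_Integration.integral_nonneg mult_nonneg_nonneg zero_le_even_power) auto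

lemma tendsto_power_exp_quartic:
  assumes "l \<ge> 0" "filterlim (\<lambda>x. \<bar>x\<bar>) at_top F"
  shows "((\<lambda>x. x ^ n * exp (- quartic l x)) \<longlongrightarrow> 0) F"
proof (rule Lim_null_comparison)
  let ?C = "exp 1 * (fact n / (1 / 2) ^ n) :: real"
  show "\<forall>\<^sub>F x in F. norm (x ^ n * exp (- quartic l x)) \<le> ?C * exp (- (1 / 2 * \<bar>x\<bar>))"
  proof (rule always_eventually, rule allI)
    fix x :: real
    have "norm (x ^ n * exp (- quartic l x)) = \<bar>x\<bar> ^ n * exp (- quartic l x)"
      by (simp add: abs_mult power_abs)
    also have "\<dots> \<le> (fact n / (1 / 2) ^ n * exp (1 / 2 * \<bar>x\<bar>)) * (exp 1 * exp (- \<bar>x\<bar>))"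
      by (intro mult_mono exp_quartic_le abs_power_le_exp assms) auto
    also have "\<dots> = ?C * exp (1 / 2 * \<bar>x\<bar> + - \<bar>x\<bar>)"
      unfolding exp_add by (simp only: mult_ac)
    also have "1 / 2 * \<bar>x\<bar> + - \<bar>x\<bar> = - (1 / 2 * \<bar>x\<bar>)" by simp
    finally show "norm (x ^ n * exp (- quartic l x)) \<le> ?C * exp (- (1 / 2 * \<bar>x\<bar>))" .
  qed
  have "filterlim (\<lambda>x. 1 / 2 * \<bar>x\<bar>) at_top F"
    by (intro filterlim_tendsto_pos_mult_at_top[OF tendsto_const] assms) simp
  then have "((\<lambda>x. exp (- (1 / 2 * \<bar>x\<bar>))) \<longlongrightarrow> 0) F"
    by (intro filterlim_compose[OF exp_at_bot] filterlim_compose[OF filterlim_uminus_at_bot_at_top])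
  from tendsto_mult[OF tendsto_const[of ?C] this]
  show "((\<lambda>x. ?C * exp (- (1 / 2 * \<bar>x\<bar>))) \<longlongrightarrow> 0) F" by simp
qed

text \<open>Integration by parts: the derivative of \<open>x ^ Suc n * exp (- quartic l x)\<close>
  integrates to 0 over the line. The case \<open>n = 0\<close> is the virial identity behind
  \<open>\<Phi>\<close>; \<open>n = 2\<close> serves the limit of large \<open>l\<close>.\<close>

lemma moment_recurrence:
  assumes "l \<ge> 0"
  shows "real (Suc n) * moment l n = 4 * moment l (n + 4) + 2 * l * moment l (n + 2)"
proof -
  let ?F = "\<lambda>x. x ^ Suc n * exp (- quartic l x)"
  let ?f = "\<lambda>x. real (Suc n) * (x ^ n * exp (- quartic l x))
    - 4 * (x ^ (n + 4) * exp (- quartic l x)) - 2 * l * (x ^ (n + 2) * exp (- quartic l x))"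
  have int: "integrable lborel ?f"
    by (intro Bochner_Integration.integrable_diff integrable_mult_right integrable_moment assms)
  have D: "(?F has_real_derivative ?f x) (at x)" for x
  proof -
    have "((\<lambda>x. exp (- quartic l x)) has_real_derivative
        exp (- quartic l x) * (- (4 * x ^ 3 + 2 * l * x))) (at x)"
      by (auto intro!: derivative_eq_intros)
    from DERIV_mult[OF DERIV_pow[of "Suc n" x] this] show ?thesis
      by (simp add: algebra_simps power_add eval_nat_numeral)
  qed
  have "(LBINT x=-\<infinity>..\<infinity>. ?f x) = 0 - 0"
  proof (rule interval_integral_FTC_integrable)
    show "(?F has_vector_derivative ?f x) (at x)" for x
      using D[of x] by (simp add: has_real_derivative_iff_has_vector_derivative)
    show "isCont ?f x" for x by (intro continuous_intros)
    show "set_integrable lborel (einterval (-\<infinity>) \<infinity>) ?f"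
      using int by (simp add: set_integrable_def)
    show "((?F \<circ> real_of_ereal) \<longlongrightarrow> 0) (at_right (-\<infinity>))"
      unfolding ereal_tendsto_simps
      by (rule tendsto_power_exp_quartic[OF assms
            filterlim_mono[OF filterlim_norm_at_top order_refl at_bot_le_at_infinity,
              unfolded real_norm_def]])
    show "((?F \<circ> real_of_ereal) \<longlongrightarrow> 0) (at_left \<infinity>)"
      unfolding ereal_tendsto_simps
      by (rule tendsto_power_exp_quartic[OF assms
            filterlim_mono[OF filterlim_norm_at_top order_refl at_top_le_at_infinity,
              unfolded real_norm_def]])
  qed simp
  moreover have "(LBINT x=-\<infinity>..\<infinity>. ?f x) = (LBINT x. ?f x)"
    by (simp add: interval_lebesgue_integral_def set_lebesgue_integral_def)
  moreover have "(LBINT x. ?f x) = real (Suc n) * moment l n - 4 * moment l (n + 4) - 2 * l * moment l (n + 2)"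
    unfolding moment_def
    by (subst Bochner_Integration.integral_diff
        Bochner_Integration.integrable_diff integrable_mult_right integrable_moment assms
        integral_mult_right_zero | simp only:)+
  ultimately show ?thesis by simp
qed

lemma abs_exp_remainder: "\<bar>exp u - 1 - u\<bar> \<le> u\<^sup>2 * exp \<bar>u :: real\<bar>"
proof -
  obtain t where t: "\<bar>t\<bar> \<le> \<bar>u\<bar>" "exp u = (\<Sum>m<2. (exp 0 / fact m) * u ^ m) + (exp t / fact 2) * u\<^sup>2"
    using Maclaurin_exp_le[of u 2] by auto
  then have "\<bar>exp u - 1 - u\<bar> = exp t / 2 * u\<^sup>2"
    by (simp add: eval_nat_numeral abs_mult)
  also have "\<dots> \<le> exp \<bar>u\<bar> * u\<^sup>2"
  proof (rule mult_right_mono)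
    have "exp t \<le> exp \<bar>u\<bar>" using t(1) by simp
    then show "exp t / 2 \<le> exp \<bar>u\<bar>" using exp_gt_zero[of t] by linarith
  qed simp
  finally show ?thesis by (simp add: mult.commute)
qed

text \<open>Differentiation under the integral with an explicit quadratic remainder. For
  \<open>\<bar>h\<bar> \<le> l / 2\<close> the factor \<open>exp \<bar>h * x\<^sup>2\<bar>\<close>
  is absorbed by half of the quadratic term of the weight, which is where
  \<open>moment (l / 2) 4\<close> comes from.\<close>

lemma DERIV_moment_0:
  assumes "l > 0"
  shows "((\<lambda>k. moment k 0) has_real_derivative - moment l 2) (at l)"
proof -
  define C where "C = moment (l / 2) 4"
  have C: "C \<ge> 0" unfolding C_def by (rule moment_even_nonneg) simp
  have bound: "\<bar>moment (l + h) 0 - moment l 0 + h * moment l 2\<bar> \<le> C * h\<^sup>2" if h: "\<bar>h\<bar> \<le> l / 2" for h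
  proof -
    have lh: "l + h \<ge> 0" "l \<ge> 0" "l / 2 \<ge> 0" using h assms by auto
    let ?r = "\<lambda>x. x ^ 0 * exp (- quartic (l + h) x) - x ^ 0 * exp (- quartic l x) + h * (x\<^sup>2 * exp (- quartic l x))"
    have int: "integrable lborel ?r"
      by (intro Bochner_Integration.integrable_diff Bochner_Integration.integrable_add
          integrable_mult_right integrable_moment lh)
    have eq: "moment (l + h) 0 - moment l 0 + h * moment l 2 = (LBINT x. ?r x)"
      unfolding moment_def
      by (subst Bochner_Integration.integral_add Bochner_Integration.integral_diff
          Bochner_Integration.integrable_diff integrable_mult_right integrable_moment lh
          integral_mult_right_zero | simp only:)+
    have "\<bar>moment (l + h) 0 - moment l 0 + h * moment l 2\<bar> \<le> (LBINT x. \<bar>?r x\<bar>)"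
      unfolding eq by (rule integral_abs_bound)
    also have "\<dots> \<le> (LBINT x. h\<^sup>2 * (x ^ 4 * exp (- quartic (l / 2) x)))"
    proof (rule integral_mono)
      fix x :: real
      have "exp (- quartic (l + h) x) = exp (- quartic l x) * exp (- h * x\<^sup>2)"
      proof -
        have "- quartic (l + h) x = - quartic l x + - h * x\<^sup>2"
          by (simp add: algebra_simps)
        then show ?thesis by (simp only: exp_add)
      qed
      moreover have "1 * (E * X) - 1 * E + h * (x\<^sup>2 * E) = E * (X - 1 - (- h * x\<^sup>2))" for E X
        by (simp add: algebra_simps)
      ultimately have r: "?r x = exp (- quartic l x) * (exp (- h * x\<^sup>2) - 1 - (- h * x\<^sup>2))"
        by (simp only: power_0)
      have "\<bar>?r x\<bar> = exp (- quartic l x) * \<bar>exp (- h * x\<^sup>2) - 1 - (- h * x\<^sup>2)\<bar>"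
        unfolding r abs_mult abs_exp_cancel ..
      also have "\<dots> \<le> exp (- quartic l x) * ((- h * x\<^sup>2)\<^sup>2 * exp \<bar>- h * x\<^sup>2\<bar>)"
        by (intro mult_left_mono abs_exp_remainder) auto
      also have "\<dots> \<le> exp (- quartic l x) * ((- h * x\<^sup>2)\<^sup>2 * exp (l / 2 * x\<^sup>2))"
        using mult_right_mono[OF h, of "x\<^sup>2"] by (intro mult_left_mono) (auto simp: abs_mult)
      also have "\<dots> = h\<^sup>2 * (x ^ 4 * exp (- quartic l x + l / 2 * x\<^sup>2))"
        unfolding exp_add by (simp add: power_mult_distrib mult_ac)
      also have "- quartic l x + l / 2 * x\<^sup>2 = - quartic (l / 2) x"
        by (simp add: field_simps)
      finally show "\<bar>?r x\<bar> \<le> h\<^sup>2 * (x ^ 4 * exp (- quartic (l / 2) x))" .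
    qed (intro integrable_abs int integrable_mult_right integrable_moment lh)+
    also have "\<dots> = C * h\<^sup>2"
      by (simp add: C_def moment_def)
    finally show ?thesis .
  qed
  have "\<forall>\<^sub>F h in at 0. norm ((moment (l + h) 0 - moment l 0) / h - (- moment l 2)) \<le> C * \<bar>h\<bar>"
    unfolding eventually_at
  proof (intro exI[of _ "l / 2"] conjI ballI impI)
    fix h :: real
    assume h: "h \<noteq> 0 \<and> dist h 0 < l / 2"
    have "(moment (l + h) 0 - moment l 0) / h - (- moment l 2)
        = (moment (l + h) 0 - moment l 0 + h * moment l 2) / h"
      using h by (simp add: field_simps)
    then show "norm ((moment (l + h) 0 - moment l 0) / h - (- moment l 2)) \<le> C * \<bar>h\<bar>"
      using bound[of h] h by (simp add: field_simps power2_eq_square)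
  qed (use assms in simp)
  moreover have "((\<lambda>h. C * \<bar>h\<bar>) \<longlongrightarrow> 0) (at (0::real))"
    by (auto intro!: tendsto_eq_intros)
  ultimately have "((\<lambda>h. (moment (l + h) 0 - moment l 0) / h - (- moment l 2)) \<longlongrightarrow> 0) (at 0)"
    by (rule Lim_null_comparison)
  then show ?thesis
    by (simp only: DERIV_def LIM_zero_iff)
qed

text \<open>The logarithmic derivative of \<open>moment l 0\<close> is
  \<open>- moment l 2 / moment l 0\<close>, and the recurrence at \<open>n = 0\<close> expresses the
  constant 1/4 by the same moments. At \<open>l = 0\<close> the prefactor removes the derivative
  term.\<close>

lemma \<Phi>_eq_moments:
  assumes "l \<ge> 0"
  shows "\<Phi> l = (moment l 4 + l * moment l 2) / moment l 0"
proof -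
  note pos = moment_0_pos[OF assms]
  have rec: "moment l 0 = 4 * moment l 4 + 2 * l * moment l 2"
    using moment_recurrence[OF assms, of 0, unfolded add_0] by simp
  have "\<Phi> l = 1 / 4 + l / 2 * (moment l 2 / moment l 0)"
  proof (cases "l = 0")
    case False
    have eq: "(LBINT x. exp (- (x ^ 4) - k * x\<^sup>2)) = moment k 0" for k
      by (simp add: moment_def)
    have "((\<lambda>k. ln (moment k 0)) has_real_derivative - moment l 2 / moment l 0) (at l)"
      using DERIV_chain2[OF DERIV_ln[OF pos] DERIV_moment_0[of l]] False assms
      by (simp add: divide_inverse mult.commute)
    then show ?thesis
      unfolding \<Phi>_def eq by (simp add: DERIV_imp_deriv)
  qed (simp add: \<Phi>_def)
  then show ?thesis
    using rec pos by (simp add: field_simps)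
qed

lemma \<Phi>_0: "\<Phi> 0 = 1 / 4"
  by (simp add: \<Phi>_def)

text \<open>The deviation from 1/2 is exactly \<open>- moment l 4 / moment l 0\<close>. The
  recurrences give 2 l A \<le> 3 B and 2 l B \<le> Z for the moments A, B, Z of orders 4, 2, 0,
  hence a deviation of order \<open>1 / (l * l)\<close>.\<close>

lemma \<Phi>_at_top: "(\<Phi> \<longlongrightarrow> 1 / 2) at_top"
proof -
  have bound: "norm (\<Phi> l - 1 / 2) \<le> 1 / (l * l)" if l: "l > 0" for l
  proof -
    define A B Z where "A = moment l 4" "B = moment l 2" "Z = moment l 0"
    have Z: "Z > 0" and nn: "A \<ge> 0" "B \<ge> 0" "moment l 6 \<ge> 0"
      using l by (auto simp: A_B_Z_def intro!: moment_0_pos moment_even_nonneg)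
    have r0: "Z = 4 * A + 2 * l * B" and r2: "3 * B = 4 * moment l 6 + 2 * l * A"
      using moment_recurrence[of l 0, unfolded add_0] moment_recurrence[of l 2] l by (simp_all add: A_B_Z_def)
    have "2 * (l * A) \<le> 3 * B" using r2 nn(3) by simp
    then have "2 * l * (l * A) \<le> 3 * (l * B)"
      using l mult_left_mono[of "2 * (l * A)" "3 * B" l] by (simp add: algebra_simps)
    also have "2 * (l * B) \<le> Z" using r0 nn(1) by simp
    then have "3 * (l * B) \<le> 2 * Z" using Z by simp
    finally have AZ: "l * l * A \<le> Z" by (simp add: mult_ac)
    have "\<Phi> l = (A + l * B) / Z"
      using l by (simp add: \<Phi>_eq_moments A_B_Z_def)
    also have "A + l * B = Z / 2 - A" using r0 by simp
    finally have "\<Phi> l - 1 / 2 = - A / Z"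
      using Z by (simp add: field_simps)
    moreover have "A / Z \<le> 1 / (l * l)" "A / Z \<ge> 0"
      using AZ Z nn l by (simp_all add: field_simps)
    ultimately show ?thesis by simp
  qed
  have "((\<lambda>l. 1 / (l * l)) \<longlongrightarrow> 0) (at_top :: real filter)"
    by (intro tendsto_divide_0[OF tendsto_const] filterlim_at_top_imp_at_infinity
        filterlim_at_top_mult_at_top filterlim_ident)
  then have "((\<lambda>l. \<Phi> l - 1 / 2) \<longlongrightarrow> 0) at_top"
    by (rule Lim_null_comparison[rotated]) (use bound in \<open>auto intro: eventually_mono[OF eventually_gt_at_top[of 0]]\<close>)
  then show ?thesis by (simp only: LIM_zero_iff)
qed

text \<open>The substitution of \<open>inverse t\<close> turns the filter into
  \<open>at_top\<close>. Integrability is recorded as well, since splitting the average into its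
  action and constant parts requires it.\<close>

lemma integral_dominated_convergence_at_right_0:
  fixes s :: "real \<Rightarrow> 'a \<Rightarrow> real"
  assumes "f \<in> borel_measurable M" "\<And>t. s t \<in> borel_measurable M" "integrable M w"
    and "\<And>x. ((\<lambda>t. s t x) \<longlongrightarrow> f x) (at_right 0)"
    and "\<forall>\<^sub>F t in at_right 0. \<forall>x. norm (s t x) \<le> w x"
  shows "((\<lambda>t. integral\<^sup>L M (s t)) \<longlongrightarrow> integral\<^sup>L M f) (at_right 0)"
    and "\<forall>\<^sub>F t in at_right 0. integrable M (s t)"
proof -
  show "((\<lambda>t. integral\<^sup>L M (s t)) \<longlongrightarrow> integral\<^sup>L M f) (at_right 0)"
    using assms unfolding filterlim_at_right_to_top eventually_at_right_to_top
    by (intro integral_dominated_convergence_at_top[of f M "\<lambda>t. s (inverse t)" w])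
      (auto elim!: eventually_mono)
  show "\<forall>\<^sub>F t in at_right 0. integrable M (s t)"
    using assms(5)
  proof eventually_elim
    case (elim t)
    show ?case
      by (rule Bochner_Integration.integrable_bound[OF assms(3,2)])
        (use elim in \<open>auto intro!: AE_I2 order_trans[OF _ abs_ge_self]\<close>)
  qed
qed

section \<open>Laplace asymptotics of convex actions\<close>

lemma convex_on_scale:
  fixes F :: "real \<Rightarrow> real"
  assumes "convex_on {a<..} F" "F 0 = 0" "a < 0" "a < x" "0 \<le> t" "t \<le> 1"
  shows "F (t * x) \<le> t * F x"
  using convex_onD[OF assms(1), of t 0 x] assms(2-) by simp

text \<open>As \<open>z\<close> and \<open>x\<close> have the same sign, 0 lies between
  \<open>- z\<close> and \<open>x\<close>; the chord inequality at 0 is solved for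
  \<open>F x\<close>. An upper bound at one point thus becomes a lower bound across the
  origin.\<close>

lemma convex_on_opposite:
  fixes F :: "real \<Rightarrow> real"
  assumes F: "convex_on {a<..} F" "F 0 = 0" "a < 0" and "a < x" "a < - z" "z * x > 0"
  shows "- (x / z) * F (- z) \<le> F x"
proof -
  define t where "t = z / (z + x)"
  have zx: "z + x \<noteq> 0" "0 \<le> t" "t \<le> 1"
    using assms(6) by (auto simp: t_def zero_less_mult_iff divide_simps)
  have t: "1 - t = x / (z + x)" using zx by (simp add: t_def field_simps)
  have "F ((1 - t) * (- z) + t * x) \<le> (1 - t) * F (- z) + t * F x"
    using convex_onD[OF F(1) zx(2,3), of "- z" x] assms by simp
  moreover have "(1 - t) * (- z) + t * x = 0"
    unfolding t by (simp add: t_def)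
  ultimately have "0 \<le> x / (z + x) * F (- z) + z / (z + x) * F x"
    using F(2) t by (simp add: t_def)
  then have "0 \<le> (x / (z + x) * F (- z) + z / (z + x) * F x) * ((z + x) / z)"
    using assms(6) by (intro mult_nonneg_nonneg) (auto simp: zero_less_mult_iff zero_le_divide_iff)
  also have "\<dots> = x / z * F (- z) + F x"
  proof -
    have eq: "(x / w * A + z / w * B) * (w / z) = x / z * A + B" if "w \<noteq> 0" "z \<noteq> 0" for A B w
      using that by (simp add: field_simps)
    have "z \<noteq> 0" using assms(6) by auto
    with zx(1) show ?thesis by (rule eq)
  qed
  finally show ?thesis by simp
qed

text \<open>For \<open>\<bar>x\<bar> \<ge> 1\<close> the chord from 0 to \<open>x\<close> passes
  above the value at 1 or -1, forcing slope at least 1/2. For smaller \<open>x\<close> the opposite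
  unit point gives \<open>F x \<ge> - B\<close>, and the extra 1/2 compensates
  \<open>\<bar>x\<bar> / 2\<close>.\<close>

lemma convex_linear_growth:
  fixes F :: "real \<Rightarrow> real"
  assumes F: "convex_on {a<..} F" "F 0 = 0" "a < - 1"
    and one: "1 / 2 \<le> F 1" "1 / 2 \<le> F (- 1)" "F 1 \<le> B" "F (- 1) \<le> B" and x: "a < x"
  shows "\<bar>x\<bar> / 2 - (B + 1 / 2) \<le> F x"
proof (cases "\<bar>x\<bar> \<ge> 1")
  case True
  have "F (1 / \<bar>x\<bar> * x) \<le> 1 / \<bar>x\<bar> * F x"
    using F x True by (intro convex_on_scale[OF F(1)]) auto
  moreover have "1 / \<bar>x\<bar> * x = 1 \<or> 1 / \<bar>x\<bar> * x = - 1"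
    using True by (auto simp: abs_if)
  ultimately have "1 / 2 \<le> 1 / \<bar>x\<bar> * F x"
    using one(1,2) by (metis order_trans)
  then have "\<bar>x\<bar> * (1 / 2) \<le> \<bar>x\<bar> * (1 / \<bar>x\<bar> * F x)"
    by (rule mult_left_mono) simp
  also have "\<dots> = F x" using True by auto
  finally have "\<bar>x\<bar> / 2 \<le> F x" by simp
  then show ?thesis using one by simp
next
  case False
  have "- B \<le> F x"
  proof (cases "x = 0")
    case False
    have "\<bar>x\<bar> * F (- sgn x) \<le> \<bar>x\<bar> * B"
      using one \<open>x \<noteq> 0\<close> by (intro mult_left_mono) (auto simp: sgn_if)
    also have "\<dots> \<le> 1 * B" using one \<open>\<not> \<bar>x\<bar> \<ge> 1\<close> by (intro mult_right_mono) auto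
    finally have "- B \<le> - \<bar>x\<bar> * F (- sgn x)" by simp
    also have "- \<bar>x\<bar> * F (- sgn x) \<le> F x"
      using convex_on_opposite[OF F(1,2), of x "sgn x"] F(3) x False
      by (auto simp: sgn_if split: if_splits)
    finally show ?thesis .
  qed (use F one in simp)
  then show ?thesis using False by simp
qed

text \<open>Half of the exponent pays for the factor \<open>\<bar>F\<bar>\<close>, through
  \<open>\<bar>F\<bar> \<le> F + 2 * C \<le> 2 * exp ((F + 2 * C) / 2)\<close>; the other half
  supplies the decay. One majorant then serves numerator and denominator of the average.\<close>

lemma exp_minus_weight_bounds:
  fixes F x C :: real
  assumes "\<bar>x\<bar> / 2 - C \<le> F" "0 \<le> C"
  shows "exp (- F) \<le> 2 * exp (2 * C) * exp (- (1 / 4) * \<bar>x\<bar>)"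
    and "\<bar>F\<bar> * exp (- F) \<le> 2 * exp (2 * C) * exp (- (1 / 4) * \<bar>x\<bar>)"
proof -
  have half: "exp (- F / 2) \<le> exp (C / 2) * exp (- (1 / 4) * \<bar>x\<bar>)"
    using assms by (simp flip: exp_add)
  have "exp (- F) \<le> exp (C / 2 + (- F / 2))"
    using assms by simp
  also have "\<dots> \<le> exp (C / 2) * (exp (C / 2) * exp (- (1 / 4) * \<bar>x\<bar>))"
    unfolding exp_add using half by (intro mult_left_mono) auto
  also have "\<dots> = exp C * exp (- (1 / 4) * \<bar>x\<bar>)"
    by (simp flip: exp_add)
  also have "\<dots> \<le> 2 * exp (2 * C) * exp (- (1 / 4) * \<bar>x\<bar>)"
  proof (rule mult_right_mono)
    have "exp C \<le> exp (2 * C)" using assms by simp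
    then show "exp C \<le> 2 * exp (2 * C)" using exp_gt_zero[of "2 * C"] by linarith
  qed simp
  finally show "exp (- F) \<le> 2 * exp (2 * C) * exp (- (1 / 4) * \<bar>x\<bar>)" .
  have "\<bar>F\<bar> \<le> 2 * ((F + 2 * C) / 2)" using assms by auto
  also have "\<dots> \<le> 2 * exp ((F + 2 * C) / 2)"
    using exp_ge_add_one_self[of "(F + 2 * C) / 2"] by linarith
  finally have "\<bar>F\<bar> * exp (- F) \<le> 2 * exp ((F + 2 * C) / 2) * exp (- F)"
    by (rule mult_right_mono) simp
  also have "\<dots> = 2 * exp C * exp (- F / 2)"
  proof -
    have "(F + 2 * C) / 2 + - F = C + - F / 2" by (simp add: field_simps)
    then show ?thesis by (simp only: mult.assoc exp_add[symmetric])
  qed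
  also have "\<dots> \<le> 2 * exp C * (exp (C / 2) * exp (- (1 / 4) * \<bar>x\<bar>))"
    using half by (intro mult_left_mono) auto
  also have "\<dots> = 2 * exp (C + C / 2) * exp (- (1 / 4) * \<bar>x\<bar>)"
    by (simp only: exp_add mult.assoc)
  also have "\<dots> \<le> 2 * exp (2 * C) * exp (- (1 / 4) * \<bar>x\<bar>)"
    using assms by (intro mult_right_mono mult_left_mono) auto
  finally show "\<bar>F\<bar> * exp (- F) \<le> 2 * exp (2 * C) * exp (- (1 / 4) * \<bar>x\<bar>)" .
qed

text \<open>In the application \<open>f\<close> is the centred action divided by \<open>g\<close>,
  \<open>q\<close> the density of the energy measure and \<open>a\<close> the rescaled edge of the
  branch. Only pointwise limits are assumed for \<open>f\<close> and \<open>q\<close>.\<close>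

locale quartic_limit =
  fixes f q :: "real \<Rightarrow> real \<Rightarrow> real" and a :: "real \<Rightarrow> real" and l q0 K :: real
  assumes l: "l \<ge> 0" and q0: "q0 > 0"
    and meas: "\<And>g. f g \<in> borel_measurable borel" "\<And>g. q g \<in> borel_measurable borel"
    and conv: "\<forall>\<^sub>F g in at_right 0. convex_on {a g<..} (f g)"
    and zero: "\<And>g. f g 0 = 0"
    and a: "filterlim a at_bot (at_right 0)"
    and f_lim: "\<And>x. ((\<lambda>g. f g x) \<longlongrightarrow> quartic l x) (at_right 0)"
    and q_lim: "\<And>x. ((\<lambda>g. q g x) \<longlongrightarrow> q0) (at_right 0)"
    and q_bound: "\<forall>\<^sub>F g in at_right 0. \<forall>x>a g. 0 \<le> q g x \<and> q g x \<le> K * (1 + x\<^sup>2)"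
begin

text \<open>The moving edge is absorbed into an indicator, so all integrals run over one fixed space
  and dominated convergence applies.\<close>

definition weight :: "real \<Rightarrow> real \<Rightarrow> real" where
  "weight g x = indicator {a g<..} x * (q g x * exp (- f g x))"

lemma a_less: "\<forall>\<^sub>F g in at_right 0. a g < c"
  using a by (simp add: filterlim_at_bot_dense)

text \<open>At 1 and -1 the action tends to \<open>1 + l\<close>, so it is eventually between 1/2
  and \<open>2 + l\<close>; the constant \<open>l + 5 / 2\<close> is this upper bound plus
  1/2.\<close>

lemma growth: "\<forall>\<^sub>F g in at_right 0. \<forall>x>a g. \<bar>x\<bar> / 2 - (l + 5 / 2) \<le> f g x"
proof -
  have lim: "((\<lambda>g. f g 1) \<longlongrightarrow> 1 + l) (at_right 0)" "((\<lambda>g. f g (- 1)) \<longlongrightarrow> 1 + l) (at_right 0)"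
    using f_lim[of 1] f_lim[of "- 1"] by simp_all
  have "\<forall>\<^sub>F g in at_right 0. 1 / 2 < f g 1" "\<forall>\<^sub>F g in at_right 0. f g 1 < 2 + l"
    "\<forall>\<^sub>F g in at_right 0. 1 / 2 < f g (- 1)" "\<forall>\<^sub>F g in at_right 0. f g (- 1) < 2 + l"
    by (rule order_tendstoD[OF lim(1)] order_tendstoD[OF lim(2)]; use l in simp)+
  then show ?thesis
    using conv a_less[of "- 1"]
  proof eventually_elim
    case (elim g)
    show ?case
      using convex_linear_growth[OF elim(5) zero elim(6), of "2 + l"] elim
      by (auto simp: add.commute[of l])
  qed
qed

lemma bounds:
  "\<forall>\<^sub>F g in at_right 0. \<forall>x. norm (weight g x) \<le> K * 2 * exp (2 * (l + 5 / 2)) * ((1 + x\<^sup>2) * exp (- (1 / 4) * \<bar>x\<bar>))"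
  "\<forall>\<^sub>F g in at_right 0. \<forall>x. norm (f g x * weight g x) \<le> K * 2 * exp (2 * (l + 5 / 2)) * ((1 + x\<^sup>2) * exp (- (1 / 4) * \<bar>x\<bar>))"
proof -
  let ?C = "l + 5 / 2"
  let ?E = "\<lambda>x::real. 2 * exp (2 * ?C) * exp (- (1 / 4) * \<bar>x\<bar>)"
  have K: "K * (1 + x\<^sup>2) * ?E x = K * 2 * exp (2 * ?C) * ((1 + x\<^sup>2) * exp (- (1 / 4) * \<bar>x\<bar>))" for x
    by (simp only: mult_ac)
  \<comment> \<open>Nonnegativity of \<open>K\<close> is read off the density bound at
    \<open>x = 0\<close>, which lies beyond the edge for some \<open>g\<close>.\<close>
  obtain g where "\<forall>x>a g. 0 \<le> q g x \<and> q g x \<le> K * (1 + x\<^sup>2)" "a g < 0"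
    using eventually_happens[OF eventually_conj[OF q_bound a_less[of 0]]] by auto
  then have "0 \<le> q g 0 \<and> q g 0 \<le> K * (1 + 0\<^sup>2)" by blast
  then have K0: "K \<ge> 0" by simp
  have both: "\<forall>\<^sub>F g in at_right 0. \<forall>x. norm (weight g x) \<le> K * (1 + x\<^sup>2) * ?E x
      \<and> norm (f g x * weight g x) \<le> K * (1 + x\<^sup>2) * ?E x"
    using growth q_bound
  proof eventually_elim
    case (elim g)
    show ?case
    proof
      fix x
      show "norm (weight g x) \<le> K * (1 + x\<^sup>2) * ?E x \<and> norm (f g x * weight g x) \<le> K * (1 + x\<^sup>2) * ?E x"
      proof (cases "a g < x")
        case True
        then have q: "0 \<le> q g x" "q g x \<le> K * (1 + x\<^sup>2)" and "\<bar>x\<bar> / 2 - ?C \<le> f g x"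
          using elim by auto
        note E = exp_minus_weight_bounds[OF this(3)]
        have "q g x * exp (- f g x) \<le> K * (1 + x\<^sup>2) * ?E x"
          "q g x * (\<bar>f g x\<bar> * exp (- f g x)) \<le> K * (1 + x\<^sup>2) * ?E x"
          using q l K0 by (intro mult_mono E; simp)+
        then show ?thesis
          using True q(1) by (simp add: weight_def abs_mult mult_ac)
      next
        case False
        then show ?thesis using K0 by (simp add: weight_def)
      qed
    qed
  qed
  show "\<forall>\<^sub>F g in at_right 0. \<forall>x. norm (weight g x) \<le> K * 2 * exp (2 * ?C) * ((1 + x\<^sup>2) * exp (- (1 / 4) * \<bar>x\<bar>))"
    using both unfolding K by (rule eventually_mono) blast
  show "\<forall>\<^sub>F g in at_right 0. \<forall>x. norm (f g x * weight g x) \<le> K * 2 * exp (2 * ?C) * ((1 + x\<^sup>2) * exp (- (1 / 4) * \<bar>x\<bar>))"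
    using both unfolding K by (rule eventually_mono) blast
qed

lemma weight_measurable [measurable]: "weight g \<in> borel_measurable borel"
  unfolding weight_def [abs_def] using meas[of g] by measurable

lemma weight_lim: "((\<lambda>g. weight g x) \<longlongrightarrow> q0 * exp (- quartic l x)) (at_right 0)"
proof -
  have "\<forall>\<^sub>F g in at_right 0. weight g x = q g x * exp (- f g x)"
    using a_less[of x] by eventually_elim (simp add: weight_def)
  moreover have "((\<lambda>g. q g x * exp (- f g x)) \<longlongrightarrow> q0 * exp (- quartic l x)) (at_right 0)"
    by (intro tendsto_intros q_lim f_lim)
  ultimately show ?thesis by (simp add: filterlim_cong)
qed

lemma dominating_integrable:
  "integrable lborel (\<lambda>x::real. c * ((1 + x\<^sup>2) * exp (- (1 / 4) * \<bar>x\<bar>)))"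
proof -
  have "integrable lborel (\<lambda>x::real. x ^ 0 * exp (- (1 / 4) * \<bar>x\<bar>) + x ^ 2 * exp (- (1 / 4) * \<bar>x\<bar>))"
    by (rule Bochner_Integration.integrable_add; rule integrable_power_exp_abs; simp)
  then have "integrable lborel (\<lambda>x::real. (1 + x\<^sup>2) * exp (- (1 / 4) * \<bar>x\<bar>))"
    by (simp add: distrib_right)
  then show ?thesis by (rule integrable_mult_right)
qed

lemma integral_weight:
  "((\<lambda>g. LBINT x. weight g x) \<longlongrightarrow> q0 * moment l 0) (at_right 0)"
  "\<forall>\<^sub>F g in at_right 0. integrable lborel (weight g)"
proof -
  have eq: "(LBINT x. q0 * exp (- quartic l x)) = q0 * moment l 0"
    by (simp add: moment_def)
  show "((\<lambda>g. LBINT x. weight g x) \<longlongrightarrow> q0 * moment l 0) (at_right 0)"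
    unfolding eq[symmetric]
    by (rule integral_dominated_convergence_at_right_0(1)[OF _ _ dominating_integrable weight_lim bounds(1)]) auto
  show "\<forall>\<^sub>F g in at_right 0. integrable lborel (weight g)"
    by (rule integral_dominated_convergence_at_right_0(2)[OF _ _ dominating_integrable weight_lim bounds(1)]) auto
qed

lemma integral_f_weight:
  "((\<lambda>g. LBINT x. f g x * weight g x) \<longlongrightarrow> q0 * (moment l 4 + l * moment l 2)) (at_right 0)"
  "\<forall>\<^sub>F g in at_right 0. integrable lborel (\<lambda>x. f g x * weight g x)"
proof -
  have "(LBINT x. quartic l x * (q0 * exp (- quartic l x)))
      = (LBINT x. q0 * (x ^ 4 * exp (- quartic l x) + l * (x\<^sup>2 * exp (- quartic l x))))"
    by (intro Bochner_Integration.integral_cong refl) (simp only: distrib_right distrib_left mult_ac)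
  also have "\<dots> = q0 * (LBINT x. x ^ 4 * exp (- quartic l x) + l * (x\<^sup>2 * exp (- quartic l x)))"
    by (rule integral_mult_right_zero)
  also have "\<dots> = q0 * (moment l 4 + l * moment l 2)"
    unfolding moment_def
    by (subst Bochner_Integration.integral_add[OF integrable_moment[OF l]
        integrable_mult_right[OF integrable_moment[OF l]]]) (simp only: integral_mult_right_zero)
  finally have eq: "(LBINT x. quartic l x * (q0 * exp (- quartic l x))) = q0 * (moment l 4 + l * moment l 2)" .
  have lim: "((\<lambda>g. f g x * weight g x) \<longlongrightarrow> quartic l x * (q0 * exp (- quartic l x))) (at_right 0)" for x
    by (intro tendsto_mult f_lim weight_lim)
  note [measurable] = meas
  show "((\<lambda>g. LBINT x. f g x * weight g x) \<longlongrightarrow> q0 * (moment l 4 + l * moment l 2)) (at_right 0)"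
    unfolding eq[symmetric]
    by (rule integral_dominated_convergence_at_right_0(1)[OF _ _ dominating_integrable lim bounds(2)]) auto
  show "\<forall>\<^sub>F g in at_right 0. integrable lborel (\<lambda>x. f g x * weight g x)"
    by (rule integral_dominated_convergence_at_right_0(2)[OF _ _ dominating_integrable lim bounds(2)]) auto
qed

text \<open>Outside the compact interval of radius \<open>2 * l + 5\<close> the linear growth gives
  a nonnegative action, which cannot beat the value 0 at the origin; inside, continuity
  suffices.\<close>

lemma minimum_exists:
  "\<forall>\<^sub>F g in at_right 0. \<exists>x0>a g. \<forall>x>a g. f g x0 \<le> f g x"
proof -
  let ?r = "2 * l + 5"
  show ?thesis
    using conv growth a_less[of "- ?r"]
  proof eventually_elim
    case (elim g)
    have r: "?r > 0" using l by simp
    have "continuous_on {a g<..} (f g)"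
      by (rule convex_on_continuous[OF _ elim(1)]) simp
    then have "continuous_on {- ?r..?r} (f g)"
      by (rule continuous_on_subset) (use elim in auto)
    then obtain x0 where x0: "x0 \<in> {- ?r..?r}" "\<forall>x\<in>{- ?r..?r}. f g x0 \<le> f g x"
      using continuous_attains_inf[of "{- ?r..?r}" "f g"] r by auto
    have "f g x0 \<le> f g x" if "a g < x" for x
    proof (cases "x \<in> {- ?r..?r}")
      case False
      then have "\<bar>x\<bar> > ?r" by auto
      then have "0 \<le> f g x" using elim(2) that by force
      moreover have "f g x0 \<le> f g 0" using x0(2) r by auto
      ultimately show ?thesis using zero by simp
    qed (use x0 in auto)
    moreover have "a g < x0" using x0(1) elim(3) by auto
    ultimately show ?case by blast
  qed
qed

text \<open>Eventually the values at \<open>d\<close> and \<open>- d\<close> lie strictly between 0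
  and \<open>e\<close>. Beyond these points convexity keeps the action positive; between them the
  value at the opposite point gives a bound above \<open>- e\<close>.\<close>

lemma minimum_lower_bound:
  assumes "e > 0"
  shows "\<forall>\<^sub>F g in at_right 0. \<forall>x>a g. - e < f g x"
proof -
  \<comment> \<open>Chosen so that \<open>quartic l d \<le> (1 + l) * d \<le> e / 2\<close>, using
    \<open>d \<le> 1\<close>.\<close>
  define d where "d = min 1 (e / (2 * (1 + l)))"
  have d: "0 < d" "d \<le> 1" "d \<le> e / (2 * (1 + l))"
    using assms l by (auto simp: d_def)
  have pos: "0 < quartic l d" using d l by (intro add_pos_nonneg) auto
  have "d ^ 4 \<le> d ^ 1" "d\<^sup>2 \<le> d ^ 1" using d power_decreasing[of 1 4 d] power_decreasing[of 1 2 d] by auto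
  then have "quartic l d \<le> d + l * d" using l by (intro add_mono mult_left_mono) simp_all
  also have "\<dots> = (1 + l) * d" by (simp add: algebra_simps)
  also have "\<dots> \<le> (1 + l) * (e / (2 * (1 + l)))" using d l by (intro mult_left_mono) auto
  also have "\<dots> = e / 2" using l by (simp add: field_simps)
  finally have small: "quartic l d < e" using assms by simp
  have "((\<lambda>g. f g d) \<longlongrightarrow> quartic l d) (at_right 0)" "((\<lambda>g. f g (- d)) \<longlongrightarrow> quartic l d) (at_right 0)"
    using f_lim[of d] f_lim[of "- d"] by simp_all
  then have "\<forall>\<^sub>F g in at_right 0. 0 < f g d" "\<forall>\<^sub>F g in at_right 0. f g d < e"
    "\<forall>\<^sub>F g in at_right 0. 0 < f g (- d)" "\<forall>\<^sub>F g in at_right 0. f g (- d) < e"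
    using pos small by (auto intro!: order_tendstoD)
  then show ?thesis
    using conv a_less[of "- d"]
  proof eventually_elim
    case (elim g)
    show ?case
    proof (intro allI impI)
      fix x assume x: "a g < x"
      define s where "s = sgn x * d"
      have s: "s = d \<or> s = - d" if "x \<noteq> 0" using that by (auto simp: s_def sgn_if)
      show "- e < f g x"
      proof (cases "\<bar>x\<bar> \<ge> d")
        case True
        then have "x \<noteq> 0" using d by auto
        have "d / \<bar>x\<bar> \<le> 1" "0 < d / \<bar>x\<bar>" using True d by auto
        then have "f g (d / \<bar>x\<bar> * x) \<le> d / \<bar>x\<bar> * f g x"
          using elim(6) x d by (intro convex_on_scale[OF elim(5) zero]) auto
        moreover have "d / \<bar>x\<bar> * x = s" using \<open>x \<noteq> 0\<close> by (auto simp: s_def sgn_if)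
        ultimately have "0 < d / \<bar>x\<bar> * f g x" using s[OF \<open>x \<noteq> 0\<close>] elim by auto
        then have "0 < f g x" using \<open>0 < d / \<bar>x\<bar>\<close> zero_less_mult_pos by blast
        then show ?thesis using assms by simp
      next
        case False
        show ?thesis
        proof (cases "x = 0")
          case x0: False
          have "0 < f g (- s)" "f g (- s) < e" "a g < - s" using s[OF x0] elim d by auto
          have xs: "0 \<le> x / s" "x / s \<le> 1" "s * x > 0"
            using x0 False d by (auto simp: s_def sgn_if field_simps mult_less_0_iff)
          have "x / s * f g (- s) \<le> 1 * f g (- s)"
            using xs \<open>0 < f g (- s)\<close> by (intro mult_right_mono) auto
          then have "- e < - (x / s) * f g (- s)" using \<open>f g (- s) < e\<close> by simp
          also have "\<dots> \<le> f g x"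
            using elim(6) d x \<open>a g < - s\<close> xs by (intro convex_on_opposite[OF elim(5) zero]) auto
          finally show ?thesis .
        qed (use zero assms in simp)
      qed
    qed
  qed
qed

text \<open>The minimum is squeezed to 0 between the lower bound and the value at the origin, so
  only the quotient of integrals contributes to the limit.\<close>

lemma average_minus_minimum:
  assumes "\<forall>\<^sub>F g in at_right 0. v g = (LBINT x. f g x * weight g x) / (LBINT x. weight g x) - m g"
    and "\<forall>\<^sub>F g in at_right 0. \<exists>x0>a g. m g = f g x0 \<and> (\<forall>x>a g. f g x0 \<le> f g x)"
  shows "(v \<longlongrightarrow> \<Phi> l) (at_right 0)"
proof -
  have "(m \<longlongrightarrow> 0) (at_right 0)"
  proof (rule tendstoI)
    fix e :: real
    assume "e > 0"
    from minimum_lower_bound[OF this] assms(2) a_less[of 0]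
    show "\<forall>\<^sub>F g in at_right 0. dist (m g) 0 < e"
    proof eventually_elim
      case (elim g)
      then obtain x0 where x0: "a g < x0" "m g = f g x0" "\<forall>x>a g. f g x0 \<le> f g x" by blast
      then have "m g \<le> f g 0" "- e < m g" using elim by auto
      then show ?case using zero[of g] by (simp add: \<open>e > 0\<close>)
    qed
  qed
  moreover have "((\<lambda>g. (LBINT x. f g x * weight g x) / (LBINT x. weight g x))
      \<longlongrightarrow> (q0 * (moment l 4 + l * moment l 2)) / (q0 * moment l 0)) (at_right 0)"
    using moment_0_pos[OF l] q0 by (intro tendsto_divide integral_weight integral_f_weight) auto
  ultimately have "((\<lambda>g. (LBINT x. f g x * weight g x) / (LBINT x. weight g x) - m g)
      \<longlongrightarrow> (q0 * (moment l 4 + l * moment l 2)) / (q0 * moment l 0) - 0) (at_right 0)"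
    by (intro tendsto_diff)
  also have "(q0 * (moment l 4 + l * moment l 2)) / (q0 * moment l 0) - 0 = \<Phi> l"
    using q0 by (simp add: \<Phi>_eq_moments[OF l])
  finally show ?thesis
    using assms(1) by (simp add: filterlim_cong)
qed

end

section \<open>Convexity above the critical angular momentum\<close>

text \<open>Each positive power of \<open>x\<close> is paired with a negative one so that the sum is
  minimal at \<open>x = c\<close>. The differences are a square over a power of \<open>x\<close>, or
  contain \<open>(x - c)\<^sup>2\<close> times a positive factor.\<close>

lemma critical_tangent_bounds:
  fixes x c :: real
  assumes "x > 0" "c > 0"
  shows "x ^ 4 + c ^ 8 / x ^ 4 \<ge> 2 * c ^ 4"
    and "x ^ 3 + 3 * c ^ 4 / x \<ge> 4 * c ^ 3"
    and "x\<^sup>2 + c ^ 4 / x\<^sup>2 \<ge> 2 * c\<^sup>2"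
    and "3 * c ^ 4 * x + c ^ 8 / x ^ 3 \<ge> 4 * c ^ 5"
proof -
  have x: "x \<noteq> 0" using assms by simp
  have square: "a + b\<^sup>2 / a - 2 * b = (a - b)\<^sup>2 / a" if "a \<noteq> 0" for a b :: real
    using that by (simp add: field_simps power2_eq_square)
  have "x ^ 4 + c ^ 8 / x ^ 4 - 2 * c ^ 4 = (x ^ 4 - c ^ 4)\<^sup>2 / x ^ 4"
    using square[of "x ^ 4" "c ^ 4"] x by (simp flip: power_mult)
  also have "\<dots> \<ge> 0" by simp
  finally show "x ^ 4 + c ^ 8 / x ^ 4 \<ge> 2 * c ^ 4" by simp
  have "x ^ 3 + 3 * c ^ 4 / x - 4 * c ^ 3 = (x - c)\<^sup>2 * (x\<^sup>2 + 2 * x * c + 3 * c\<^sup>2) / x"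
    using x by (simp add: field_simps eval_nat_numeral)
  also have "\<dots> \<ge> 0" using assms by simp
  finally show "x ^ 3 + 3 * c ^ 4 / x \<ge> 4 * c ^ 3" by simp
  have "x\<^sup>2 + c ^ 4 / x\<^sup>2 - 2 * c\<^sup>2 = (x\<^sup>2 - c\<^sup>2)\<^sup>2 / x\<^sup>2"
    using square[of "x\<^sup>2" "c\<^sup>2"] x by (simp flip: power_mult)
  also have "\<dots> \<ge> 0" by simp
  finally show "x\<^sup>2 + c ^ 4 / x\<^sup>2 \<ge> 2 * c\<^sup>2" by simp
  have "3 * c ^ 4 * x + c ^ 8 / x ^ 3 - 4 * c ^ 5 = c ^ 4 * ((x - c)\<^sup>2 * (3 * x\<^sup>2 + 2 * x * c + c\<^sup>2)) / x ^ 3"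
    using x by (simp add: field_simps eval_nat_numeral)
  also have "\<dots> \<ge> 0" using assms by simp
  finally show "3 * c ^ 4 * x + c ^ 8 / x ^ 3 \<ge> 4 * c ^ 5" by simp
qed

text \<open>Up to the factor \<open>64 * (mu0 x j)\<^sup>2\<close> this is the numerator of
  \<open>mu2\<close>. Expanded in \<open>4 * j\<^sup>2\<close>, both higher coefficients are
  positive, which gives monotonicity in \<open>j\<close>.\<close>

lemma convexity_discriminant:
  assumes "x > 0"
  shows "2 * R_K x j * R2 x j - (R1 x j)\<^sup>2 = 3 * x ^ 4 + 8 * x ^ 3 + 6 * x\<^sup>2 - 1
    + 4 * j\<^sup>2 * (12 * x + 30 + 24 / x + 6 / x\<^sup>2) + (4 * j\<^sup>2)\<^sup>2 * (4 / x ^ 3 + 3 / x ^ 4)"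
proof -
  define J where "J = 4 * j\<^sup>2"
  have "2 * (x ^ 3 + 2 * x\<^sup>2 + x + J + J / x) * (6 * x + 4 + 2 * J / x ^ 3) - (3 * x\<^sup>2 + 4 * x + 1 - J / x\<^sup>2)\<^sup>2
      = 3 * x ^ 4 + 8 * x ^ 3 + 6 * x\<^sup>2 - 1
        + J * (12 * x + 30 + 24 / x + 6 / x\<^sup>2) + J\<^sup>2 * (4 / x ^ 3 + 3 / x ^ 4)"
    using assms by (simp add: field_simps eval_nat_numeral)
  then show ?thesis
    by (simp add: R_K_def R1_def R2_def J_def)
qed

text \<open>At \<open>j = j\<^sub>c\<close> the discriminant is minimal at \<open>x = chi\<^sub>c\<close>, where it vanishes, and it increases with \<open>j\<close>.\<close>

lemma mu2_nonneg:
  assumes "x > 0" "j \<ge> j\<^sub>c"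
  shows "mu2 x j \<ge> 0"
proof -
  let ?c = chi\<^sub>c
  define J where "J = 4 * j\<^sup>2"
  have "4 * j\<^sub>c\<^sup>2 = ?c ^ 4" by (simp add: j\<^sub>c_def power_divide)
  then have J: "?c ^ 4 \<le> J"
    using assms(2) j\<^sub>c_pos power_mono[of j\<^sub>c j 2] unfolding J_def by linarith
  then have JJ: "?c ^ 8 \<le> J\<^sup>2"
    using power_mono[of "?c ^ 4" J 2] by (simp flip: power_mult)
  note T = critical_tangent_bounds[OF assms(1) chi\<^sub>c(1)]
  \<comment> \<open>The chain starts from the discriminant at the critical point, raises it to
    arbitrary \<open>x\<close> by the four tangent bounds with weights 3, 8, 6, 4, and then raises
    \<open>?c ^ 4\<close> to \<open>J\<close>.\<close>
  have "0 = 2 * (8 * ?c ^ 3 + 10 * ?c\<^sup>2 + 2 * ?c - 1) * (?c\<^sup>2 + ?c + 1 / 2)"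
    by (simp add: chi\<^sub>c(2))
  also have "\<dots> = 3 * (2 * ?c ^ 4) + 8 * (4 * ?c ^ 3) + 6 * (2 * ?c\<^sup>2) + 4 * (4 * ?c ^ 5) + 30 * ?c ^ 4 - 1"
    by (simp add: algebra_simps eval_nat_numeral)
  also have "\<dots> \<le> 3 * (x ^ 4 + ?c ^ 8 / x ^ 4) + 8 * (x ^ 3 + 3 * ?c ^ 4 / x) + 6 * (x\<^sup>2 + ?c ^ 4 / x\<^sup>2)
      + 4 * (3 * ?c ^ 4 * x + ?c ^ 8 / x ^ 3) + 30 * ?c ^ 4 - 1"
    using T by (intro add_mono diff_mono mult_left_mono order_refl) auto
  also have "\<dots> = 3 * x ^ 4 + 8 * x ^ 3 + 6 * x\<^sup>2 - 1
      + ?c ^ 4 * (12 * x + 30 + 24 / x + 6 / x\<^sup>2) + ?c ^ 8 * (4 / x ^ 3 + 3 / x ^ 4)"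
    by (simp add: algebra_simps)
  also have "\<dots> \<le> 3 * x ^ 4 + 8 * x ^ 3 + 6 * x\<^sup>2 - 1
      + J * (12 * x + 30 + 24 / x + 6 / x\<^sup>2) + J\<^sup>2 * (4 / x ^ 3 + 3 / x ^ 4)"
    using assms(1) J JJ by (intro add_mono mult_right_mono order_refl) auto
  also have "\<dots> = 2 * R_K x j * R2 x j - (R1 x j)\<^sup>2"
    by (simp add: convexity_discriminant[OF assms(1)] J_def)
  finally have P: "0 \<le> 2 * R_K x j * R2 x j - (R1 x j)\<^sup>2" .
  have R: "R_K x j = 4 * (mu0 x j)\<^sup>2"
    using R_K_pos[OF assms(1), of j] by (simp add: mu0_def power_divide)
  have pos: "mu0 x j > 0" by (rule mu0_pos[OF assms(1)])
  have "R2 x j / 8 - (mu1 x j)\<^sup>2 = (2 * R_K x j * R2 x j - (R1 x j)\<^sup>2) / (64 * (mu0 x j)\<^sup>2)"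
    using pos by (simp add: R mu1_def power_divide field_simps)
  also have "\<dots> \<ge> 0" using P by simp
  finally show ?thesis using pos by (simp add: mu2_def)
qed

lemma mu1_mono:
  assumes "0 < x" "x \<le> y" "j \<ge> j\<^sub>c"
  shows "mu1 x j \<le> mu1 y j"
proof (rule DERIV_nonneg_imp_nondecreasing[OF assms(2)])
  fix z
  assume "x \<le> z"
  then have "z > 0" using assms(1) by simp
  then show "\<exists>d. ((\<lambda>x. mu1 x j) has_real_derivative d) (at z) \<and> d \<ge> 0"
    using DERIV_mu(2)[of z j] mu2_nonneg[OF _ assms(3)] by blast
qed

lemma I_K_convex:
  assumes "\<tau> > 0" "j \<ge> j\<^sub>c"
  shows "convex_on {0<..} (\<lambda>\<sigma>. I_K \<sigma> \<tau> j)"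
proof (rule f''_ge0_imp_convex)
  fix \<sigma> :: real
  assume s: "\<sigma> \<in> {0<..}"
  show "((\<lambda>\<sigma>. I_K \<sigma> \<tau> j) has_real_derivative mu1 (\<sigma> / pi) j / pi / \<tau> - 1) (at \<sigma>)"
    unfolding I_K_def m_K_eq_mu0 using s
    by (intro DERIV_diff DERIV_cdivide DERIV_mu_sigma DERIV_ident) simp
  have "((\<lambda>\<sigma>. mu1 (\<sigma> / pi) j / pi / \<tau> - 1) has_real_derivative mu2 (\<sigma> / pi) j / pi / pi / \<tau> - 0) (at \<sigma>)"
    using s by (intro DERIV_diff DERIV_cdivide DERIV_mu_sigma DERIV_const) simp
  then show "((\<lambda>\<sigma>. mu1 (\<sigma> / pi) j / pi / \<tau> - 1) has_real_derivative mu2 (\<sigma> / pi) j / pi / pi / \<tau>) (at \<sigma>)"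
    by simp
  show "mu2 (\<sigma> / pi) j / pi / pi / \<tau> \<ge> 0"
    using s assms by (intro divide_nonneg_nonneg mu2_nonneg) auto
qed simp

lemma convex_on_rescaled:
  fixes F :: "real \<Rightarrow> real"
  assumes "convex_on {0<..} F" "e > 0" "g > 0" "s \<ge> 0"
  shows "convex_on {(s - y) / e<..} (\<lambda>x. (F (y + e * x) - d) / g)"
proof (rule convex_onI)
  fix t x z :: real
  assume t: "0 < t" "t < 1" and x: "x \<in> {(s - y) / e<..}" and z: "z \<in> {(s - y) / e<..}"
  have "0 < y + e * x" "0 < y + e * z"
    using x z assms by (auto simp: field_simps)
  then have "F ((1 - t) * (y + e * x) + t * (y + e * z)) \<le> (1 - t) * F (y + e * x) + t * F (y + e * z)"
    using convex_onD[OF assms(1), of t "y + e * x" "y + e * z"] t by simp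
  moreover have "(1 - t) * (y + e * x) + t * (y + e * z) = y + e * ((1 - t) * x + t * z)"
    by (simp add: algebra_simps)
  ultimately have "F (y + e * ((1 - t) * x + t * z)) - d \<le> (1 - t) * (F (y + e * x) - d) + t * (F (y + e * z) - d)"
    by (simp add: algebra_simps)
  then have "(F (y + e * ((1 - t) * x + t * z)) - d) / g
      \<le> ((1 - t) * (F (y + e * x) - d) + t * (F (y + e * z) - d)) / g"
    using assms by (intro divide_right_mono) auto
  then show "(F (y + e * ((1 - t) *\<^sub>R x + t *\<^sub>R z)) - d) / g
      \<le> (1 - t) * ((F (y + e * x) - d) / g) + t * ((F (y + e * z) - d) / g)"
    by (simp add: add_divide_distrib)
qed simp

lemma \<sigma>\<^sub>e:
  assumes "j > 0"
  shows "\<sigma>\<^sub>e j > 0" "mu1 (\<sigma>\<^sub>e j / pi) j = 0"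
proof -
  have "\<sigma>\<^sub>e j > 0 \<and> m_\<sigma> (\<sigma>\<^sub>e j) j = 0"
    using theI'[OF \<sigma>\<^sub>e_unique[OF assms]] unfolding \<sigma>\<^sub>e_def .
  then show "\<sigma>\<^sub>e j > 0" "mu1 (\<sigma>\<^sub>e j / pi) j = 0"
    using m_\<sigma>_eq_mu1[of "\<sigma>\<^sub>e j" j] by auto
qed

lemma tendsto_mu1:
  assumes "(X \<longlongrightarrow> x) F" "(Y \<longlongrightarrow> y) F" "x > 0"
  shows "((\<lambda>g. mu1 (X g) (Y g)) \<longlongrightarrow> mu1 x y) F"
proof -
  have "x \<noteq> 0" "sqrt (R_K x y) / 2 \<noteq> 0"
    using assms(3) R_K_pos[of x y] by auto
  then show ?thesis
    unfolding mu1_def mu0_def R1_def R_K_def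
    by (intro tendsto_intros assms) auto
qed

text \<open>Serves to keep the edge of the branch away from the critical point. The cubic forces
  \<open>2 * chi\<^sub>c < 1\<close>, which makes \<open>R1\<close> positive at half the critical
  value.\<close>

lemma mu1_half_pos: "mu1 (chi\<^sub>c / 2) j\<^sub>c > 0"
proof -
  let ?c = chi\<^sub>c
  have c: "?c > 0" by (rule chi\<^sub>c)
  have "8 * ?c ^ 3 > 0" "10 * ?c\<^sup>2 > 0" using c by simp_all
  then have "2 * ?c < 1" using chi\<^sub>c(2) by linarith
  then have "2 * ?c\<^sup>2 < ?c" using c by (simp add: power2_eq_square)
  then have "0 < 3 * ?c\<^sup>2 / 4 + 2 * ?c + 1 - 4 * ?c\<^sup>2"
    using c by linarith
  also have "\<dots> = R1 (?c / 2) j\<^sub>c"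
    using c by (simp add: R1_def j\<^sub>c_def field_simps eval_nat_numeral)
  finally show ?thesis
    unfolding mu1_def using mu0_pos[of "?c / 2" j\<^sub>c] c by simp
qed

text \<open>Gives the polynomial growth of the density needed for domination: the numerator is at
  most quadratic, and \<open>R_K x j \<ge> (2 * j)\<^sup>2\<close> bounds \<open>mu0\<close> below
  by \<open>j\<^sub>c\<close>.\<close>

lemma mu1_le:
  assumes "x > 0" "j \<ge> j\<^sub>c"
  shows "mu1 x j \<le> (5 * x\<^sup>2 + 3) / (8 * j\<^sub>c)"
proof -
  have "4 * x \<le> 2 * x\<^sup>2 + 2"
    using zero_le_power2[of "x - 1"] by (simp add: power2_diff)
  moreover have "0 \<le> 4 * j\<^sup>2 / x\<^sup>2" by simp
  ultimately have R1: "R1 x j \<le> 5 * x\<^sup>2 + 3"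
    unfolding R1_def by linarith
  have j: "j > 0" using j\<^sub>c_pos assms by linarith
  have "(2 * j)\<^sup>2 \<le> R_K x j"
    using assms(1) by (simp add: R_K_def power_mult_distrib)
  then have "2 * j \<le> sqrt (R_K x j)"
    using j by (intro real_le_rsqrt)
  then have mu0: "j\<^sub>c \<le> mu0 x j" using assms by (simp add: mu0_def)
  have "mu1 x j \<le> ((5 * x\<^sup>2 + 3) / 8) / mu0 x j"
    unfolding mu1_def using R1 mu0 j\<^sub>c_pos by (intro divide_right_mono) auto
  also have "\<dots> \<le> ((5 * x\<^sup>2 + 3) / 8) / j\<^sub>c"
    using mu0 j\<^sub>c_pos by (intro divide_left_mono mult_pos_pos) auto
  finally show ?thesis by simp
qed

section \<open>The crossover on the zero-field tangent\<close>

text \<open>The width of the critical fluctuations, fixed by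
  \<open>a4_K * eps g ^ 4 = g\<close>.\<close>

definition eps :: "real \<Rightarrow> real" where
  "eps g = sqrt (sqrt (g / a4_K))"

lemma eps:
  assumes "g > 0"
  shows "eps g > 0" "g = a4_K * eps g ^ 4" "sqrt g = sqrt a4_K * (eps g)\<^sup>2"
proof -
  have ga: "g / a4_K > 0" using assms a4_K_pos by simp
  then show "eps g > 0" by (simp add: eps_def)
  have sq: "(eps g)\<^sup>2 = sqrt (g / a4_K)" using ga by (simp add: eps_def)
  have "eps g ^ 4 = ((eps g)\<^sup>2)\<^sup>2" by (simp flip: power_mult)
  also have "\<dots> = g / a4_K" using ga by (simp add: sq)
  finally show "g = a4_K * eps g ^ 4" using a4_K_pos by simp
  show "sqrt g = sqrt a4_K * (eps g)\<^sup>2"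
    unfolding sq using a4_K_pos by (simp add: real_sqrt_divide)
qed

lemma tendsto_eps: "(eps \<longlongrightarrow> 0) (at_right 0)"
proof -
  have "((\<lambda>g. sqrt (sqrt (g / a4_K))) \<longlongrightarrow> sqrt (sqrt (0 / a4_K))) (at_right 0)"
    using a4_K_pos by (intro tendsto_intros) auto
  then show ?thesis by (simp add: eps_def [abs_def])
qed

text \<open>The increment of \<open>j\<close> that solves
  \<open>u_K h = l * sqrt (a4_K * g)\<close>.\<close>

definition dj :: "real \<Rightarrow> real \<Rightarrow> real" where
  "dj l g = 2 * \<tau>\<^sub>c * l * sqrt a4_K / m_\<sigma>\<sigma>j \<sigma>\<^sub>c j\<^sub>c * sqrt g"

lemma m_\<sigma>j_neg: "m_\<sigma>j \<sigma>\<^sub>c j\<^sub>c < 0"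
  unfolding m_\<sigma>j_c using mu1\<^sub>j_neg by (simp add: divide_neg_pos)

lemma m_\<sigma>\<sigma>j_pos: "m_\<sigma>\<sigma>j \<sigma>\<^sub>c j\<^sub>c > 0"
  unfolding m_\<sigma>\<sigma>j_c using mu2\<^sub>j_pos by simp

lemma u_K_eq_iff: "u_K h = l * sqrt (a4_K * g) \<longleftrightarrow> h = dj l g"
  unfolding u_K_def dj_def using m_\<sigma>\<sigma>j_pos \<tau>\<^sub>c_pos by (auto simp: real_sqrt_mult field_simps)

lemma dj_nonneg: "l \<ge> 0 \<Longrightarrow> g \<ge> 0 \<Longrightarrow> dj l g \<ge> 0"
  unfolding dj_def using m_\<sigma>\<sigma>j_pos \<tau>\<^sub>c_pos a4_K_pos by simp

lemma tendsto_dj: "(dj l \<longlongrightarrow> 0) (at_right 0)"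
proof -
  have "(dj l \<longlongrightarrow> 2 * \<tau>\<^sub>c * l * sqrt a4_K / m_\<sigma>\<sigma>j \<sigma>\<^sub>c j\<^sub>c * sqrt 0) (at_right 0)"
    unfolding dj_def [abs_def] by (intro tendsto_intros)
  then show ?thesis by simp
qed

lemma w_K_tangent: "w_K (m_\<sigma>j \<sigma>\<^sub>c j\<^sub>c * h) h = 0"
  by (simp add: w_K_def)

lemma borel_measurable_I_K: "(\<lambda>x. I_K (f x) \<tau> j) \<in> borel_measurable borel"
  if "f \<in> borel_measurable borel" for f :: "real \<Rightarrow> real"
  unfolding I_K_def m_K_def R_K_def using that by measurable

lemma borel_measurable_mu1: "(\<lambda>x. mu1 (f x) j) \<in> borel_measurable borel"
  if "f \<in> borel_measurable borel" for f :: "real \<Rightarrow> real"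
  unfolding mu1_def mu0_def R1_def R_K_def using that by measurable

lemma filterlim_divide_eps_at_bot:
  assumes "\<forall>\<^sub>F g in at_right 0. n g \<le> - d" "d > 0"
  shows "filterlim (\<lambda>g. n g / eps g) at_bot (at_right 0)"
proof -
  have pos: "\<forall>\<^sub>F g in at_right 0. eps g > 0"
    using eventually_at_right_less[of 0] by eventually_elim (rule eps)
  have "filterlim eps (at_right 0) (at_right 0)"
    using tendsto_eps pos by (simp add: filterlim_at eventually_conj_iff eventually_mono)
  then have "filterlim (\<lambda>g. inverse (eps g)) at_top (at_right 0)"
    by (rule filterlim_compose[OF filterlim_inverse_at_top_right])
  from filterlim_tendsto_pos_mult_at_top[OF tendsto_const assms(2) this]
  have "filterlim (\<lambda>g. - (d * inverse (eps g))) at_bot (at_right 0)"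
    by (rule filterlim_compose[OF filterlim_uminus_at_bot_at_top])
  moreover have "\<forall>\<^sub>F g in at_right 0. n g / eps g \<le> - (d * inverse (eps g))"
    using assms(1) pos
  proof eventually_elim
    case (elim g)
    then have "n g / eps g \<le> - d / eps g" by (intro divide_right_mono) auto
    then show ?case by (simp add: divide_inverse)
  qed
  ultimately show ?thesis by (rule filterlim_at_bot_mono)
qed

section \<open>The rescaled problem along the tangent\<close>

definition \<tau>_tan :: "real \<Rightarrow> real \<Rightarrow> real" where
  "\<tau>_tan l g = \<tau>\<^sub>c + m_\<sigma>j \<sigma>\<^sub>c j\<^sub>c * dj l g"

definition j_tan :: "real \<Rightarrow> real \<Rightarrow> real" where
  "j_tan l g = j\<^sub>c + dj l g"

definition center :: "real \<Rightarrow> real \<Rightarrow> real" where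
  "center l g = \<sigma>\<^sub>c + shift\<^sub>c (dj l g)"

definition rescaled_action :: "real \<Rightarrow> real \<Rightarrow> real \<Rightarrow> real" where
  "rescaled_action l g x =
    (I_K (center l g + eps g * x) (\<tau>_tan l g) (j_tan l g) - I_K (center l g) (\<tau>_tan l g) (j_tan l g)) / g"

definition rescaled_density :: "real \<Rightarrow> real \<Rightarrow> real \<Rightarrow> real" where
  "rescaled_density l g x = mu1 ((center l g + eps g * x) / pi) (j_tan l g) / pi"

definition rescaled_edge :: "real \<Rightarrow> real \<Rightarrow> real" where
  "rescaled_edge l g = (\<sigma>\<^sub>e (j_tan l g) - center l g) / eps g"

text \<open>Comes from \<open>mu1_le\<close> at an argument of size at most
  \<open>(\<sigma>\<^sub>c + 1) + \<bar>x\<bar>\<close>, whose square is at most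
  \<open>2 * (\<sigma>\<^sub>c + 1)\<^sup>2 + 2 * x\<^sup>2\<close>.\<close>

definition density_bound :: real where
  "density_bound = (10 * (\<sigma>\<^sub>c + 1)\<^sup>2 + 13) / (8 * j\<^sub>c * pi)"

lemma eventually_pos_at_right: "\<forall>\<^sub>F g in at_right 0. 0 < (g :: real)"
  by (rule eventually_at_right_less)

lemma tangent_limits:
  "(\<tau>_tan l \<longlongrightarrow> \<tau>\<^sub>c) (at_right 0)" "(j_tan l \<longlongrightarrow> j\<^sub>c) (at_right 0)" "(center l \<longlongrightarrow> \<sigma>\<^sub>c) (at_right 0)"
  unfolding \<tau>_tan_def [abs_def] j_tan_def [abs_def] center_def [abs_def] shift\<^sub>c_def
  by (rule tendsto_eq_intros tendsto_dj refl | simp)+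

context
  fixes l :: real
  assumes l: "l \<ge> 0"
begin

lemma \<tau>_pos: "\<forall>\<^sub>F g in at_right 0. \<tau>_tan l g > 0"
  using order_tendstoD(1)[OF tangent_limits(1) \<tau>\<^sub>c_pos] .

lemma j_ge: "\<forall>\<^sub>F g in at_right 0. j_tan l g \<ge> j\<^sub>c"
  using eventually_pos_at_right by eventually_elim (use dj_nonneg[OF l] in \<open>simp add: j_tan_def\<close>)

text \<open>An edge at or beyond \<open>\<sigma>\<^sub>c / 2\<close> would, by monotonicity of
  \<open>mu1\<close>, force \<open>mu1\<close> to be nonpositive at \<open>chi\<^sub>c / 2\<close>,
  against its positive limit.\<close>

lemma edge_less: "\<forall>\<^sub>F g in at_right 0. \<sigma>\<^sub>e (j_tan l g) < \<sigma>\<^sub>c / 2"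
proof -
  have "((\<lambda>g. mu1 (chi\<^sub>c / 2) (j_tan l g)) \<longlongrightarrow> mu1 (chi\<^sub>c / 2) j\<^sub>c) (at_right 0)"
    using chi\<^sub>c(1) by (intro tendsto_mu1 tendsto_const tangent_limits(2)) simp
  from order_tendstoD(1)[OF this mu1_half_pos] j_ge show ?thesis
  proof eventually_elim
    case (elim g)
    show ?case
    proof (rule ccontr)
      assume "\<not> ?thesis"
      then have "chi\<^sub>c / 2 \<le> \<sigma>\<^sub>e (j_tan l g) / pi" by (simp add: \<sigma>\<^sub>c_def field_simps)
      then have "mu1 (chi\<^sub>c / 2) (j_tan l g) \<le> mu1 (\<sigma>\<^sub>e (j_tan l g) / pi) (j_tan l g)"
        using chi\<^sub>c(1) elim by (intro mu1_mono) auto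
      then show False using elim \<sigma>\<^sub>e(2)[of "j_tan l g"] j\<^sub>c_pos by auto
    qed
  qed
qed

lemma domain:
  "0 < center l g + eps g * x \<and> \<sigma>\<^sub>e (j_tan l g) < center l g + eps g * x \<and> 0 < \<sigma>\<^sub>e (j_tan l g)"
  if "g > 0" "j_tan l g \<ge> j\<^sub>c" "rescaled_edge l g < x" for g x
proof -
  have "\<sigma>\<^sub>e (j_tan l g) < center l g + eps g * x"
    using that(3) eps(1)[OF that(1)] by (simp add: rescaled_edge_def field_simps)
  then show ?thesis using \<sigma>\<^sub>e(1)[of "j_tan l g"] that j\<^sub>c_pos by simp
qed

lemma rescaled_action_convex: "\<forall>\<^sub>F g in at_right 0. convex_on {rescaled_edge l g<..} (rescaled_action l g)"
  using eventually_pos_at_right \<tau>_pos j_ge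
proof eventually_elim
  case (elim g)
  show ?case
    unfolding rescaled_edge_def rescaled_action_def using elim eps(1) \<sigma>\<^sub>e(1)[of "j_tan l g"] j\<^sub>c_pos
    by (intro convex_on_rescaled I_K_convex) auto
qed

lemma rescaled_edge_lim: "filterlim (rescaled_edge l) at_bot (at_right 0)"
proof -
  \<comment> \<open>The centre stays above 3/4 and the edge below 1/2 of
    \<open>\<sigma>\<^sub>c\<close>; division of this fixed gap by \<open>eps g\<close> sends the
    edge to minus infinity.\<close>
  have "\<forall>\<^sub>F g in at_right 0. 3 / 4 * \<sigma>\<^sub>c < center l g"
    by (rule order_tendstoD(1)[OF tangent_limits(3)]) (use \<sigma>\<^sub>c_pos in simp)
  then have "\<forall>\<^sub>F g in at_right 0. \<sigma>\<^sub>e (j_tan l g) - center l g \<le> - (\<sigma>\<^sub>c / 4)"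
    using edge_less by eventually_elim simp
  then show ?thesis
    unfolding rescaled_edge_def [abs_def] by (rule filterlim_divide_eps_at_bot) (simp add: \<sigma>\<^sub>c_pos)
qed

lemma rescaled_density_lim: "((\<lambda>g. rescaled_density l g x) \<longlongrightarrow> \<tau>\<^sub>c) (at_right 0)"
proof -
  have "((\<lambda>g. (center l g + eps g * x) / pi) \<longlongrightarrow> (\<sigma>\<^sub>c + 0 * x) / pi) (at_right 0)"
    by (intro tendsto_intros tangent_limits(3) tendsto_eps) simp
  also have "(\<sigma>\<^sub>c + 0 * x) / pi = chi\<^sub>c" by (simp add: \<sigma>\<^sub>c_def)
  finally have "((\<lambda>g. rescaled_density l g x) \<longlongrightarrow> mu1 chi\<^sub>c j\<^sub>c / pi) (at_right 0)"
    unfolding rescaled_density_def by (intro tendsto_intros tendsto_mu1 tangent_limits(2) chi\<^sub>c(1)) simp_all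
  then show ?thesis by (simp add: \<tau>\<^sub>c_eq t\<^sub>c_def)
qed

lemma rescaled_density_bounds:
  "\<forall>\<^sub>F g in at_right 0. \<forall>x>rescaled_edge l g. 0 \<le> rescaled_density l g x \<and> rescaled_density l g x \<le> density_bound * (1 + x\<^sup>2)"
proof -
  have "\<forall>\<^sub>F g in at_right 0. eps g < 1" "\<forall>\<^sub>F g in at_right 0. center l g < \<sigma>\<^sub>c + 1"
    using order_tendstoD(2)[OF tendsto_eps, of 1] order_tendstoD(2)[OF tangent_limits(3), of "\<sigma>\<^sub>c + 1"] by simp_all
  then show ?thesis
    using eventually_pos_at_right j_ge
  proof eventually_elim
    case (elim g)
    show ?case
    proof (intro allI impI conjI)
      fix x assume "rescaled_edge l g < x"
      note d = domain[OF elim(3,4) this]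
      define s where "s = (center l g + eps g * x) / pi"
      have "j_tan l g > 0" using elim j\<^sub>c_pos by simp
      have "\<sigma>\<^sub>e (j_tan l g) / pi \<le> s" using d by (simp add: s_def divide_right_mono)
      then have "mu1 (\<sigma>\<^sub>e (j_tan l g) / pi) (j_tan l g) \<le> mu1 s (j_tan l g)"
        using elim d by (intro mu1_mono) auto
      then show "0 \<le> rescaled_density l g x"
        using \<sigma>\<^sub>e(2)[OF \<open>j_tan l g > 0\<close>] by (simp add: rescaled_density_def s_def)
      have s: "s > 0" using d by (simp add: s_def)
      have "s \<le> center l g + eps g * x"
        using d pi_gt3 mult_left_mono[of 1 pi "center l g + eps g * x"] by (simp add: s_def pos_divide_le_eq)
      also have "\<dots> \<le> (\<sigma>\<^sub>c + 1) + \<bar>x\<bar>"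
      proof -
        have "eps g * x \<le> \<bar>eps g * x\<bar>" by simp
        also have "\<dots> \<le> 1 * \<bar>x\<bar>"
          unfolding abs_mult using elim eps(1)[OF elim(3)] by (intro mult_right_mono) auto
        finally show ?thesis using elim by simp
      qed
      finally have "s\<^sup>2 \<le> ((\<sigma>\<^sub>c + 1) + \<bar>x\<bar>)\<^sup>2" using s by (intro power_mono) auto
      also have "\<dots> \<le> 2 * (\<sigma>\<^sub>c + 1)\<^sup>2 + 2 * x\<^sup>2"
        using zero_le_power2[of "(\<sigma>\<^sub>c + 1) - \<bar>x\<bar>"] by (simp add: power2_sum power2_diff)
      finally have "5 * s\<^sup>2 + 3 \<le> 10 * (\<sigma>\<^sub>c + 1)\<^sup>2 + 10 * x\<^sup>2 + 3" by simp
      also have "\<dots> \<le> (10 * (\<sigma>\<^sub>c + 1)\<^sup>2 + 13) * (1 + x\<^sup>2)"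
        by (simp add: distrib_left distrib_right)
      finally have "(5 * s\<^sup>2 + 3) / (8 * j\<^sub>c) \<le> (10 * (\<sigma>\<^sub>c + 1)\<^sup>2 + 13) * (1 + x\<^sup>2) / (8 * j\<^sub>c)"
        using j\<^sub>c_pos by (intro divide_right_mono) auto
      with mu1_le[OF s elim(4)]
      have "mu1 s (j_tan l g) / pi \<le> (10 * (\<sigma>\<^sub>c + 1)\<^sup>2 + 13) * (1 + x\<^sup>2) / (8 * j\<^sub>c) / pi"
        by (intro divide_right_mono) auto
      then show "rescaled_density l g x \<le> density_bound * (1 + x\<^sup>2)"
        by (simp add: rescaled_density_def s_def density_bound_def)
    qed
  qed
qed

lemma rescaled_action_lim: "((\<lambda>g. rescaled_action l g x) \<longlongrightarrow> quartic l x) (at_right 0)"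
proof -
  obtain C d where C: "C > 0" "d > 0"
    "\<And>y a h. \<bar>y\<bar> < d \<Longrightarrow> \<bar>a\<bar> < d \<Longrightarrow> \<bar>h\<bar> < d \<Longrightarrow>
      \<bar>I_K (\<sigma>\<^sub>c + shift\<^sub>c h + y) (\<tau>\<^sub>c + a) (j\<^sub>c + h)
        - (I_K (\<sigma>\<^sub>c + shift\<^sub>c h) (\<tau>\<^sub>c + a) (j\<^sub>c + h) - w_K a h * y + u_K h * y\<^sup>2 + a4_K * y ^ 4)\<bar>
      \<le> C * (\<bar>y\<bar> ^ 5 + (\<bar>a\<bar> + \<bar>h\<bar>) * \<bar>y\<bar> ^ 3 + (\<bar>a\<bar> + \<bar>h\<bar>)\<^sup>2 * \<bar>y\<bar>)"
    using I_K_expansion by blast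
  let ?b = "m_\<sigma>j \<sigma>\<^sub>c j\<^sub>c"
  \<comment> \<open>\<open>N * (eps g)\<^sup>2\<close> is the total size of both controls on the
    tangent. Every error monomial then carries \<open>eps g ^ 5\<close>, and division by
    \<open>g = a4_K * eps g ^ 4\<close> leaves \<open>B * eps g\<close>.\<close>
  define N where "N = (\<bar>?b\<bar> + 1) * (2 * \<tau>\<^sub>c * l * sqrt a4_K / m_\<sigma>\<sigma>j \<sigma>\<^sub>c j\<^sub>c * sqrt a4_K)"
  define B where "B = C * (\<bar>x\<bar> ^ 5 + N * \<bar>x\<bar> ^ 3 + N\<^sup>2 * \<bar>x\<bar>) / a4_K"
  have "((\<lambda>g. eps g * x) \<longlongrightarrow> 0 * x) (at_right 0)" "((\<lambda>g. ?b * dj l g) \<longlongrightarrow> ?b * 0) (at_right 0)"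
    by (intro tendsto_intros tendsto_eps tendsto_dj)+
  then have "\<forall>\<^sub>F g in at_right 0. \<bar>eps g * x\<bar> < d" "\<forall>\<^sub>F g in at_right 0. \<bar>?b * dj l g\<bar> < d"
    "\<forall>\<^sub>F g in at_right 0. \<bar>dj l g\<bar> < d"
    using tendstoD[OF _ C(2)] tendsto_dj[of l] by (fastforce simp: dist_real_def)+
  then have "\<forall>\<^sub>F g in at_right 0. norm (rescaled_action l g x - quartic l x) \<le> B * eps g"
    using eventually_pos_at_right
  proof eventually_elim
    case (elim g)
    note e = eps[OF elim(4)]
    let ?e = "eps g" and ?h = "dj l g"
    have D: "\<bar>?b * ?h\<bar> + \<bar>?h\<bar> = N * ?e\<^sup>2"
    proof -
      have "\<bar>?h\<bar> = ?h" using dj_nonneg[OF l, of g] elim by simp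
      then have "\<bar>?b * ?h\<bar> + \<bar>?h\<bar> = (\<bar>?b\<bar> + 1) * ?h" by (simp add: abs_mult distrib_right)
      then show ?thesis unfolding N_def dj_def e(3) by simp
    qed
    have u: "u_K ?h = l * (a4_K * ?e\<^sup>2)"
    proof -
      have "u_K ?h = l * sqrt (a4_K * g)" unfolding u_K_eq_iff ..
      also have "sqrt (a4_K * g) = (sqrt a4_K * sqrt a4_K) * ?e\<^sup>2"
        by (simp only: real_sqrt_mult e(3) mult.assoc)
      finally show ?thesis using a4_K_pos by simp
    qed
    have "rescaled_action l g x - quartic l x = (I_K (\<sigma>\<^sub>c + shift\<^sub>c ?h + ?e * x) (\<tau>\<^sub>c + ?b * ?h) (j\<^sub>c + ?h)
        - (I_K (\<sigma>\<^sub>c + shift\<^sub>c ?h) (\<tau>\<^sub>c + ?b * ?h) (j\<^sub>c + ?h) - w_K (?b * ?h) ?h * (?e * x)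
          + u_K ?h * (?e * x)\<^sup>2 + a4_K * (?e * x) ^ 4)) / g"
    proof -
      have "u_K ?h * (?e * x)\<^sup>2 + a4_K * (?e * x) ^ 4 = quartic l x * g"
        unfolding u by (subst e(2)) (simp add: algebra_simps power_mult_distrib eval_nat_numeral)
      moreover have "rescaled_action l g x - quartic l x
          = (I_K (\<sigma>\<^sub>c + shift\<^sub>c ?h + ?e * x) (\<tau>\<^sub>c + ?b * ?h) (j\<^sub>c + ?h)
            - I_K (\<sigma>\<^sub>c + shift\<^sub>c ?h) (\<tau>\<^sub>c + ?b * ?h) (j\<^sub>c + ?h) - quartic l x * g) / g"
        using elim(4) by (simp add: rescaled_action_def center_def \<tau>_tan_def j_tan_def diff_divide_distrib)
      ultimately show ?thesis
        by (simp only: w_K_tangent mult_zero_left diff_zero diff_diff_eq add.assoc)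
    qed
    then have "norm (rescaled_action l g x - quartic l x) \<le> C * (\<bar>?e * x\<bar> ^ 5 + (N * ?e\<^sup>2) * \<bar>?e * x\<bar> ^ 3
        + (N * ?e\<^sup>2)\<^sup>2 * \<bar>?e * x\<bar>) / g"
      using C(3)[OF elim(1-3)] elim(4) unfolding D by (simp add: divide_right_mono)
    also have "\<dots> = B * ?e"
    proof -
      have "C * ((e * z) ^ 5 + (N * e\<^sup>2) * (e * z) ^ 3 + (N * e\<^sup>2)\<^sup>2 * (e * z))
          = C * (z ^ 5 + N * z ^ 3 + N\<^sup>2 * z) * e * e ^ 4" for e z
        by (simp add: algebra_simps eval_nat_numeral)
      moreover have "\<bar>?e * x\<bar> = ?e * \<bar>x\<bar>" using e(1) by (simp add: abs_mult)
      ultimately have "C * (\<bar>?e * x\<bar> ^ 5 + (N * ?e\<^sup>2) * \<bar>?e * x\<bar> ^ 3 + (N * ?e\<^sup>2)\<^sup>2 * \<bar>?e * x\<bar>)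
          = C * (\<bar>x\<bar> ^ 5 + N * \<bar>x\<bar> ^ 3 + N\<^sup>2 * \<bar>x\<bar>) * ?e * ?e ^ 4"
        by (simp only:)
      moreover have "?e ^ 4 / g = 1 / a4_K"
      proof -
        have "1 / a4_K = ?e ^ 4 / (a4_K * ?e ^ 4)" using e(1) by simp
        also have "a4_K * ?e ^ 4 = g" by (rule e(2)[symmetric])
        finally show ?thesis by simp
      qed
      ultimately show ?thesis
        unfolding B_def by (simp only: times_divide_eq_right[symmetric]) simp
    qed
    finally show ?case .
  qed
  moreover have "((\<lambda>g. B * eps g) \<longlongrightarrow> 0) (at_right 0)"
    using tendsto_mult[OF tendsto_const tendsto_eps, of B] by simp
  ultimately have "((\<lambda>g. rescaled_action l g x - quartic l x) \<longlongrightarrow> 0) (at_right 0)"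
    by (rule Lim_null_comparison)
  then show ?thesis by (simp only: LIM_zero_iff)
qed

lemma quartic_limit_rescaled: "quartic_limit (rescaled_action l) (rescaled_density l) (rescaled_edge l) l \<tau>\<^sub>c density_bound"
proof
  show "rescaled_action l g \<in> borel_measurable borel" for g
    unfolding rescaled_action_def [abs_def]
    by (intro borel_measurable_divide borel_measurable_diff borel_measurable_I_K) simp_all
  show "rescaled_density l g \<in> borel_measurable borel" for g
    unfolding rescaled_density_def [abs_def]
    by (intro borel_measurable_divide borel_measurable_mu1) simp_all
  show "rescaled_action l g 0 = 0" for g
    by (simp add: rescaled_action_def)
qed (fact l \<tau>\<^sub>c_pos rescaled_action_convex rescaled_edge_lim rescaled_action_lim rescaled_density_lim
    rescaled_density_bounds)+

interpretation quartic_limit "rescaled_action l" "rescaled_density l" "rescaled_edge l" l \<tau>\<^sub>c density_bound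
  by (rule quartic_limit_rescaled)

text \<open>The additive constant removed from the rescaled action. It is common to the average and
  the minimum and so drops out of their difference.\<close>

definition offset :: "real \<Rightarrow> real" where
  "offset g = I_K (center l g) (\<tau>_tan l g) (j_tan l g) / g"

lemma gen_eq:
  assumes "L > 0" "g > 0" "\<tau>_tan l g > 0"
  shows F_eq: "F_gen L g (\<tau>_tan l g) (j_tan l g) (center l g + eps g * x) = T_E L (\<tau>_tan l g) * (rescaled_action l g x + offset g)"
    and I_eq: "I_E L g (\<tau>_tan l g) (j_tan l g) (center l g + eps g * x) = rescaled_action l g x + offset g"
proof -
  show I: "I_E L g (\<tau>_tan l g) (j_tan l g) (center l g + eps g * x) = rescaled_action l g x + offset g"
    using I_E_eq_I_K[OF assms] by (simp add: rescaled_action_def offset_def diff_divide_distrib)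
  have "T_E L (\<tau>_tan l g) \<noteq> 0" using assms by (simp add: T_E_def)
  then show "F_gen L g (\<tau>_tan l g) (j_tan l g) (center l g + eps g * x) = T_E L (\<tau>_tan l g) * (rescaled_action l g x + offset g)"
    using I by (simp add: I_E_def field_simps)
qed

lemma integral_rescale:
  "(LBINT \<sigma>:{\<sigma>\<^sub>e (j_tan l g)<..}. h \<sigma>) = eps g * (LBINT x. indicator {rescaled_edge l g<..} x * h (center l g + eps g * x))"
  if "g > 0"
proof -
  have e: "eps g > 0" by (rule eps[OF that])
  have ind: "indicator {\<sigma>\<^sub>e (j_tan l g)<..} (center l g + eps g * x) = (indicator {rescaled_edge l g<..} x :: real)" for x
    using e by (auto simp: indicator_def rescaled_edge_def field_simps)
  have "(LBINT \<sigma>:{\<sigma>\<^sub>e (j_tan l g)<..}. h \<sigma>) = (LBINT \<sigma>. indicator {\<sigma>\<^sub>e (j_tan l g)<..} \<sigma> * h \<sigma>)"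
    by (simp add: set_lebesgue_integral_def)
  also have "\<dots> = eps g * (LBINT x. indicator {\<sigma>\<^sub>e (j_tan l g)<..} (center l g + eps g * x) * h (center l g + eps g * x))"
    using lborel_integral_real_affine[of "eps g" "\<lambda>\<sigma>. indicator {\<sigma>\<^sub>e (j_tan l g)<..} \<sigma> * h \<sigma>" "center l g"] e by simp
  finally show ?thesis
    unfolding ind .
qed

lemma weight_integral_pos: "\<forall>\<^sub>F g in at_right 0. (LBINT x. weight g x) > 0"
  using order_tendstoD(1)[OF integral_weight(1)] \<tau>\<^sub>c_pos moment_0_pos[OF l] by simp

text \<open>The Jacobian \<open>eps g\<close> and the factor \<open>exp (- offset g)\<close> cancel
  in the quotient; positivity of the weight integral excludes a division by zero.\<close>

lemma F_avg_rescaled: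
  assumes L: "L > 0"
  shows "\<forall>\<^sub>F g in at_right 0. F_avg L g (\<tau>_tan l g) (j_tan l g)
    = T_E L (\<tau>_tan l g) * ((LBINT x. rescaled_action l g x * weight g x) / (LBINT x. weight g x) + offset g)"
  using eventually_pos_at_right \<tau>_pos j_ge weight_integral_pos integral_weight(2) integral_f_weight(2)
proof eventually_elim
  case (elim g)
  let ?T = "T_E L (\<tau>_tan l g)" and ?E = "exp (- offset g)"
  let ?W = "LBINT x. weight g x" and ?FW = "LBINT x. rescaled_action l g x * weight g x"
  have w: "indicator {rescaled_edge l g<..} x * (m_\<sigma> (center l g + eps g * x) (j_tan l g) * exp (- I_E L g (\<tau>_tan l g) (j_tan l g) (center l g + eps g * x)))
      = ?E * weight g x" for x
  proof (cases "rescaled_edge l g < x")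
    case True
    then have "m_\<sigma> (center l g + eps g * x) (j_tan l g) = rescaled_density l g x"
      using domain[OF elim(1,3) True] by (simp add: m_\<sigma>_eq_mu1 rescaled_density_def)
    then show ?thesis
      unfolding I_eq[OF L elim(1,2)] weight_def by (simp add: exp_diff exp_minus field_simps)
  qed (simp add: weight_def)
  have den: "(LBINT \<sigma>:{\<sigma>\<^sub>e (j_tan l g)<..}. m_\<sigma> \<sigma> (j_tan l g) * exp (- I_E L g (\<tau>_tan l g) (j_tan l g) \<sigma>)) = eps g * (?E * ?W)"
    unfolding integral_rescale[OF elim(1)] w by simp
  have "(LBINT \<sigma>:{\<sigma>\<^sub>e (j_tan l g)<..}. F_gen L g (\<tau>_tan l g) (j_tan l g) \<sigma> * m_\<sigma> \<sigma> (j_tan l g) * exp (- I_E L g (\<tau>_tan l g) (j_tan l g) \<sigma>))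
      = eps g * (LBINT x. ?T * (rescaled_action l g x + offset g) * (?E * weight g x))"
    unfolding integral_rescale[OF elim(1)] w[symmetric] F_eq[OF L elim(1,2)] by (simp only: mult_ac)
  also have "(\<lambda>x. ?T * (rescaled_action l g x + offset g) * (?E * weight g x)) = (\<lambda>x. ?T * ?E * (rescaled_action l g x * weight g x + offset g * weight g x))"
    by (simp add: fun_eq_iff algebra_simps)
  also have "(LBINT x. ?T * ?E * (rescaled_action l g x * weight g x + offset g * weight g x)) = ?T * ?E * (?FW + offset g * ?W)"
    using elim(5,6) by simp
  finally have num: "(LBINT \<sigma>:{\<sigma>\<^sub>e (j_tan l g)<..}. F_gen L g (\<tau>_tan l g) (j_tan l g) \<sigma> * m_\<sigma> \<sigma> (j_tan l g) * exp (- I_E L g (\<tau>_tan l g) (j_tan l g) \<sigma>))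
      = eps g * (?T * ?E * (?FW + offset g * ?W))" .
  show ?case
    unfolding F_avg_def num den using elim(4) eps(1)[OF elim(1)] by (simp add: field_simps)
qed

text \<open>\<open>arg_min_on\<close> is a choice, so it is a minimiser only once one is known to
  exist; \<open>minimum_exists\<close> supplies it, and \<open>T_E > 0\<close> makes the order of
  \<open>F_gen\<close> that of the action.\<close>

lemma F_cl_rescaled:
  assumes L: "L > 0"
  shows "\<forall>\<^sub>F g in at_right 0. \<exists>x0>rescaled_edge l g. F_cl L g (\<tau>_tan l g) (j_tan l g) = T_E L (\<tau>_tan l g) * (rescaled_action l g x0 + offset g)
    \<and> (\<forall>x>rescaled_edge l g. rescaled_action l g x0 \<le> rescaled_action l g x)"
  using eventually_pos_at_right \<tau>_pos minimum_exists
proof eventually_elim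
  case (elim g)
  let ?F = "F_gen L g (\<tau>_tan l g) (j_tan l g)"
  note e = eps(1)[OF elim(1)]
  have T: "T_E L (\<tau>_tan l g) > 0" using L elim by (simp add: T_E_def)
  have x_of: "\<exists>x>rescaled_edge l g. \<sigma> = center l g + eps g * x" if "\<sigma> \<in> {\<sigma>\<^sub>e (j_tan l g)<..}" for \<sigma>
    using that e by (intro exI[of _ "(\<sigma> - center l g) / eps g"]) (simp add: rescaled_edge_def divide_strict_right_mono)
  have mem: "center l g + eps g * x \<in> {\<sigma>\<^sub>e (j_tan l g)<..} \<longleftrightarrow> rescaled_edge l g < x" for x
    using e by (simp add: rescaled_edge_def field_simps)
  have le: "?F (center l g + eps g * x) < ?F (center l g + eps g * z) \<longleftrightarrow> rescaled_action l g x < rescaled_action l g z" for x z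
    unfolding F_eq[OF L elim(1,2)] using T by simp
  obtain x1 where x1: "rescaled_edge l g < x1" "\<forall>x>rescaled_edge l g. rescaled_action l g x1 \<le> rescaled_action l g x" using elim(3) by blast
  define s where "s = arg_min_on ?F {\<sigma>\<^sub>e (j_tan l g)<..}"
  have "s \<in> {\<sigma>\<^sub>e (j_tan l g)<..} \<and> (\<forall>\<sigma>\<in>{\<sigma>\<^sub>e (j_tan l g)<..}. \<not> ?F \<sigma> < ?F s)"
    unfolding s_def arg_min_on_def
  proof (rule arg_minI)
    show "center l g + eps g * x1 \<in> {\<sigma>\<^sub>e (j_tan l g)<..}" using x1 by (simp only: mem)
    show "\<not> ?F \<sigma> < ?F (center l g + eps g * x1)" if "\<sigma> \<in> {\<sigma>\<^sub>e (j_tan l g)<..}" for \<sigma>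
      using x_of[OF that] x1(2) le by (metis not_less)
  qed auto
  moreover from this obtain x0 where x0: "rescaled_edge l g < x0" "s = center l g + eps g * x0" using x_of by blast
  ultimately have "\<forall>x>rescaled_edge l g. rescaled_action l g x0 \<le> rescaled_action l g x"
    using mem le by (metis not_less)
  then show ?case
    using x0 unfolding F_cl_def s_def[symmetric] by (auto simp: F_eq[OF L elim(1,2)])
qed

lemma crossover_limit:
  assumes L: "L > 0"
  shows "((\<lambda>g. (F_avg L g (\<tau>_tan l g) (j_tan l g) - F_cl L g (\<tau>_tan l g) (j_tan l g)) / T_E L (\<tau>_tan l g)) \<longlongrightarrow> \<Phi> l) (at_right 0)"
proof -
  have T_pos: "\<forall>\<^sub>F g in at_right 0. T_E L (\<tau>_tan l g) > 0"
    using \<tau>_pos by eventually_elim (use L in \<open>simp add: T_E_def\<close>)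
  show ?thesis
  proof (rule average_minus_minimum[where m = "\<lambda>g. F_cl L g (\<tau>_tan l g) (j_tan l g) / T_E L (\<tau>_tan l g) - offset g"])
    show "\<forall>\<^sub>F g in at_right 0. (F_avg L g (\<tau>_tan l g) (j_tan l g) - F_cl L g (\<tau>_tan l g) (j_tan l g)) / T_E L (\<tau>_tan l g)
        = (LBINT x. rescaled_action l g x * weight g x) / (LBINT x. weight g x) - (F_cl L g (\<tau>_tan l g) (j_tan l g) / T_E L (\<tau>_tan l g) - offset g)"
      using F_avg_rescaled[OF L] T_pos by eventually_elim (simp add: diff_divide_distrib)
    show "\<forall>\<^sub>F g in at_right 0. \<exists>x0>rescaled_edge l g. F_cl L g (\<tau>_tan l g) (j_tan l g) / T_E L (\<tau>_tan l g) - offset g = rescaled_action l g x0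
        \<and> (\<forall>x>rescaled_edge l g. rescaled_action l g x0 \<le> rescaled_action l g x)"
      using F_cl_rescaled[OF L] T_pos
    proof eventually_elim
      case (elim g)
      then obtain x0 where "rescaled_edge l g < x0" "F_cl L g (\<tau>_tan l g) (j_tan l g) = T_E L (\<tau>_tan l g) * (rescaled_action l g x0 + offset g)"
        "\<forall>x>rescaled_edge l g. rescaled_action l g x0 \<le> rescaled_action l g x" by blast
      then show ?case using elim(2) by (intro exI[of _ x0]) simp
    qed
  qed
qed

end

section \<open>Order statements and assembly of the theorem\<close>

lemma I_K_expansion_bigo:
  "(\<lambda>(y, a, h). I_K (\<sigma>\<^sub>c + y + shift\<^sub>c h) (\<tau>\<^sub>c + a) (j\<^sub>c + h)
      - (I_K (\<sigma>\<^sub>c + shift\<^sub>c h) (\<tau>\<^sub>c + a) (j\<^sub>c + h) - w_K a h * y + u_K h * y\<^sup>2 + a4_K * y ^ 4))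
    \<in> O[nhds (0, 0, 0)](\<lambda>(y, a, h). \<bar>y\<bar> ^ 5 + (\<bar>a\<bar> + \<bar>h\<bar>) * \<bar>y\<bar> ^ 3 + (\<bar>a\<bar> + \<bar>h\<bar>)\<^sup>2 * \<bar>y\<bar>)"
proof -
  obtain K d where K: "K > 0" "d > 0"
    "\<And>y a h. \<bar>y\<bar> < d \<Longrightarrow> \<bar>a\<bar> < d \<Longrightarrow> \<bar>h\<bar> < d \<Longrightarrow>
      \<bar>I_K (\<sigma>\<^sub>c + shift\<^sub>c h + y) (\<tau>\<^sub>c + a) (j\<^sub>c + h)
        - (I_K (\<sigma>\<^sub>c + shift\<^sub>c h) (\<tau>\<^sub>c + a) (j\<^sub>c + h) - w_K a h * y + u_K h * y\<^sup>2 + a4_K * y ^ 4)\<bar>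
      \<le> K * (\<bar>y\<bar> ^ 5 + (\<bar>a\<bar> + \<bar>h\<bar>) * \<bar>y\<bar> ^ 3 + (\<bar>a\<bar> + \<bar>h\<bar>)\<^sup>2 * \<bar>y\<bar>)"
    using I_K_expansion by blast
  let ?S = "{- d<..<d} \<times> {- d<..<d} \<times> {- d<..<d}"
  have "\<forall>\<^sub>F p in nhds (0, 0, 0). p \<in> ?S"
    using K(2) by (intro eventually_nhds_in_open open_Times) auto
  then show ?thesis
  proof (intro bigoI[of _ K], eventually_elim)
    case (elim p)
    obtain y a h where p: "p = (y, a, h)" by (cases p)
    have "\<bar>y\<bar> < d" "\<bar>a\<bar> < d" "\<bar>h\<bar> < d" using elim by (auto simp: p)
    from K(3)[OF this] show ?case
      by (simp add: p add_ac)
  qed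
qed

lemma cubic_coefficient_bigo:
  "(\<lambda>(a, h). (deriv ^^ 3) (\<lambda>y. I_K (\<sigma>\<^sub>c + y + shift\<^sub>c h) (\<tau>\<^sub>c + a) (j\<^sub>c + h)) 0)
    \<in> O[nhds (0, 0)](\<lambda>(a, h). (\<bar>a\<bar> + \<bar>h\<bar>)\<^sup>2)"
proof -
  obtain K d where K: "K > 0" "d > 0"
    "\<And>a h. \<bar>a\<bar> < d \<Longrightarrow> \<bar>h\<bar> < d \<Longrightarrow>
      \<bar>mu3 (chi\<^sub>c + kap\<^sub>c * h) (j\<^sub>c + h) / (6 * pi ^ 3 * (\<tau>\<^sub>c + a))\<bar> \<le> K * (\<bar>a\<bar> + \<bar>h\<bar>)\<^sup>2"
    using expansion_coefficients by metis
  have "(snd \<longlongrightarrow> 0) (nhds (0 :: real, 0 :: real))"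
    using tendsto_snd[OF filterlim_ident] by force
  then have "((\<lambda>p. \<sigma>\<^sub>c + shift\<^sub>c (snd p)) \<longlongrightarrow> \<sigma>\<^sub>c + pi * kap\<^sub>c * 0) (nhds (0 :: real, 0 :: real))"
    unfolding shift\<^sub>c_def by (intro tendsto_intros)
  from order_tendstoD(1)[OF this, of 0]
  have pos: "\<forall>\<^sub>F p in nhds (0 :: real, 0). \<sigma>\<^sub>c + shift\<^sub>c (snd p) > 0"
    using \<sigma>\<^sub>c_pos by simp
  have "\<forall>\<^sub>F p in nhds (0, 0). p \<in> {- d<..<d} \<times> {- d<..<d}"
    using K(2) by (intro eventually_nhds_in_open open_Times) auto
  with pos show ?thesis
  \<comment> \<open>The factor 6 is 3!, relating the third derivative to the Taylor coefficient
    bounded by \<open>K\<close>.\<close>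
  proof (intro bigoI[of _ "6 * K"], eventually_elim)
    case (elim p)
    obtain a h where p: "p = (a, h)" by (cases p)
    have "\<bar>a\<bar> < d" "\<bar>h\<bar> < d" using elim by (auto simp: p)
    note bound = K(3)[OF this]
    have "(deriv ^^ 3) (\<lambda>y. I_K (\<sigma>\<^sub>c + shift\<^sub>c h + y) (\<tau>\<^sub>c + a) (j\<^sub>c + h)) 0
        = mu3 ((\<sigma>\<^sub>c + shift\<^sub>c h) / pi) (j\<^sub>c + h) / (pi ^ 3 * (\<tau>\<^sub>c + a))"
      using elim by (intro deriv3_I_K) (simp add: p)
    also have "(\<sigma>\<^sub>c + shift\<^sub>c h) / pi = chi\<^sub>c + kap\<^sub>c * h"
      using shift\<^sub>c_div_pi[of h 0] by simp
    also have "mu3 (chi\<^sub>c + kap\<^sub>c * h) (j\<^sub>c + h) / (pi ^ 3 * (\<tau>\<^sub>c + a))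
        = 6 * (mu3 (chi\<^sub>c + kap\<^sub>c * h) (j\<^sub>c + h) / (6 * pi ^ 3 * (\<tau>\<^sub>c + a)))"
      by simp
    finally have eq: "(deriv ^^ 3) (\<lambda>y. I_K (\<sigma>\<^sub>c + shift\<^sub>c h + y) (\<tau>\<^sub>c + a) (j\<^sub>c + h)) 0
        = 6 * (mu3 (chi\<^sub>c + kap\<^sub>c * h) (j\<^sub>c + h) / (6 * pi ^ 3 * (\<tau>\<^sub>c + a)))" .
    have comm: "(\<lambda>y. I_K (\<sigma>\<^sub>c + y + shift\<^sub>c h) (\<tau>\<^sub>c + a) (j\<^sub>c + h))
        = (\<lambda>y. I_K (\<sigma>\<^sub>c + shift\<^sub>c h + y) (\<tau>\<^sub>c + a) (j\<^sub>c + h))"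
      by (simp add: add_ac)
    show ?case
      unfolding p prod.case comm eq using bound by (simp only: real_norm_def abs_mult) simp
  qed
qed

theorem mainTheorem8:
  shows
    "(\<exists>(s :: real \<Rightarrow> real) (I_K0 :: real \<Rightarrow> real \<Rightarrow> real).
       (\<exists>A. s has_fps_expansion A) \<and>
       s \<in> O[nhds 0](\<lambda>\<Delta>j. \<Delta>j) \<and>
       (\<lambda>(\<Delta>\<tau>, \<Delta>j). (deriv ^^ 3) (\<lambda>y. I_K (\<sigma>\<^sub>c + y + s \<Delta>j) (\<tau>\<^sub>c + \<Delta>\<tau>) (j\<^sub>c + \<Delta>j)) 0)
         \<in> O[nhds (0, 0)](\<lambda>(\<Delta>\<tau>, \<Delta>j). (\<bar>\<Delta>\<tau>\<bar> + \<bar>\<Delta>j\<bar>)\<^sup>2) \<and>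
       (\<lambda>(y, \<Delta>\<tau>, \<Delta>j).
           I_K (\<sigma>\<^sub>c + y + s \<Delta>j) (\<tau>\<^sub>c + \<Delta>\<tau>) (j\<^sub>c + \<Delta>j)
           - (I_K0 (\<tau>\<^sub>c + \<Delta>\<tau>) (j\<^sub>c + \<Delta>j) - w_K \<Delta>\<tau> \<Delta>j * y + u_K \<Delta>j * y\<^sup>2 + a4_K * y ^ 4))
         \<in> O[nhds (0, 0, 0)](\<lambda>(y, \<Delta>\<tau>, \<Delta>j).
              \<bar>y\<bar> ^ 5 + (\<bar>\<Delta>\<tau>\<bar> + \<bar>\<Delta>j\<bar>) * \<bar>y\<bar> ^ 3 + (\<bar>\<Delta>\<tau>\<bar> + \<bar>\<Delta>j\<bar>)\<^sup>2 * \<bar>y\<bar>)) \<and>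
     (m_\<sigma>j \<sigma>\<^sub>c j\<^sub>c < 0) \<and>
     (m_\<sigma>\<sigma>j \<sigma>\<^sub>c j\<^sub>c > 0) \<and>
     (linear (\<lambda>(\<Delta>\<tau>, \<Delta>j). (w_K \<Delta>\<tau> \<Delta>j, u_K \<Delta>j))) \<and>
     (bij (\<lambda>(\<Delta>\<tau>, \<Delta>j). (w_K \<Delta>\<tau> \<Delta>j, u_K \<Delta>j))) \<and>
     (\<forall>\<Delta>\<tau> \<Delta>j. w_K \<Delta>\<tau> \<Delta>j = 0 \<longleftrightarrow> \<Delta>\<tau> = m_\<sigma>j \<sigma>\<^sub>c j\<^sub>c * \<Delta>j) \<and>
     (\<forall>\<Delta>\<tau> \<Delta>j. w_K \<Delta>\<tau> \<Delta>j = 0 \<and> \<Delta>j > 0 \<longrightarrow> u_K \<Delta>j > 0) \<and>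
     (\<forall>(L :: real) (l\<^sub>K :: real) (\<tau> :: real \<Rightarrow> real) (j :: real \<Rightarrow> real).
           L > 0 \<and> l\<^sub>K \<ge> 0 \<and>
           (\<forall>\<^sub>F g in at_right 0. \<tau> g - \<tau>\<^sub>c = m_\<sigma>j \<sigma>\<^sub>c j\<^sub>c * (j g - j\<^sub>c) \<and>
                               u_K (j g - j\<^sub>c) = l\<^sub>K * sqrt (a4_K * g))
           \<longrightarrow> (\<lambda>g. j g - j\<^sub>c) \<in> O[at_right 0](\<lambda>g. sqrt g) \<and>
               ((\<lambda>g. (F_avg L g (\<tau> g) (j g) - F_cl L g (\<tau> g) (j g)) / T_E L (\<tau> g))
                  \<longlongrightarrow> \<Phi> l\<^sub>K) (at_right 0)) \<and>
     (\<Phi> 0 = 1 / 4) \<and>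
     ((\<Phi> \<longlongrightarrow> 1 / 2) at_top)"
proof (intro conjI)
  let ?b = "m_\<sigma>j \<sigma>\<^sub>c j\<^sub>c"
  show "\<exists>(s :: real \<Rightarrow> real) (I_K0 :: real \<Rightarrow> real \<Rightarrow> real).
       (\<exists>A. s has_fps_expansion A) \<and>
       s \<in> O[nhds 0](\<lambda>\<Delta>j. \<Delta>j) \<and>
       (\<lambda>(\<Delta>\<tau>, \<Delta>j). (deriv ^^ 3) (\<lambda>y. I_K (\<sigma>\<^sub>c + y + s \<Delta>j) (\<tau>\<^sub>c + \<Delta>\<tau>) (j\<^sub>c + \<Delta>j)) 0)
         \<in> O[nhds (0, 0)](\<lambda>(\<Delta>\<tau>, \<Delta>j). (\<bar>\<Delta>\<tau>\<bar> + \<bar>\<Delta>j\<bar>)\<^sup>2) \<and>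
       (\<lambda>(y, \<Delta>\<tau>, \<Delta>j).
           I_K (\<sigma>\<^sub>c + y + s \<Delta>j) (\<tau>\<^sub>c + \<Delta>\<tau>) (j\<^sub>c + \<Delta>j)
           - (I_K0 (\<tau>\<^sub>c + \<Delta>\<tau>) (j\<^sub>c + \<Delta>j) - w_K \<Delta>\<tau> \<Delta>j * y + u_K \<Delta>j * y\<^sup>2 + a4_K * y ^ 4))
         \<in> O[nhds (0, 0, 0)](\<lambda>(y, \<Delta>\<tau>, \<Delta>j).
              \<bar>y\<bar> ^ 5 + (\<bar>\<Delta>\<tau>\<bar> + \<bar>\<Delta>j\<bar>) * \<bar>y\<bar> ^ 3 + (\<bar>\<Delta>\<tau>\<bar> + \<bar>\<Delta>j\<bar>)\<^sup>2 * \<bar>y\<bar>)"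
  proof (intro exI conjI)
    show "shift\<^sub>c has_fps_expansion fps_const (pi * kap\<^sub>c) * fps_X"
      unfolding shift\<^sub>c_def [abs_def] by (intro fps_expansion_intros)
    show "shift\<^sub>c \<in> O[nhds 0](\<lambda>\<Delta>j. \<Delta>j)"
      unfolding shift\<^sub>c_def [abs_def] by simp
    show "(\<lambda>(\<Delta>\<tau>, \<Delta>j). (deriv ^^ 3) (\<lambda>y. I_K (\<sigma>\<^sub>c + y + shift\<^sub>c \<Delta>j) (\<tau>\<^sub>c + \<Delta>\<tau>) (j\<^sub>c + \<Delta>j)) 0)
         \<in> O[nhds (0, 0)](\<lambda>(\<Delta>\<tau>, \<Delta>j). (\<bar>\<Delta>\<tau>\<bar> + \<bar>\<Delta>j\<bar>)\<^sup>2)"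
      by (rule cubic_coefficient_bigo)
    \<comment> \<open>The witness for \<open>I_K0\<close> is the action at the translated centre,
      written with \<open>j - j\<^sub>c\<close> so that it depends on \<open>\<tau>\<close> and
      \<open>j\<close> only.\<close>
    show "(\<lambda>(y, \<Delta>\<tau>, \<Delta>j).
           I_K (\<sigma>\<^sub>c + y + shift\<^sub>c \<Delta>j) (\<tau>\<^sub>c + \<Delta>\<tau>) (j\<^sub>c + \<Delta>j)
           - ((\<lambda>\<tau> j. I_K (\<sigma>\<^sub>c + shift\<^sub>c (j - j\<^sub>c)) \<tau> j) (\<tau>\<^sub>c + \<Delta>\<tau>) (j\<^sub>c + \<Delta>j)
              - w_K \<Delta>\<tau> \<Delta>j * y + u_K \<Delta>j * y\<^sup>2 + a4_K * y ^ 4))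
         \<in> O[nhds (0, 0, 0)](\<lambda>(y, \<Delta>\<tau>, \<Delta>j).
              \<bar>y\<bar> ^ 5 + (\<bar>\<Delta>\<tau>\<bar> + \<bar>\<Delta>j\<bar>) * \<bar>y\<bar> ^ 3 + (\<bar>\<Delta>\<tau>\<bar> + \<bar>\<Delta>j\<bar>)\<^sup>2 * \<bar>y\<bar>)"
      using I_K_expansion_bigo by simp
  qed
  show "?b < 0" by (rule m_\<sigma>j_neg)
  show "m_\<sigma>\<sigma>j \<sigma>\<^sub>c j\<^sub>c > 0" by (rule m_\<sigma>\<sigma>j_pos)
  show "linear (\<lambda>(\<Delta>\<tau>, \<Delta>j). (w_K \<Delta>\<tau> \<Delta>j, u_K \<Delta>j))"
    by (rule linearI) (auto simp: w_K_def u_K_def algebra_simps add_divide_distrib diff_divide_distrib)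
  show "bij (\<lambda>(\<Delta>\<tau>, \<Delta>j). (w_K \<Delta>\<tau> \<Delta>j, u_K \<Delta>j))"
  proof (rule o_bij)
    let ?c = "m_\<sigma>\<sigma>j \<sigma>\<^sub>c j\<^sub>c"
    let ?inv = "\<lambda>(w, u). (\<tau>\<^sub>c * w + ?b * (2 * \<tau>\<^sub>c * u / ?c), 2 * \<tau>\<^sub>c * u / ?c)"
    show "?inv \<circ> (\<lambda>(\<Delta>\<tau>, \<Delta>j). (w_K \<Delta>\<tau> \<Delta>j, u_K \<Delta>j)) = id"
      using \<tau>\<^sub>c_pos m_\<sigma>\<sigma>j_pos by (auto simp: fun_eq_iff w_K_def u_K_def)
    show "(\<lambda>(\<Delta>\<tau>, \<Delta>j). (w_K \<Delta>\<tau> \<Delta>j, u_K \<Delta>j)) \<circ> ?inv = id"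
      using \<tau>\<^sub>c_pos m_\<sigma>\<sigma>j_pos by (auto simp: fun_eq_iff w_K_def u_K_def)
  qed
  show "\<forall>\<Delta>\<tau> \<Delta>j. w_K \<Delta>\<tau> \<Delta>j = 0 \<longleftrightarrow> \<Delta>\<tau> = ?b * \<Delta>j"
    using \<tau>\<^sub>c_pos by (auto simp: w_K_def)
  show "\<forall>\<Delta>\<tau> \<Delta>j. w_K \<Delta>\<tau> \<Delta>j = 0 \<and> \<Delta>j > 0 \<longrightarrow> u_K \<Delta>j > 0"
    using \<tau>\<^sub>c_pos m_\<sigma>\<sigma>j_pos by (auto simp: u_K_def)
  show "\<forall>(L :: real) (l\<^sub>K :: real) (\<tau> :: real \<Rightarrow> real) (j :: real \<Rightarrow> real).
           L > 0 \<and> l\<^sub>K \<ge> 0 \<and>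
           (\<forall>\<^sub>F g in at_right 0. \<tau> g - \<tau>\<^sub>c = m_\<sigma>j \<sigma>\<^sub>c j\<^sub>c * (j g - j\<^sub>c) \<and>
                               u_K (j g - j\<^sub>c) = l\<^sub>K * sqrt (a4_K * g))
           \<longrightarrow> (\<lambda>g. j g - j\<^sub>c) \<in> O[at_right 0](\<lambda>g. sqrt g) \<and>
               ((\<lambda>g. (F_avg L g (\<tau> g) (j g) - F_cl L g (\<tau> g) (j g)) / T_E L (\<tau> g))
                  \<longlongrightarrow> \<Phi> l\<^sub>K) (at_right 0)"
  proof (intro allI impI, elim conjE)
    fix L l :: real and \<tau> j :: "real \<Rightarrow> real"
    assume L: "L > 0" and l: "l \<ge> 0"
      and tangent: "\<forall>\<^sub>F g in at_right 0. \<tau> g - \<tau>\<^sub>c = ?b * (j g - j\<^sub>c) \<and> u_K (j g - j\<^sub>c) = l * sqrt (a4_K * g)"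
    \<comment> \<open>Since \<open>u_K\<close> is injective, the two conditions eventually determine
      \<open>j g\<close> and then \<open>\<tau> g\<close>, so the given families may be replaced by
      the explicit ones.\<close>
    from tangent have eq: "\<forall>\<^sub>F g in at_right 0. j g - j\<^sub>c = dj l g \<and> \<tau> g = \<tau>_tan l g \<and> j g = j_tan l g"
    proof eventually_elim
      case (elim g)
      then have "j g - j\<^sub>c = dj l g" by (simp only: u_K_eq_iff)
      with elim show ?case by (simp add: \<tau>_tan_def j_tan_def algebra_simps)
    qed
    have "(\<lambda>g. j g - j\<^sub>c) \<in> O[at_right 0](sqrt) \<longleftrightarrow> dj l \<in> O[at_right 0](sqrt)"
      using eq by (intro landau_o.big.in_cong) (auto elim: eventually_mono)
    moreover have "dj l \<in> O[at_right 0](sqrt)"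
      by (rule bigoI[of _ "\<bar>2 * \<tau>\<^sub>c * l * sqrt a4_K / m_\<sigma>\<sigma>j \<sigma>\<^sub>c j\<^sub>c\<bar>"])
        (simp add: dj_def abs_mult)
    ultimately have "(\<lambda>g. j g - j\<^sub>c) \<in> O[at_right 0](sqrt)"
      by (simp only:)
    moreover have "((\<lambda>g. (F_avg L g (\<tau> g) (j g) - F_cl L g (\<tau> g) (j g)) / T_E L (\<tau> g)) \<longlongrightarrow> \<Phi> l) (at_right 0)
      \<longleftrightarrow> ((\<lambda>g. (F_avg L g (\<tau>_tan l g) (j_tan l g) - F_cl L g (\<tau>_tan l g) (j_tan l g)) / T_E L (\<tau>_tan l g))
        \<longlongrightarrow> \<Phi> l) (at_right 0)"
      using eq by (intro filterlim_cong refl) (auto elim: eventually_mono)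
    ultimately show "(\<lambda>g. j g - j\<^sub>c) \<in> O[at_right 0](\<lambda>g. sqrt g) \<and>
        ((\<lambda>g. (F_avg L g (\<tau> g) (j g) - F_cl L g (\<tau> g) (j g)) / T_E L (\<tau> g)) \<longlongrightarrow> \<Phi> l) (at_right 0)"
      using crossover_limit[OF l L] by simp
  qed
  show "\<Phi> 0 = 1 / 4" by (rule \<Phi>_0)
  show "(\<Phi> \<longlongrightarrow> 1 / 2) at_top" by (rule \<Phi>_at_top)
qed

end
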